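(* Let $\mathbb G$ be a stratified group with a homogeneous distance $d$, and let $\Sigma\subset\mathbb G$ be a $p$-dimensional $C^1$ smooth transversal submanifold. Then the Hausdorff dimension of $\Sigma$ with respect to $d$ is equal to $$D(p)=\sum_{j=\ell+1}^\iota j\,n_j+\ell\Big(p-\sum_{j=\ell+1}^\iota n_j\Big),\qquad \ell=\ell(p)=d_{n+1-p}.$$
   Context: Stratified group: a connected, simply connected nilpotent Lie group $\mathbb G$ with Lie algebra $\mathcal G=V_1\oplus\dots\oplus V_\iota$, $V_{i+1}=[V_1,V_i]$ for $i\ge1$, $V_{\iota+1}=\{0\}$. Put $n_j=\dim V_j$, $m_0=0$, $m_j=n_1+\dots+n_j$, $n=m_\iota$; the degree $d_j$ of $j\in\{1,\dots,n\}$ is defined by $m_{d_j-1}<j\le m_{d_j}$. A graded metric $g$ (left invariant Riemannian metric with the $V_k$ mutually orthogonal) is fixed; a graded basis $(X_1,\dots,X_n)$ is a $g$-orthonormal basis of $\mathcal G$ such that $X_{m_{j-1}+1},\dots,X_{m_j}$ is a basis of $V_j$ for all $j$. $\mathbb G$ is identified with $\mathbb R^n$ via $(x_1,\dots,x_n)\leftrightarrow\exp(\sum_i x_iX_i)$. Dilations: $\delta_r(x_1,\dots,x_n)=(r^{d_1}x_1,\dots,r^{d_n}x_n)$. A homogeneous distance $d$ is a continuous distance on $\mathbb G$ with $d(zx,zy)=d(x,y)$ and $d(\delta_rx,\delta_ry)=r\,d(x,y)$ for all $x,y,z$, $r>0$. $I_p$ is the set of $\alpha=(\alpha_1,\dots,\alpha_p)$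 with $1\le\alpha_1<\dots<\alpha_p\le n$, $d(\alpha)=d_{\alpha_1}+\dots+d_{\alpha_p}$; $D(p)$ is the maximum of $d(\alpha)$ over $\alpha\in I_p$. For $x\in\Sigma$ and a tangent $p$-vector $\tau_\Sigma(x)=\sum_{\alpha\in I_p}c_\alpha\,(X_{\alpha_1}\wedge\dots\wedge X_{\alpha_p})(x)$ (wedge of the vectors of a basis of $T_x\Sigma$), the degree of $\Sigma$ at $x$ is $d_\Sigma(x)=\max\{d(\alpha):c_\alpha\ne0\}$. $\Sigma$ is transversal if $\max_{x\in\Sigma}d_\Sigma(x)=D(p)$, i.e. if it contains at least one point of degree $D(p)$. Submanifolds are second countable. *)

theory Defs
  imports "HOL-Analysis.Analysis"
begin

section \<open>Smooth maps\<close>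

text \<open>\<open>Ck k f\<close>: the map \<open>f\<close> is of class \<open>C\<^sup>k\<close> on the whole space, i.e. it is differentiable and all its
  directional derivatives are of class \<open>C\<^sup>(\<^sup>k\<^sup>-\<^sup>1\<^sup>)\<close>.\<close>

primrec Ck :: "nat \<Rightarrow> ('a::euclidean_space \<Rightarrow> 'b::euclidean_space) \<Rightarrow> bool" where
  "Ck 0 f \<longleftrightarrow> continuous_on UNIV f"
| "Ck (Suc k) f \<longleftrightarrow>
     f differentiable_on UNIV \<and> (\<forall>v. Ck k (\<lambda>x. frechet_derivative f (at x) v))"

definition smooth :: "('a::euclidean_space \<Rightarrow> 'b::euclidean_space) \<Rightarrow> bool" where
  "smooth f \<longleftrightarrow> (\<forall>k. Ck k f)"

section \<open>Stratified groups in exponential coordinates\<close>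

text \<open>A connected, simply connected nilpotent Lie group is identified with its Lie algebra
  \<open>'a\<close> by means of the exponential map, so that a group is given by a smooth group law \<open>mul\<close> on \<open>'a\<close>
  whose exponential map is the identity: \<open>t \<mapsto> t x\<close> is the one-parameter subgroup with initial
  velocity \<open>x\<close>.  In particular the unit element is \<open>0\<close> and the inverse of \<open>x\<close> is \<open>- x\<close>.
  The inner product of \<open>'a\<close> plays the role of the graded metric (at the unit element).\<close>

definition exponential_lie_group :: "('a::euclidean_space \<Rightarrow> 'a \<Rightarrow> 'a) \<Rightarrow> bool" where
  "exponential_lie_group mul \<longleftrightarrow>
     group mul 0 uminus \<and>
     smooth (\<lambda>(x, y). mul x y) \<and>
     (\<forall>x s t. mul (s *\<^sub>R x) (t *\<^sub>R x) = (s + t) *\<^sub>R x)"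

text \<open>The left invariant vector field whose value at the unit element is \<open>v\<close>.\<close>

definition left_inv_field :: "('a::euclidean_space \<Rightarrow> 'a \<Rightarrow> 'a) \<Rightarrow> 'a \<Rightarrow> 'a \<Rightarrow> 'a" where
  "left_inv_field mul v x = frechet_derivative (mul x) (at 0) v"

definition vf_bracket :: "('a::euclidean_space \<Rightarrow> 'a) \<Rightarrow> ('a \<Rightarrow> 'a) \<Rightarrow> 'a \<Rightarrow> 'a" where
  "vf_bracket F G x = frechet_derivative G (at x) (F x) - frechet_derivative F (at x) (G x)"

definition lie_bracket :: "('a::euclidean_space \<Rightarrow> 'a \<Rightarrow> 'a) \<Rightarrow> 'a \<Rightarrow> 'a \<Rightarrow> 'a" where
  "lie_bracket mul v w = vf_bracket (left_inv_field mul v) (left_inv_field mul w) 0"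

text \<open>Only \<open>V 1, V 2, \<dots>\<close> are relevant.  The sum of the layers is direct because they are
  mutually orthogonal, and nilpotency follows from \<open>V (Suc \<iota>) = {0}\<close>.\<close>

definition stratified_group ::
  "('a::euclidean_space \<Rightarrow> 'a \<Rightarrow> 'a) \<Rightarrow> (nat \<Rightarrow> 'a set) \<Rightarrow> nat \<Rightarrow> bool" where
  "stratified_group mul V \<iota> \<longleftrightarrow>
     exponential_lie_group mul \<and>
     (\<forall>i\<ge>1. subspace (V i)) \<and>
     span (\<Union>i\<in>{1..\<iota>}. V i) = UNIV \<and>
     (\<forall>i\<in>{1..\<iota>}. \<forall>j\<in>{1..\<iota>}. i \<noteq> j \<longrightarrow> (\<forall>v\<in>V i. \<forall>w\<in>V j. v \<bullet> w = 0)) \<and>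
     (\<forall>i\<ge>1. V (Suc i) = span {lie_bracket mul v w | v w. v \<in> V 1 \<and> w \<in> V i}) \<and>
     V (Suc \<iota>) = {0}"

definition layer_sum :: "(nat \<Rightarrow> 'a::euclidean_space set) \<Rightarrow> nat \<Rightarrow> nat" where
  "layer_sum V j = (\<Sum>i=1..j. dim (V i))"

definition deg :: "(nat \<Rightarrow> 'a::euclidean_space set) \<Rightarrow> nat \<Rightarrow> nat" where
  "deg V j = (THE k. layer_sum V (k - 1) < j \<and> j \<le> layer_sum V k)"

text \<open>The elements \<open>X 1, \<dots>, X n\<close> with \<open>n = DIM('a)\<close> form a graded orthonormal basis;
  the corresponding left invariant vector fields are \<open>left_inv_field mul (X j)\<close>.\<close>

definition graded_basis ::
  "(nat \<Rightarrow> 'a::euclidean_space set) \<Rightarrow> nat \<Rightarrow> (nat \<Rightarrow> 'a) \<Rightarrow> bool" where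
  "graded_basis V \<iota> X \<longleftrightarrow>
     (\<forall>i\<in>{1..DIM('a)}. \<forall>j\<in>{1..DIM('a)}. X i \<bullet> X j = (if i = j then 1 else 0)) \<and>
     (\<forall>j\<in>{1..\<iota>}. V j = span (X ` {layer_sum V (j - 1) + 1..layer_sum V j}))"

definition dilation ::
  "(nat \<Rightarrow> 'a::euclidean_space set) \<Rightarrow> (nat \<Rightarrow> 'a) \<Rightarrow> real \<Rightarrow> 'a \<Rightarrow> 'a" where
  "dilation V X r x = (\<Sum>i=1..DIM('a). (r ^ deg V i * (x \<bullet> X i)) *\<^sub>R X i)"

definition homogeneous_distance ::
  "('a::euclidean_space \<Rightarrow> 'a \<Rightarrow> 'a) \<Rightarrow> (nat \<Rightarrow> 'a set) \<Rightarrow> (nat \<Rightarrow> 'a) \<Rightarrow> ('a \<Rightarrow> 'a \<Rightarrow> real) \<Rightarrow> bool"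
  where
  "homogeneous_distance mul V X d \<longleftrightarrow>
     Metric_space UNIV d \<and>
     continuous_on UNIV (\<lambda>(x, y). d x y) \<and>
     (\<forall>x y z. d (mul z x) (mul z y) = d x y) \<and>
     (\<forall>x y. \<forall>r>0. d (dilation V X r x) (dilation V X r y) = r * d x y)"

section \<open>Submanifolds\<close>

text \<open>A \<open>C\<^sup>1\<close> parametrization of an open piece of a set carrying the manifold topology \<open>T\<close>.\<close>

definition C1_param ::
  "'a::euclidean_space topology \<Rightarrow> (real ^ 'p) set \<Rightarrow> (real ^ 'p::finite \<Rightarrow> 'a) \<Rightarrow>
   (real ^ 'p \<Rightarrow> (real ^ 'p) \<Rightarrow>\<^sub>L 'a) \<Rightarrow> bool" where
  "C1_param T W \<phi> \<phi>' \<longleftrightarrow>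
     open W \<and> openin T (\<phi> ` W) \<and>
     homeomorphic_map (top_of_set W) (subtopology T (\<phi> ` W)) \<phi> \<and>
     (\<forall>w\<in>W. (\<phi> has_derivative blinfun_apply (\<phi>' w)) (at w) \<and> inj (blinfun_apply (\<phi>' w))) \<and>
     continuous_on W \<phi>'"

text \<open>\<open>S\<close> is a second countable \<open>C\<^sup>1\<close> submanifold of dimension \<open>CARD('p)\<close>, with manifold
  topology \<open>T\<close>.  Embedded submanifolds are those with \<open>T = top_of_set S\<close>; for immersed ones \<open>T\<close> is
  finer.  The charts are automatically \<open>C\<^sup>1\<close> compatible and \<open>T\<close> is Hausdorff.\<close>

definition C1_submanifold ::
  "'p::finite itself \<Rightarrow> 'a::euclidean_space set \<Rightarrow> 'a topology \<Rightarrow> bool" where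
  "C1_submanifold P S T \<longleftrightarrow>
     topspace T = S \<and> continuous_map T euclidean (\<lambda>x. x) \<and> second_countable T \<and>
     (\<forall>x\<in>S. \<exists>W (\<phi> :: real ^ 'p \<Rightarrow> 'a) \<phi>'. C1_param T W \<phi> \<phi>' \<and> x \<in> \<phi> ` W)"

definition tangent_space ::
  "'p::finite itself \<Rightarrow> 'a::euclidean_space topology \<Rightarrow> 'a \<Rightarrow> 'a set" where
  "tangent_space P T x =
     {v. \<exists>W (\<phi> :: real ^ 'p \<Rightarrow> 'a) \<phi>' w h.
           C1_param T W \<phi> \<phi>' \<and> w \<in> W \<and> \<phi> w = x \<and> v = blinfun_apply (\<phi>' w) h}"

section \<open>Multivectors and degrees\<close>

text \<open>The simple \<open>p\<close>-vector \<open>v\<^sub>1 \<and> \<dots> \<and> v\<^sub>p\<close>, regarded as usual as an alternating form on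
  \<open>p\<close>-tuples of covectors, \<open>(\<xi>\<^sub>1, \<dots>, \<xi>\<^sub>p) \<mapsto> det (\<xi>\<^sub>j (v\<^sub>i))\<close>, where the covectors \<open>\<xi>\<^sub>j\<close> are represented
  by vectors \<open>u\<^sub>j\<close> through the inner product.  The determinant is written out by the Leibniz formula.\<close>

definition wedge :: "nat \<Rightarrow> (nat \<Rightarrow> 'a::euclidean_space) \<Rightarrow> (nat \<Rightarrow> 'a) \<Rightarrow> real" where
  "wedge p v u = (\<Sum>\<pi> | \<pi> permutes {1..p}. of_int (sign \<pi>) * (\<Prod>i=1..p. v i \<bullet> u (\<pi> i)))"

definition multi_indices :: "nat \<Rightarrow> nat \<Rightarrow> (nat \<Rightarrow> nat) set" where
  "multi_indices n p = {\<alpha> \<in> {1..p} \<rightarrow>\<^sub>E {1..n}. strict_mono_on {1..p} \<alpha>}"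

definition multi_deg :: "(nat \<Rightarrow> 'a::euclidean_space set) \<Rightarrow> nat \<Rightarrow> (nat \<Rightarrow> nat) \<Rightarrow> nat" where
  "multi_deg V p \<alpha> = (\<Sum>i=1..p. deg V (\<alpha> i))"

definition max_deg :: "(nat \<Rightarrow> 'a::euclidean_space set) \<Rightarrow> nat \<Rightarrow> nat" where
  "max_deg V p = Max (multi_deg V p ` multi_indices DIM('a) p)"

text \<open>The coefficients \<open>c\<close> are unique for a given basis \<open>v\<close> of the tangent space, and a change of
  basis multiplies them by a common nonzero factor; so the degree is well defined.\<close>

definition point_deg ::
  "'p::finite itself \<Rightarrow> ('a::euclidean_space \<Rightarrow> 'a \<Rightarrow> 'a) \<Rightarrow> (nat \<Rightarrow> 'a set) \<Rightarrow> (nat \<Rightarrow> 'a) \<Rightarrow>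
   'a topology \<Rightarrow> 'a \<Rightarrow> nat" where
  "point_deg P mul V X T x = (THE k. \<exists>v c.
     inj_on v {1..CARD('p)} \<and> independent (v ` {1..CARD('p)}) \<and>
     span (v ` {1..CARD('p)}) = tangent_space P T x \<and>
     wedge CARD('p) v =
       (\<lambda>u. \<Sum>\<alpha>\<in>multi_indices DIM('a) CARD('p).
              c \<alpha> * wedge CARD('p) (\<lambda>i. left_inv_field mul (X (\<alpha> i)) x) u) \<and>
     k = Max {multi_deg V CARD('p) \<alpha> | \<alpha>. \<alpha> \<in> multi_indices DIM('a) CARD('p) \<and> c \<alpha> \<noteq> 0})"

definition transversal ::
  "'p::finite itself \<Rightarrow> ('a::euclidean_space \<Rightarrow> 'a \<Rightarrow> 'a) \<Rightarrow> (nat \<Rightarrow> 'a set) \<Rightarrow> (nat \<Rightarrow> 'a) \<Rightarrow>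
   'a set \<Rightarrow> 'a topology \<Rightarrow> bool" where
  "transversal P mul V X S T \<longleftrightarrow> (\<exists>x\<in>S. point_deg P mul V X T x = max_deg V CARD('p))"

section \<open>Hausdorff dimension with respect to a distance\<close>

text \<open>\<open>diam(E)\<^sup>s\<close> with the conventions that the empty set contributes \<open>0\<close> and that \<open>0\<^sup>0 = 1\<close>
  (whereas \<open>0 powr 0 = 0\<close>).  It is only used for sets that are bounded with respect to \<open>d\<close>.\<close>

definition diam_power :: "('a \<Rightarrow> 'a \<Rightarrow> real) \<Rightarrow> real \<Rightarrow> 'a set \<Rightarrow> ennreal" where
  "diam_power d s E =
     (if E = {} then 0 else if s = 0 then 1
      else ennreal ((SUP (x, y)\<in>E \<times> E. d x y) powr s))"

definition hausdorff_premeasure ::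
  "('a \<Rightarrow> 'a \<Rightarrow> real) \<Rightarrow> real \<Rightarrow> real \<Rightarrow> 'a set \<Rightarrow> ennreal" where
  "hausdorff_premeasure d s \<epsilon> A =
     (INF E \<in> {E :: nat \<Rightarrow> 'a set. A \<subseteq> (\<Union>i. E i) \<and> (\<forall>i. \<forall>x\<in>E i. \<forall>y\<in>E i. d x y \<le> \<epsilon>)}.
        \<Sum>i. diam_power d s (E i))"

definition hausdorff_measure :: "('a \<Rightarrow> 'a \<Rightarrow> real) \<Rightarrow> real \<Rightarrow> 'a set \<Rightarrow> ennreal" where
  "hausdorff_measure d s A = (SUP \<epsilon>\<in>{0<..}. hausdorff_premeasure d s \<epsilon> A)"

definition hausdorff_dim :: "('a \<Rightarrow> 'a \<Rightarrow> real) \<Rightarrow> 'a set \<Rightarrow> ereal" where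
  "hausdorff_dim d A = (INF s\<in>{s. 0 \<le> s \<and> hausdorff_measure d s A = 0}. ereal s)"

end

(*
  Upper bound.  If q has vanishing coordinates of degree < k, then left translation by q acts
  additively on the coordinates of degree at most k.  Hence a Euclidean ball of radius r^l can be cut
  into about r^(-sum_{j>l} (j-l) n_j) pieces of d-diameter at most C r: for k = l+1, ..., iota one
  reduces the coordinates of degree k from size r^l to size r^k by translating with a grid in V_k.
  A compact piece of Sigma is covered by about r^(-l p) balls of radius r^l, and the exponents add up
  to D(p) when l = l(p).

  Lower bound.  If the coefficient c_alpha is nonzero at a point of degree d(alpha), then the alpha
  coordinates of phi(w)^(-1) phi(w') are, near that point, expanding in w' uniformly in w.  On a
  d-ball of radius r they are bounded by C r^(d_(alpha_i)), so such a ball contains at most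
  C r^(d(alpha)) of the Lebesgue measure of the chart.

  The additivity statement avoids the Baker-Campbell-Hausdorff formula: W(t) = t (dL_{-tz})_{tz}(u)
  satisfies W' = u - [z, W], which shows inductively that the left invariant fields agree with
  constant ones modulo the next term of the filtration by degree.
*)
theory Submission
  imports Defs
begin

section \<open>Lie groups in exponential coordinates\<close>

text \<open>The exponent l p + sum_{j>l} (j - l) n_j of the covering is convex in l: its increment
  from l to l + 1 is p minus the sum of n_j over j > l. So it is minimal at l(p), where it equals
  the sum of the p largest degrees. Coordinates of degree j <= l need no cutting, since r^l <= r^j;
  the others are treated in increasing degree, because a translation in V_k has uncontrolled effects
  only in degrees above k, where the size is still O(r^l).

  The covering works in every chart, whatever the degrees of its points; transversality supplies the
  one point at which the lower bound reaches the same exponent. The obstacle there is that the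
  coordinates of phi(w)^(-1) phi(w') change with the centre w of the ball. One injective linear map,
  and a neighbourhood on which all derivatives stay close to it, give a constant for all centres.
  The expanding map is not inverted: cubes are counted.

  The group enters as a smooth law and a bracket of vector fields, so conjugation is first related
  to this bracket; Jacobi's identity comes from the same relation.\<close>

lemma has_vector_derivative_iff_lim:
  "(f has_vector_derivative D) (at x) \<longleftrightarrow> ((\<lambda>h. (1 / h) *\<^sub>R (f (x + h) - f x)) \<longlongrightarrow> D) (at 0)"
proof -
  have "((\<lambda>h. (1 / h) *\<^sub>R (f (x + h) - f x)) \<longlongrightarrow> D) (at 0) \<longleftrightarrow>
      ((\<lambda>h. norm ((1 / h) *\<^sub>R (f (x + h) - f x) - D)) \<longlongrightarrow> 0) (at 0)"
    by (simp add: LIM_zero_iff tendsto_norm_zero_iff)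
  also have "\<dots> \<longleftrightarrow> ((\<lambda>h. norm (f (x + h) - f x - h *\<^sub>R D) / norm h) \<longlongrightarrow> 0) (at 0)"
  proof (rule filterlim_cong [OF refl refl])
    have "norm ((1 / h) *\<^sub>R (f (x + h) - f x) - D) = norm (f (x + h) - f x - h *\<^sub>R D) / norm h"
      if "h \<noteq> 0" for h
    proof -
      have "(1 / h) *\<^sub>R (f (x + h) - f x) - D = (1 / h) *\<^sub>R (f (x + h) - f x - h *\<^sub>R D)"
        using that by (simp add: scaleR_diff_right)
      then show ?thesis by simp
    qed
    then show "\<forall>\<^sub>F h in at 0. norm ((1 / h) *\<^sub>R (f (x + h) - f x) - D) = norm (f (x + h) - f x - h *\<^sub>R D) / norm h"
      by (auto simp: eventually_at_filter)
  qed
  also have "\<dots> \<longleftrightarrow> (f has_vector_derivative D) (at x)"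
    by (simp add: has_vector_derivative_def has_derivative_at bounded_linear_scaleR_left)
  finally show ?thesis by simp
qed

locale exp_lie_group =
  fixes mul :: "'a::euclidean_space \<Rightarrow> 'a \<Rightarrow> 'a"
  assumes exponential: "exponential_lie_group mul"
begin

sublocale group mul 0 uminus
  using exponential by (simp add: exponential_lie_group_def)

lemma smooth_mul: "smooth (\<lambda>(x, y). mul x y)"
  using exponential by (simp add: exponential_lie_group_def)

lemma mul_scaleR: "mul (s *\<^sub>R x) (t *\<^sub>R x) = (s + t) *\<^sub>R x"
  using exponential by (simp add: exponential_lie_group_def)

lemma mul_neg [simp]: "mul x (mul (- x) y) = y" "mul (- x) (mul x y) = y"
  by (simp_all add: assoc [symmetric])

lemma neg_mul: "- mul x y = mul (- y) (- x)"
  by (rule inverse_distrib_swap)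

section \<open>The derivative of multiplication\<close>

definition D :: "'a \<times> 'a \<Rightarrow> 'a \<times> 'a \<Rightarrow> 'a" where
  "D q = frechet_derivative (\<lambda>(x, y). mul x y) (at q)"

lemma has_derivative_mul: "((\<lambda>(x, y). mul x y) has_derivative D q) (at q)"
proof -
  have "Ck 1 (\<lambda>(x, y). mul x y)"
    using smooth_mul by (simp add: smooth_def)
  then show ?thesis
    unfolding D_def One_nat_def Ck.simps differentiable_on_def
    by (metis (no_types, lifting) UNIV_I frechet_derivative_works)
qed

lemma linear_D: "linear (D q)"
  using has_derivative_mul has_derivative_linear by blast

lemma D_differentiable: "(\<lambda>q. D q v) differentiable (at q)"
proof -
  \<comment> \<open>Order two is needed: the bracket differentiates left invariant fields, which are
    themselves derivatives of \<open>mul\<close>.\<close>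
  have "Ck (Suc (Suc 0)) (\<lambda>(x, y). mul x y)"
    using smooth_mul by (simp only: smooth_def)
  then show ?thesis
    unfolding Ck.simps differentiable_on_def D_def by blast
qed

text \<open>Linearity in \<open>v\<close> reduces joint continuity of \<open>D q v\<close> to
  continuity in \<open>q\<close> for each of the finitely many basis vectors.\<close>

lemma D_expand: "D q v = (\<Sum>b\<in>Basis. (v \<bullet> b) *\<^sub>R D q b)"
  by (metis (no_types, lifting) euclidean_representation linear_D linear_scale linear_sum sum.cong)

lemma continuous_D: "continuous_on UNIV (\<lambda>(q, v). D q v)"
proof -
  have 1: "continuous_on UNIV (\<lambda>q. D q b)" for b
    by (simp add: D_differentiable differentiable_imp_continuous_on differentiable_on_def)
  show ?thesis
    unfolding case_prod_unfold
    by (subst D_expand, intro continuous_intros continuous_on_compose2 [OF 1]) auto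
qed

lemma continuous_on_D [continuous_intros]:
  assumes "continuous_on S f" "continuous_on S g"
  shows "continuous_on S (\<lambda>x. D (f x) (g x))"
  using continuous_on_compose2 [OF continuous_D continuous_on_Pair [OF assms]] by auto

lemma continuous_on_mul [continuous_intros]:
  assumes "continuous_on S f" "continuous_on S g"
  shows "continuous_on S (\<lambda>x. mul (f x) (g x))"
proof -
  have "continuous_on UNIV (\<lambda>(x, y). mul x y)"
    by (meson differentiable_at_imp_differentiable_on differentiable_imp_continuous_on
        has_derivative_mul differentiable_def)
  from continuous_on_compose2 [OF this continuous_on_Pair [OF assms]] show ?thesis by auto
qed

lemma has_derivative_mul_compose [derivative_intros]:
  assumes "(f has_derivative f') (at x within S)" "(g has_derivative g') (at x within S)"
  shows "((\<lambda>x. mul (f x) (g x)) has_derivative (\<lambda>h. D (f x, g x) (f' h, g' h))) (at x within S)"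
  using has_derivative_compose [OF has_derivative_Pair [OF assms] has_derivative_mul] by auto

lemma D_zero_left: "D (0, y) (0, v) = v"
proof -
  have "((\<lambda>y. mul 0 y) has_derivative (\<lambda>v. D (0, y) (0, v))) (at y)"
    by (rule has_derivative_mul_compose) (auto intro!: derivative_eq_intros)
  moreover have "((\<lambda>y. mul 0 y) has_derivative (\<lambda>v. v)) (at y)"
    by (simp add: has_derivative_ident)
  ultimately show ?thesis
    by (metis has_derivative_unique)
qed

lemma D_zero_right: "D (x, 0) (v, 0) = v"
proof -
  have "((\<lambda>x. mul x 0) has_derivative (\<lambda>v. D (x, 0) (v, 0))) (at x)"
    by (rule has_derivative_mul_compose) (auto intro!: derivative_eq_intros)
  moreover have "((\<lambda>y. mul y 0) has_derivative (\<lambda>v. v)) (at x)"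
    by (simp add: has_derivative_ident)
  ultimately show ?thesis
    by (metis has_derivative_unique)
qed

lemma D_zero: "D (0, 0) (v, w) = v + w"
proof -
  have "D (0, 0) (v, w) = D (0, 0) (v, 0) + D (0, 0) (0, w)"
    using linear_add [OF linear_D, of "(0, 0)" "(v, 0)" "(0, w)"] by simp
  then show ?thesis
    by (simp add: D_zero_left D_zero_right)
qed

lemma left_inv_field_eq: "left_inv_field mul v g = D (g, 0) (0, v)"
proof -
  have "(mul g has_derivative (\<lambda>v. D (g, 0) (0, v))) (at 0)"
    by (rule derivative_eq_intros refl | simp)+
  then show ?thesis
    unfolding left_inv_field_def using frechet_derivative_at by metis
qed

lemma left_inv_field_linear: "linear (\<lambda>v. left_inv_field mul v g)"
  unfolding left_inv_field_eq
  by (rule linear_compose [OF _ linear_D, unfolded o_def])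
    (auto intro!: linearI)

lemma left_inv_field_zero: "left_inv_field mul v 0 = v"
  by (simp add: left_inv_field_eq D_zero_left)

lemma left_inv_field_differentiable: "left_inv_field mul v differentiable (at g)"
proof -
  have "(\<lambda>q. D q (0, v)) differentiable (at (g, 0))"
    by (rule D_differentiable)
  moreover have "(\<lambda>g. (g, 0)) differentiable (at g)"
    unfolding differentiable_def by (auto intro!: derivative_eq_intros)
  ultimately have "((\<lambda>q. D q (0, v)) \<circ> (\<lambda>g. (g, 0))) differentiable (at g)"
    by (intro differentiable_chain_at)
  then show ?thesis
    unfolding o_def left_inv_field_eq [abs_def] .
qed

text \<open>Since \<open>t' *\<^sub>R y\<close> is the product of \<open>t *\<^sub>R y\<close> and
  \<open>(t' - t) *\<^sub>R y\<close>, the derivative at any time reduces to one at the unit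
  element: the curve is an integral curve of the left invariant field.\<close>

lemma mul_curve_derivative:
  "((\<lambda>t. mul x (t *\<^sub>R y)) has_vector_derivative left_inv_field mul y (mul x (t *\<^sub>R y))) (at t)"
proof -
  have eq: "mul (mul x (t *\<^sub>R y)) ((t' - t) *\<^sub>R y) = mul x (t' *\<^sub>R y)" for t'
    by (simp add: assoc mul_scaleR)
  have "((\<lambda>t'. mul (mul x (t *\<^sub>R y)) ((t' - t) *\<^sub>R y)) has_derivative
      (\<lambda>h. D (mul x (t *\<^sub>R y), (t - t) *\<^sub>R y) (0, h *\<^sub>R y))) (at t)"
    by (rule has_derivative_mul_compose) (auto intro!: derivative_eq_intros)
  moreover have "D (g, 0) (0, h *\<^sub>R y) = h *\<^sub>R left_inv_field mul y g" for g h
    using linear_scale [OF left_inv_field_linear, of h y g] by (simp add: left_inv_field_eq)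
  ultimately show ?thesis
    unfolding has_vector_derivative_def by (simp add: eq)
qed

subsection \<open>The adjoint representation\<close>

text \<open>Conjugation in the group. In exponential coordinates it is also the adjoint action on
  the Lie algebra, once it is known to be linear.\<close>

definition Ad :: "'a \<Rightarrow> 'a \<Rightarrow> 'a" where
  "Ad g y = mul (mul g y) (- g)"

lemma Ad_mul: "Ad g (mul x y) = mul (Ad g x) (Ad g y)"
  by (simp add: Ad_def assoc)

lemma Ad_zero_left [simp]: "Ad 0 y = y"
  by (simp add: Ad_def)

lemma Ad_zero_right [simp]: "Ad g 0 = 0"
  by (simp add: Ad_def)

lemma Ad_of_nat: "Ad g (of_nat n *\<^sub>R y) = of_nat n *\<^sub>R Ad g y"
proof (induction n)
  case (Suc n)
  have "Ad g (of_nat (Suc n) *\<^sub>R y) = Ad g (mul (of_nat n *\<^sub>R y) (1 *\<^sub>R y))"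
    unfolding mul_scaleR by (simp add: add.commute)
  also have "\<dots> = mul (of_nat n *\<^sub>R Ad g y) (1 *\<^sub>R Ad g y)"
    unfolding Ad_mul Suc by simp
  finally show ?case
    unfolding mul_scaleR by (simp add: add.commute)
qed simp

text \<open>Conjugation commutes with \<open>y \<mapsto> n y\<close>, which is the \<open>n\<close>-th power, so it coincides with
  its derivative at the unit element.\<close>

lemma linear_Ad: "linear (Ad g)"
proof -
  have "\<exists>A. (Ad g has_derivative A) (at 0)"
    unfolding Ad_def [abs_def] by (rule exI) (rule derivative_eq_intros refl)+
  then obtain A where A: "(Ad g has_derivative A) (at 0)" by blast
  have linA: "linear A" using A has_derivative_linear by blast
  have "Ad g y = A y" for y
  proof -
    have "((\<lambda>t. Ad g (t *\<^sub>R y)) has_vector_derivative A y) (at 0)"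
    proof -
      have 1: "((\<lambda>t. t *\<^sub>R y) has_derivative (\<lambda>t. t *\<^sub>R y)) (at 0)"
        by (auto intro!: derivative_eq_intros)
      have "((\<lambda>t. Ad g (t *\<^sub>R y)) has_derivative (\<lambda>t. A (t *\<^sub>R y))) (at 0)"
        using has_derivative_compose [OF 1, of "Ad g" A] A by simp
      then show ?thesis
        unfolding has_vector_derivative_def using linear_scale [OF linA] by simp
    qed
    then have lim: "((\<lambda>t. (1 / t) *\<^sub>R Ad g (t *\<^sub>R y)) \<longlongrightarrow> A y) (at 0)"
      unfolding has_vector_derivative_iff_lim by simp
    \<comment> \<open>The difference quotient is computed only along t = 1/(n+1), where it is
      constant; this suffices because the full limit is already known to exist.\<close>
    have "filterlim (\<lambda>n. 1 / real (Suc n)) (at 0) sequentially"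
      by (rule filterlim_atI) (use LIMSEQ_inverse_real_of_nat in \<open>auto simp: inverse_eq_divide\<close>)
    then have "((\<lambda>n. (1 / (1 / real (Suc n))) *\<^sub>R Ad g ((1 / real (Suc n)) *\<^sub>R y)) \<longlongrightarrow> A y) sequentially"
      by (rule filterlim_compose [OF lim])
    moreover have "(1 / (1 / real (Suc n))) *\<^sub>R Ad g ((1 / real (Suc n)) *\<^sub>R y) = Ad g y" for n
      using Ad_of_nat [of g "Suc n" "(1 / real (Suc n)) *\<^sub>R y"] by (simp del: of_nat_Suc)
    ultimately show ?thesis
      by (simp only: LIMSEQ_const_iff)
  qed
  then have "Ad g = A" by auto
  then show ?thesis using linA by simp
qed

text \<open>Differentiates the identity \<open>mul g (f y) = y\<close>. With \<open>f\<close> the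
  translation by the inverse of \<open>g\<close>, it says that the differentials of opposite left
  translations are inverse to each other.\<close>

lemma D_chain:
  assumes "\<And>y. mul g (f y) = y" and "(f has_derivative f') (at y)"
  shows "D (g, f y) (0, f' v) = v"
proof -
  have "((\<lambda>y. mul g (f y)) has_derivative (\<lambda>v. D (g, f y) (0, f' v))) (at y)"
    by (rule has_derivative_mul_compose) (use assms(2) in \<open>auto intro!: derivative_eq_intros\<close>)
  moreover have "((\<lambda>y. mul g (f y)) has_derivative (\<lambda>v. v)) (at y)"
    by (simp add: assms(1) has_derivative_ident)
  ultimately show ?thesis
    by (metis has_derivative_unique)
qed

lemma has_derivative_left_mul: "(mul g has_derivative (\<lambda>v. D (g, y) (0, v))) (at y)"
  by (rule derivative_eq_intros refl | simp)+

text \<open>The curve g exp(s y) is also exp(s Ad_g y) g, the inverse of g^(-1) exp(-s Ad_g y).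
  Inversion is \<open>uminus\<close>, so comparing the two derivatives at s = 0 expresses
  conjugation through left invariant fields alone.\<close>

lemma left_inv_field_Ad: "left_inv_field mul (Ad g y) (- g) = left_inv_field mul y g"
proof -
  have eq: "- mul (- g) (- (s *\<^sub>R Ad g y)) = mul g (s *\<^sub>R y)" for s
    unfolding neg_mul minus_minus linear_scale [OF linear_Ad, symmetric] by (simp add: Ad_def assoc)
  have "((\<lambda>s. - mul (- g) (- (s *\<^sub>R Ad g y))) has_derivative
      (\<lambda>s. - D (- g, - (0 *\<^sub>R Ad g y)) (0, - (s *\<^sub>R Ad g y)))) (at 0)"
    by (intro has_derivative_minus has_derivative_mul_compose)
      (auto intro!: derivative_eq_intros)
  then have 1: "((\<lambda>s. mul g (s *\<^sub>R y)) has_derivative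
      (\<lambda>s. - D (- g, 0) (0, - (s *\<^sub>R Ad g y)))) (at 0)"
    by (simp add: eq)
  have "((\<lambda>s. mul g (s *\<^sub>R y)) has_derivative (\<lambda>s. D (g, 0 *\<^sub>R y) (0, s *\<^sub>R y))) (at 0)"
    by (intro has_derivative_mul_compose) (auto intro!: derivative_eq_intros)
  with 1 have feq: "(\<lambda>s. - D (- g, 0) (0, - (s *\<^sub>R Ad g y))) = (\<lambda>s. D (g, 0 *\<^sub>R y) (0, s *\<^sub>R y))"
    by (rule has_derivative_unique)
  have "- D (- g, 0) (0, - Ad g y) = D (g, 0) (0, y)"
    using fun_cong [OF feq, of 1] by simp
  moreover have "D (- g, 0) (0, - Ad g y) = - D (- g, 0) (0, Ad g y)"
    using linear_neg [OF linear_D, of "(- g, 0)" "(0, Ad g y)"] by simp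
  ultimately show ?thesis
    by (simp add: left_inv_field_eq)
qed

subsection \<open>The Lie bracket\<close>

abbreviation bracket :: "'a \<Rightarrow> 'a \<Rightarrow> 'a" where
  "bracket \<equiv> lie_bracket mul"

text \<open>The second order term of the group law: \<open>left_inv_field mul v z\<close> is
  \<open>v + \<beta> z v\<close> up to o(z). It will turn out to be half the bracket.\<close>

definition \<beta> :: "'a \<Rightarrow> 'a \<Rightarrow> 'a" where
  "\<beta> z v = frechet_derivative (left_inv_field mul v) (at 0) z"

lemma has_derivative_left_inv_field: "(left_inv_field mul v has_derivative (\<lambda>z. \<beta> z v)) (at 0)"
  unfolding \<beta>_def using left_inv_field_differentiable frechet_derivative_works by blast

lemma linear_\<beta>_left: "linear (\<lambda>z. \<beta> z v)"
  using has_derivative_left_inv_field has_derivative_linear by blast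

lemma linear_\<beta>_right: "linear (\<beta> z)"
proof (rule linearI)
  fix v w :: 'a and c :: real
  have "(left_inv_field mul (v + w) has_derivative (\<lambda>z. \<beta> z v + \<beta> z w)) (at 0)"
    using has_derivative_add [OF has_derivative_left_inv_field [of v] has_derivative_left_inv_field [of w]]
    by (simp add: linear_add [OF left_inv_field_linear, symmetric])
  then show "\<beta> z (v + w) = \<beta> z v + \<beta> z w"
    using has_derivative_left_inv_field [of "v + w"] by (metis has_derivative_unique)
  have "(left_inv_field mul (c *\<^sub>R v) has_derivative (\<lambda>z. c *\<^sub>R \<beta> z v)) (at 0)"
    using has_derivative_scaleR_right [OF has_derivative_left_inv_field [of v], of c]
    by (simp add: linear_scale [OF left_inv_field_linear, symmetric])
  then show "\<beta> z (c *\<^sub>R v) = c *\<^sub>R \<beta> z v"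
    using has_derivative_left_inv_field [of "c *\<^sub>R v"] by (metis has_derivative_unique)
qed

text \<open>The one-parameter subgroup of \<open>x\<close> is a straight line with constant velocity
  \<open>x\<close> and at the same time an integral curve of the field of \<open>x\<close>. This
  makes \<open>\<beta>\<close> alternating.\<close>

lemma left_inv_field_self: "left_inv_field mul x (t *\<^sub>R x) = x"
proof -
  have "((\<lambda>t. mul 0 (t *\<^sub>R x)) has_vector_derivative left_inv_field mul x (mul 0 (t *\<^sub>R x))) (at t)"
    by (rule mul_curve_derivative)
  moreover have "((\<lambda>t. t *\<^sub>R x) has_vector_derivative x) (at t)"
    by (auto intro!: derivative_eq_intros)
  ultimately show ?thesis
    using vector_derivative_unique_at by fastforce
qed

lemma left_inv_field_along_line:
  "((\<lambda>t. left_inv_field mul v (t *\<^sub>R z)) has_vector_derivative \<beta> z v) (at 0)"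
proof -
  have 1: "((\<lambda>t. t *\<^sub>R z) has_derivative (\<lambda>t. t *\<^sub>R z)) (at 0)"
    by (auto intro!: derivative_eq_intros)
  have "((\<lambda>t. left_inv_field mul v (t *\<^sub>R z)) has_derivative (\<lambda>t. \<beta> (t *\<^sub>R z) v)) (at 0)"
    using has_derivative_compose [OF 1, of "left_inv_field mul v"] has_derivative_left_inv_field [of v]
    by simp
  then show ?thesis
    unfolding has_vector_derivative_def using linear_scale [OF linear_\<beta>_left] by simp
qed

lemma \<beta>_self: "\<beta> x x = 0"
proof -
  have "((\<lambda>t. left_inv_field mul x (t *\<^sub>R x)) has_vector_derivative 0) (at 0)"
    by (simp add: left_inv_field_self)
  with left_inv_field_along_line show ?thesis
    by (metis vector_derivative_unique_at)
qed

lemma \<beta>_skew: "\<beta> y x = - \<beta> x y"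
proof -
  have "\<beta> (x + y) (x + y) = \<beta> x x + \<beta> x y + \<beta> y x + \<beta> y y"
    by (simp add: linear_add [OF linear_\<beta>_left] linear_add [OF linear_\<beta>_right])
  then show ?thesis
    by (simp add: \<beta>_self eq_neg_iff_add_eq_0 add.commute)
qed

text \<open>The definition unfolds to \<open>\<beta> z y - \<beta> y z\<close>; the factor 2 comes
  from skew symmetry, a feature of exponential coordinates.\<close>

lemma bracket_eq_\<beta>: "bracket z y = 2 *\<^sub>R \<beta> z y"
  unfolding lie_bracket_def vf_bracket_def left_inv_field_zero \<beta>_def [symmetric]
  by (simp add: \<beta>_skew [of y z] scaleR_2)

lemma bilinear_bracket: "bilinear bracket"
  unfolding bilinear_def bracket_eq_\<beta>
  by (intro conjI allI linear_compose_scale_right linear_\<beta>_left linear_\<beta>_right)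

lemma Ad_continuous: "continuous_on UNIV (\<lambda>t. Ad (t *\<^sub>R z) y)"
  unfolding Ad_def by (intro continuous_intros)

text \<open>With a(t) = Ad_{tz} y, \<open>left_inv_field_Ad\<close> says that the field of a(t) at
  -tz equals the field of y at tz. To first order a(t) - t \<beta>(z, a(t)) = y + t \<beta>(z, y),
  so the slope is 2 \<beta>(z, y).\<close>

lemma Ad_has_vector_derivative:
  "((\<lambda>t. Ad (t *\<^sub>R z) y) has_vector_derivative bracket z y) (at 0)"
proof -
  define a where "a t = Ad (t *\<^sub>R z) y" for t
  define X where "X v t = left_inv_field mul v (t *\<^sub>R z)" for v t
  have lim: "((\<lambda>h. (1 / h) *\<^sub>R (X v h - v)) \<longlongrightarrow> \<beta> z v) (at 0)" for v
    using left_inv_field_along_line [of v z]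
    unfolding has_vector_derivative_iff_lim X_def by (simp add: left_inv_field_zero)
  have lim': "((\<lambda>h. (1 / h) *\<^sub>R (X v (- h) - v)) \<longlongrightarrow> - \<beta> z v) (at 0)" for v
  proof -
    have "\<beta> (- z) v = - \<beta> z v"
      by (rule linear_neg [OF linear_\<beta>_left])
    then show ?thesis
      using left_inv_field_along_line [of v "- z"]
      unfolding has_vector_derivative_iff_lim X_def by (simp add: left_inv_field_zero)
  qed
  have X_linear: "linear (\<lambda>v. X v t)" for t
    unfolding X_def by (rule left_inv_field_linear)
  have X_a: "X (a t) (- t) = X y t" for t
    using left_inv_field_Ad [of "t *\<^sub>R z" y] by (simp add: X_def a_def)
  \<comment> \<open>The vector \<open>a h\<close> varies with \<open>h\<close>, so a limit for each
    fixed \<open>v\<close> is not enough. Expanding over a basis moves the variation into scalar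
    factors, for which continuity of \<open>a\<close> suffices.\<close>
  have expand: "X v t - v = (\<Sum>b\<in>Basis. (v \<bullet> b) *\<^sub>R (X b t - b))" for v t
  proof -
    have "X v t = X (\<Sum>b\<in>Basis. (v \<bullet> b) *\<^sub>R b) t"
      by (simp add: euclidean_representation)
    also have "\<dots> = (\<Sum>b\<in>Basis. (v \<bullet> b) *\<^sub>R X b t)"
      by (simp add: linear_sum [OF X_linear] linear_scale [OF X_linear])
    finally show ?thesis
      by (simp add: scaleR_diff_right sum_subtractf euclidean_representation)
  qed
  have a_eq: "a h - y = (X y h - y) - (\<Sum>b\<in>Basis. (a h \<bullet> b) *\<^sub>R (X b (- h) - b))" for h
    using expand [of "a h" "- h"] X_a [of h] by (simp add: algebra_simps)
  have "isCont a 0"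
    using Ad_continuous [of z y] unfolding a_def [abs_def] by (simp add: continuous_on_eq_continuous_at)
  then have a_lim: "(a \<longlongrightarrow> y) (at 0)"
    by (simp add: isCont_def a_def)
  have "((\<lambda>h. (1 / h) *\<^sub>R (X y h - y) - (\<Sum>b\<in>Basis. (a h \<bullet> b) *\<^sub>R ((1 / h) *\<^sub>R (X b (- h) - b))))
      \<longlongrightarrow> \<beta> z y - (\<Sum>b\<in>Basis. (y \<bullet> b) *\<^sub>R (- \<beta> z b))) (at 0)"
    by (intro tendsto_intros lim lim' a_lim)
  moreover have "(\<Sum>b\<in>Basis. (y \<bullet> b) *\<^sub>R (- \<beta> z b)) = - \<beta> z y"
  proof -
    have "\<beta> z y = \<beta> z (\<Sum>b\<in>Basis. (y \<bullet> b) *\<^sub>R b)"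
      by (simp add: euclidean_representation)
    also have "\<dots> = (\<Sum>b\<in>Basis. (y \<bullet> b) *\<^sub>R \<beta> z b)"
      by (simp add: linear_sum [OF linear_\<beta>_right] linear_scale [OF linear_\<beta>_right])
    finally show ?thesis
      by (simp add: sum_negf)
  qed
  moreover have "(1 / h) *\<^sub>R (X y h - y) - (\<Sum>b\<in>Basis. (a h \<bullet> b) *\<^sub>R ((1 / h) *\<^sub>R (X b (- h) - b)))
      = (1 / h) *\<^sub>R (a h - y)" for h
    unfolding a_eq by (simp add: scaleR_diff_right scaleR_sum_right mult.commute)
  ultimately show ?thesis
    unfolding has_vector_derivative_iff_lim bracket_eq_\<beta>
    by (simp add: a_def scaleR_2)
qed

text \<open>Differentiate at t = 0 the conjugation identity Ad_g Ad_{tz} = Ad_{t Ad_g z}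
  Ad_g.\<close>

lemma Ad_bracket: "Ad g (bracket z y) = bracket (Ad g z) (Ad g y)"
proof -
  have eq: "Ad g (Ad (t *\<^sub>R z) y) = Ad (t *\<^sub>R Ad g z) (Ad g y)" for t
  proof -
    have "Ad g (Ad w y) = Ad (Ad g w) (Ad g y)" for w
      by (simp add: Ad_def assoc neg_mul)
    then show ?thesis
      by (simp add: linear_scale [OF linear_Ad, symmetric])
  qed
  have "((\<lambda>t. Ad g (Ad (t *\<^sub>R z) y)) has_vector_derivative Ad g (bracket z y)) (at 0)"
    by (rule bounded_linear.has_vector_derivative [OF _ Ad_has_vector_derivative])
      (use linear_Ad linear_conv_bounded_linear in blast)
  then show ?thesis
    unfolding eq using Ad_has_vector_derivative vector_derivative_unique_at by blast
qed

lemma bounded_bilinear_bracket: "bounded_bilinear bracket"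
  using bilinear_bracket bilinear_conv_bounded_bilinear by blast

text \<open>Differentiate at t = 0 the compatibility of Ad_{tx} with the bracket; the product rule
  gives the two terms on the right.\<close>

lemma jacobi: "bracket x (bracket y z) = bracket (bracket x y) z + bracket y (bracket x z)"
proof -
  have "((\<lambda>t. bracket (Ad (t *\<^sub>R x) y) (Ad (t *\<^sub>R x) z)) has_vector_derivative
      bracket (Ad (0 *\<^sub>R x) y) (bracket x z) + bracket (bracket x y) (Ad (0 *\<^sub>R x) z)) (at 0)"
    by (intro bounded_bilinear.has_vector_derivative [OF bounded_bilinear_bracket]
        Ad_has_vector_derivative)
  then have "((\<lambda>t. Ad (t *\<^sub>R x) (bracket y z)) has_vector_derivative
      bracket y (bracket x z) + bracket (bracket x y) z) (at 0)"
    by (simp add: Ad_bracket)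
  then show ?thesis
    using Ad_has_vector_derivative [of x "bracket y z"] vector_derivative_unique_at
    by (metis add.commute)
qed

subsection \<open>The left logarithmic derivative of the exponential map\<close>

text \<open>The left Maurer-Cartan form: it moves a tangent vector at \<open>g\<close> back to the
  unit element, so it reads off the components of \<open>u\<close> in the left invariant frame at
  \<open>g\<close>.\<close>

definition \<omega> :: "'a \<Rightarrow> 'a \<Rightarrow> 'a" where
  "\<omega> g u = D (- g, g) (0, u)"

lemma linear_\<omega>: "linear (\<omega> g)"
  unfolding \<omega>_def by (rule linear_compose [OF _ linear_D, unfolded o_def]) (auto intro!: linearI)

lemma \<omega>_left_inv_field: "\<omega> g (left_inv_field mul y g) = y"
  unfolding \<omega>_def left_inv_field_eq
  using D_chain [OF mul_neg(2) has_derivative_left_mul, of g 0 y] by simp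

text \<open>Differentiate in s at 0 the curve exp(-tz) exp(t(z + su)). Splitting t + h in both
  exponentials turns it into the conjugate by exp(-hz) of the curve for t, times the curve for h; at
  the unit element the derivative of a product is the sum.\<close>

lemma scaled_\<omega>_cocycle:
  "(t + h) *\<^sub>R \<omega> ((t + h) *\<^sub>R z) u = Ad (- (h *\<^sub>R z)) (t *\<^sub>R \<omega> (t *\<^sub>R z) u) + h *\<^sub>R \<omega> (h *\<^sub>R z) u"
proof -
  define \<Psi> where "\<Psi> t s = mul (- (t *\<^sub>R z)) (t *\<^sub>R (z + s *\<^sub>R u))" for t s
  have der: "((\<Psi> t) has_derivative (\<lambda>s. s *\<^sub>R (t *\<^sub>R \<omega> (t *\<^sub>R z) u))) (at 0)" for t
  proof -
    have "((\<Psi> t) has_derivative (\<lambda>s. D (- (t *\<^sub>R z), t *\<^sub>R (z + 0 *\<^sub>R u)) (0, t *\<^sub>R (s *\<^sub>R u)))) (at 0)"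
      unfolding \<Psi>_def by (rule has_derivative_mul_compose) (auto intro!: derivative_eq_intros)
    moreover have "D (- (t *\<^sub>R z), t *\<^sub>R z) (0, t *\<^sub>R (s *\<^sub>R u)) = s *\<^sub>R (t *\<^sub>R \<omega> (t *\<^sub>R z) u)" for s
      unfolding \<omega>_def [symmetric] by (simp add: linear_scale [OF linear_\<omega>])
    ultimately show ?thesis by simp
  qed
  have \<Psi>_0: "\<Psi> t 0 = 0" for t
    by (simp add: \<Psi>_def)
  have eq: "\<Psi> (t + h) s = mul (Ad (- (h *\<^sub>R z)) (\<Psi> t s)) (\<Psi> h s)" for s
  proof -
    have 1: "- ((t + h) *\<^sub>R z) = mul (- (h *\<^sub>R z)) (- (t *\<^sub>R z))"
      using mul_scaleR [of "- h" z "- t"] by (simp add: algebra_simps)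
    have 2: "(t + h) *\<^sub>R (z + s *\<^sub>R u) = mul (t *\<^sub>R (z + s *\<^sub>R u)) (h *\<^sub>R (z + s *\<^sub>R u))"
      by (rule mul_scaleR [symmetric])
    show ?thesis
      unfolding \<Psi>_def 1 2 Ad_def by (simp add: assoc del: scaleR_add_right)
  qed
  have linA: "bounded_linear (Ad (- (h *\<^sub>R z)))"
    using linear_Ad linear_conv_bounded_linear by blast
  have "((\<lambda>s. mul (Ad (- (h *\<^sub>R z)) (\<Psi> t s)) (\<Psi> h s)) has_derivative
     (\<lambda>s. D (Ad (- (h *\<^sub>R z)) (\<Psi> t 0), \<Psi> h 0)
       (Ad (- (h *\<^sub>R z)) (s *\<^sub>R (t *\<^sub>R \<omega> (t *\<^sub>R z) u)), s *\<^sub>R (h *\<^sub>R \<omega> (h *\<^sub>R z) u)))) (at 0)"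
    by (intro has_derivative_mul_compose bounded_linear.has_derivative [OF linA] der)
  then have "((\<Psi> (t + h)) has_derivative
     (\<lambda>s. Ad (- (h *\<^sub>R z)) (s *\<^sub>R (t *\<^sub>R \<omega> (t *\<^sub>R z) u)) + s *\<^sub>R (h *\<^sub>R \<omega> (h *\<^sub>R z) u))) (at 0)"
    by (simp add: \<Psi>_0 D_zero eq [symmetric])
  from has_derivative_unique [OF der this, THEN fun_cong, of 1] show ?thesis
    by simp
qed

text \<open>Let h tend to 0 in the cocycle: the conjugation contributes the bracket term, the second
  summand tends to \<open>u\<close>. The factor t makes the curve start at 0, so no singularity
  appears there.\<close>

lemma scaled_\<omega>_derivative:
  "((\<lambda>t. t *\<^sub>R \<omega> (t *\<^sub>R z) u) has_vector_derivative u - bracket z (t *\<^sub>R \<omega> (t *\<^sub>R z) u)) (at t)"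
proof -
  define w where "w = t *\<^sub>R \<omega> (t *\<^sub>R z) u"
  have "((\<lambda>h. Ad (h *\<^sub>R (- z)) w) has_vector_derivative bracket (- z) w) (at 0)"
    by (rule Ad_has_vector_derivative)
  then have "((\<lambda>h. (1 / h) *\<^sub>R (Ad (- (h *\<^sub>R z)) w - w)) \<longlongrightarrow> - bracket z w) (at 0)"
    unfolding has_vector_derivative_iff_lim using bilinear_lneg [OF bilinear_bracket] by simp
  moreover have "((\<lambda>h. \<omega> (h *\<^sub>R z) u) \<longlongrightarrow> u) (at 0)"
  proof -
    have "isCont (\<lambda>h. \<omega> (h *\<^sub>R z) u) 0"
      unfolding \<omega>_def
      by (rule continuous_on_interior [of UNIV]) (auto intro!: continuous_intros)
    then show ?thesis
      by (simp add: isCont_def \<omega>_def D_zero)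
  qed
  ultimately have lim: "((\<lambda>h. (1 / h) *\<^sub>R (Ad (- (h *\<^sub>R z)) w - w) + \<omega> (h *\<^sub>R z) u) \<longlongrightarrow> - bracket z w + u) (at 0)"
    by (rule tendsto_add)
  have "((\<lambda>h. (1 / h) *\<^sub>R ((t + h) *\<^sub>R \<omega> ((t + h) *\<^sub>R z) u - w)) \<longlongrightarrow> - bracket z w + u) (at 0)"
  proof (rule Lim_transform_eventually [OF lim])
    have "(1 / h) *\<^sub>R (Ad (- (h *\<^sub>R z)) w - w) + \<omega> (h *\<^sub>R z) u
        = (1 / h) *\<^sub>R ((t + h) *\<^sub>R \<omega> ((t + h) *\<^sub>R z) u - w)" if "h \<noteq> 0" for h
      unfolding scaled_\<omega>_cocycle w_def [symmetric] using that
      by (simp add: algebra_simps)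
    then show "\<forall>\<^sub>F h in at 0. (1 / h) *\<^sub>R (Ad (- (h *\<^sub>R z)) w - w) + \<omega> (h *\<^sub>R z) u
        = (1 / h) *\<^sub>R ((t + h) *\<^sub>R \<omega> ((t + h) *\<^sub>R z) u - w)"
      by (auto simp: eventually_at_filter)
  qed
  then show ?thesis
    unfolding has_vector_derivative_iff_lim w_def by simp
qed

subsection \<open>The group law modulo a central filtration\<close>

text \<open>Stands in for integrating \<open>f'\<close>: against a vector orthogonal to
  \<open>U\<close> the curve has zero derivative and is constant, and \<open>U\<close> is its own
  double orthogonal complement.\<close>

lemma in_subspace_if_derivative_in:
  fixes f :: "real \<Rightarrow> 'a"
  assumes U: "subspace U" and f: "\<And>t. (f has_vector_derivative f' t) (at t)" and f': "\<And>t. f' t \<in> U"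
  shows "f b - f a \<in> U"
proof -
  have "(f b - f a) \<bullet> w = 0" if w: "\<And>u. u \<in> U \<Longrightarrow> u \<bullet> w = 0" for w
  proof -
    have "((\<lambda>t. f t \<bullet> w) has_real_derivative 0) (at t)" for t
      using bounded_linear.has_vector_derivative [OF bounded_linear_inner_left f, of w t] w [OF f', of t]
      by (simp add: has_real_derivative_iff_has_vector_derivative)
    then have "f b \<bullet> w = f a \<bullet> w"
      by (intro DERIV_isconst_all allI)
    then show ?thesis
      by (simp add: inner_diff_left)
  qed
  then have "f b - f a \<in> (U\<^sup>\<bottom>)\<^sup>\<bottom>"
    by (auto simp: orthogonal_comp_def orthogonal_def inner_commute)
  then show ?thesis
    using orthogonal_comp_self [OF U] by simp
qed

text \<open>A descending central filtration that starts with the whole algebra at index 1; the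
  filtration by degree will be the instance.\<close>

context
  fixes I :: "nat \<Rightarrow> 'a set"
  assumes subspace_I: "\<And>k. subspace (I k)"
    and I_1: "I 1 = UNIV"
    and I_Suc: "\<And>k. I (Suc k) \<subseteq> I k"
    and bracket_I: "\<And>k x y. k \<ge> 1 \<Longrightarrow> y \<in> I k \<Longrightarrow> bracket x y \<in> I (Suc k)"
begin

text \<open>Bootstrapping in the index. If W(t) = t \<omega>(tz) u lies in \<open>I i\<close> for
  all t and i < k, then W' = u - [z, W] lies in \<open>I (Suc i)\<close>, hence so does W, because
  W(0) = 0.\<close>

lemma scaled_\<omega>_in_filtration:
  assumes "u \<in> I k" "k \<ge> 1"
  shows "t *\<^sub>R \<omega> (t *\<^sub>R z) u \<in> I k"
proof -
  have anti: "I m \<subseteq> I i" if "i \<le> m" for i m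
    using that I_Suc by (rule lift_Suc_antimono_le [rotated])
  have "i \<le> k \<Longrightarrow> t *\<^sub>R \<omega> (t *\<^sub>R z) u \<in> I i" if "i \<ge> 1" for i t
    using that
  proof (induction i arbitrary: t rule: nat_induct_at_least)
    case base
    then show ?case by (simp only: I_1)  simp
  next
    case (Suc i)
    have "u - bracket z (t *\<^sub>R \<omega> (t *\<^sub>R z) u) \<in> I (Suc i)" for t
    proof (rule subspace_diff [OF subspace_I])
      show "u \<in> I (Suc i)"
        using anti [OF \<open>Suc i \<le> k\<close>] assms(1) by blast
      show "bracket z (t *\<^sub>R \<omega> (t *\<^sub>R z) u) \<in> I (Suc i)"
        using Suc by (intro bracket_I) auto
    qed
    from in_subspace_if_derivative_in [OF subspace_I scaled_\<omega>_derivative this, of t 0]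
    show ?case by simp
  qed
  from this [of k t] assms show ?thesis by simp
qed

text \<open>The curve W(t) - t u has derivative -[z, W(t)], one step deeper in the filtration;
  compare t = 1 with t = 0.\<close>

lemma \<omega>_minus_id_in_filtration:
  assumes "u \<in> I k" "k \<ge> 1"
  shows "\<omega> z u - u \<in> I (Suc k)"
proof -
  have der: "((\<lambda>t. t *\<^sub>R \<omega> (t *\<^sub>R z) u - t *\<^sub>R u) has_vector_derivative
      (u - bracket z (t *\<^sub>R \<omega> (t *\<^sub>R z) u)) - u) (at t)" for t
    by (intro has_vector_derivative_diff scaled_\<omega>_derivative)
      (auto intro!: derivative_eq_intros)
  have der_in: "(u - bracket z (t *\<^sub>R \<omega> (t *\<^sub>R z) u)) - u \<in> I (Suc k)" for t
    using subspace_neg [OF subspace_I bracket_I [OF assms(2) scaled_\<omega>_in_filtration [OF assms]]]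
    by simp
  from in_subspace_if_derivative_in [OF subspace_I der der_in, of 1 0] show ?thesis
    by simp
qed

text \<open>Transfers the previous estimate to the inverse of \<open>\<omega> z\<close>. First u is
  shown to lie in \<open>I k\<close>, one index at a time, from u = y - (\<omega> z u - u).\<close>

lemma left_inv_field_in_filtration:
  assumes "y \<in> I k" "k \<ge> 1"
  shows "left_inv_field mul y z - y \<in> I (Suc k)"
proof -
  have anti: "I m \<subseteq> I i" if "i \<le> m" for i m
    using that I_Suc by (rule lift_Suc_antimono_le [rotated])
  define u where "u = left_inv_field mul y z"
  have \<omega>u: "\<omega> z u = y"
    by (simp add: u_def \<omega>_left_inv_field)
  have "j \<le> k \<Longrightarrow> u \<in> I j" if "j \<ge> 1" for j
    using that
  proof (induction j rule: nat_induct_at_least)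
    case base
    then show ?case by (simp only: I_1) simp
  next
    case (Suc j)
    then have "\<omega> z u - u \<in> I (Suc j)"
      by (intro \<omega>_minus_id_in_filtration) auto
    moreover have "y \<in> I (Suc j)"
      using anti [OF \<open>Suc j \<le> k\<close>] assms(1) by blast
    ultimately show ?case
      using subspace_diff [OF subspace_I, of y "Suc j" "y - u"] \<omega>u by simp
  qed
  then have "u \<in> I k" using assms(2) by simp
  from subspace_neg [OF subspace_I \<omega>_minus_id_in_filtration [OF this assms(2), of z]] show ?thesis
    by (simp add: \<omega>u u_def [symmetric])
qed

lemma mul_mod_filtration_right:
  assumes "y \<in> I k" "k \<ge> 1"
  shows "mul x y - x - y \<in> I (Suc k)"
proof -
  have "((\<lambda>t. mul x (t *\<^sub>R y) - t *\<^sub>R y) has_vector_derivative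
      left_inv_field mul y (mul x (t *\<^sub>R y)) - y) (at t)" for t
    by (intro has_vector_derivative_diff mul_curve_derivative)
      (auto intro!: derivative_eq_intros)
  from in_subspace_if_derivative_in [OF subspace_I this left_inv_field_in_filtration [OF assms], of 1 0]
  show ?thesis by (simp add: algebra_simps)
qed

text \<open>Inversion is \<open>uminus\<close> and exchanges the two factors.\<close>

lemma mul_mod_filtration_left:
  assumes "y \<in> I k" "k \<ge> 1"
  shows "mul y x - y - x \<in> I (Suc k)"
proof -
  have "mul (- x) (- y) - (- x) - (- y) \<in> I (Suc k)"
    by (rule mul_mod_filtration_right [OF subspace_neg [OF subspace_I assms(1)] assms(2)])
  from subspace_neg [OF subspace_I this] show ?thesis
    unfolding neg_mul [of y x, symmetric] by (simp add: algebra_simps)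
qed

end

end

section \<open>Alternating forms and the wedge product\<close>

text \<open>Arguments are sequences indexed by all naturals of which only the entries in
  \<open>{1..p}\<close> matter, as for \<open>wedge\<close>. Antisymmetry is stated for all
  permutations at once, so that sorting an index takes a single application.\<close>

definition alternating_form :: "nat \<Rightarrow> ((nat \<Rightarrow> 'a::real_vector) \<Rightarrow> real) \<Rightarrow> bool" where
  "alternating_form p f \<longleftrightarrow>
     (\<forall>u w. (\<forall>i\<in>{1..p}. u i = w i) \<longrightarrow> f u = f w) \<and>
     (\<forall>u. \<forall>i\<in>{1..p}. linear (\<lambda>x. f (u(i := x)))) \<and>
     (\<forall>u \<sigma>. \<sigma> permutes {1..p} \<longrightarrow> f (u \<circ> \<sigma>) = of_int (sign \<sigma>) * f u)"

lemma alternating_formD: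
  assumes "alternating_form p f"
  shows alternating_form_cong: "(\<And>i. i \<in> {1..p} \<Longrightarrow> u i = w i) \<Longrightarrow> f u = f w"
    and alternating_form_linear: "i \<in> {1..p} \<Longrightarrow> linear (\<lambda>x. f (u(i := x)))"
    and alternating_form_permute: "\<sigma> permutes {1..p} \<Longrightarrow> f (u \<circ> \<sigma>) = of_int (sign \<sigma>) * f u"
  using assms unfolding alternating_form_def by blast+

lemma alternating_form_eq_slots:
  assumes f: "alternating_form p f" and "i \<in> {1..p}" "j \<in> {1..p}" "i \<noteq> j" "u i = u j"
  shows "f u = 0"
proof -
  have "u \<circ> Transposition.transpose i j = u"
    using \<open>u i = u j\<close> by (auto simp: fun_eq_iff Transposition.transpose_def)
  moreover have "f (u \<circ> Transposition.transpose i j) = - f u"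
    using alternating_form_permute [OF f permutes_swap_id [OF assms(2,3)], of u] \<open>i \<noteq> j\<close>
    by (simp add: sign_swap_id)
  ultimately show ?thesis by simp
qed

lemma permutes_extend:
  assumes "bij_betw f A A"
  shows "(\<lambda>i. if i \<in> A then f i else i) permutes A"
proof (rule bij_imp_permutes)
  show "bij_betw (\<lambda>i. if i \<in> A then f i else i) A A"
    using assms by (simp cong: bij_betw_cong)
qed simp

text \<open>Compose the increasing enumeration \<open>h\<close> of the image with the inverse of
  \<open>g\<close>; the shift by 1 occurs because \<open>h\<close> counts from 0.\<close>

lemma exists_sorting_permutation:
  fixes g :: "nat \<Rightarrow> 'a::wellorder"
  assumes "inj_on g {1..p}"
  obtains \<sigma> where "\<sigma> permutes {1..p}" "strict_mono_on {1..p} (g \<circ> \<sigma>)"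
proof -
  obtain h where h: "bij_betw h {..<card (g ` {1..p})} (g ` {1..p})"
      "strict_mono_on {..<card (g ` {1..p})} h"
    using ex_bij_betw_strict_mono_card [of "g ` {1..p}"] by blast
  have c: "card (g ` {1..p}) = p"
    using card_image [OF assms] by simp
  have pred: "bij_betw (\<lambda>i. i - 1) {1..p} {..<p}"
    by (rule bij_betwI [where g = Suc]) auto
  have "bij_betw (inv_into {1..p} g \<circ> h \<circ> (\<lambda>i. i - 1)) {1..p} {1..p}"
    by (intro bij_betw_trans [OF bij_betw_trans [OF pred h(1) [unfolded c], unfolded o_assoc [symmetric]]
          bij_betw_inv_into [OF inj_on_imp_bij_betw [OF assms]], unfolded o_assoc])
  then have "(\<lambda>i. if i \<in> {1..p} then (inv_into {1..p} g \<circ> h \<circ> (\<lambda>i. i - 1)) i else i) permutes {1..p}"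
    by (rule permutes_extend)
  moreover have "strict_mono_on {1..p} (g \<circ> (\<lambda>i. if i \<in> {1..p} then (inv_into {1..p} g \<circ> h \<circ> (\<lambda>i. i - 1)) i else i))"
  proof (rule strict_mono_onI)
    fix r s assume rs: "r \<in> {1..p}" "s \<in> {1..p}" "r < s"
    have "h (r - 1) \<in> g ` {1..p}" "h (s - 1) \<in> g ` {1..p}"
      using h(1) rs unfolding c bij_betw_def by auto
    moreover have "h (r - 1) < h (s - 1)"
      using h(2) rs unfolding c by (auto intro!: strict_mono_onD [of "{..<p}" h])
    ultimately show "(g \<circ> (\<lambda>i. if i \<in> {1..p} then (inv_into {1..p} g \<circ> h \<circ> (\<lambda>i. i - 1)) i else i)) r
        < (g \<circ> (\<lambda>i. if i \<in> {1..p} then (inv_into {1..p} g \<circ> h \<circ> (\<lambda>i. i - 1)) i else i)) s"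
      using rs by (simp add: f_inv_into_f)
  qed
  ultimately show thesis by (rule that)
qed

text \<open>A repeated index gives 0, and an injective index becomes increasing at the cost of a
  sign.\<close>

lemma alternating_form_eq_zero_if_basis:
  assumes f: "alternating_form p f"
    and zero: "\<And>\<alpha>. \<alpha> \<in> multi_indices n p \<Longrightarrow> f (y \<circ> \<alpha>) = 0"
    and g: "g \<in> {1..p} \<rightarrow> {1..n}"
  shows "f (y \<circ> g) = 0"
proof (cases "inj_on g {1..p}")
  case True
  then obtain \<sigma> where \<sigma>: "\<sigma> permutes {1..p}" "strict_mono_on {1..p} (g \<circ> \<sigma>)"
    using exists_sorting_permutation by blast
  define \<alpha> where "\<alpha> = restrict (g \<circ> \<sigma>) {1..p}"
  have "\<alpha> \<in> multi_indices n p"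
    using \<sigma> g permutes_in_image [OF \<sigma>(1)]
    by (auto simp: multi_indices_def \<alpha>_def strict_mono_on_def Pi_iff)
  then have "f (y \<circ> \<alpha>) = 0" by (rule zero)
  also have "f (y \<circ> \<alpha>) = f ((y \<circ> g) \<circ> \<sigma>)"
    by (rule alternating_form_cong [OF f]) (simp add: \<alpha>_def)
  also have "\<dots> = of_int (sign \<sigma>) * f (y \<circ> g)"
    by (rule alternating_form_permute [OF f \<sigma>(1)])
  finally show ?thesis by (auto simp: sign_def split: if_splits)
next
  case False
  then obtain i j where "i \<in> {1..p}" "j \<in> {1..p}" "i \<noteq> j" "g i = g j"
    by (auto simp: inj_on_def)
  then show ?thesis
    using alternating_form_eq_slots [OF f] by auto
qed

text \<open>Multilinearity is used one slot at a time: \<open>m\<close> counts the slots filled with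
  arbitrary elements of the span, the later ones still hold vectors \<open>y j\<close>.\<close>

lemma alternating_form_eq_zero:
  assumes f: "alternating_form p f"
    and zero: "\<And>\<alpha>. \<alpha> \<in> multi_indices n p \<Longrightarrow> f (y \<circ> \<alpha>) = 0"
    and u: "\<And>i. i \<in> {1..p} \<Longrightarrow> u i \<in> span (y ` {1..n})"
  shows "f u = 0"
proof -
  have "f u = 0" if "m \<le> p" "\<And>i. i \<in> {1..m} \<Longrightarrow> u i \<in> span (y ` {1..n})"
    "\<And>i. i \<in> {m<..p} \<Longrightarrow> u i \<in> y ` {1..n}" for u m
    using that
  proof (induction m arbitrary: u)
    case 0
    have "\<forall>i\<in>{1..p}. \<exists>j\<in>{1..n}. u i = y j"
      using 0(3) by (metis One_nat_def Suc_le_eq atLeastAtMost_iff greaterThanAtMost_iff imageE)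
    then obtain g :: "nat \<Rightarrow> nat" where g: "\<forall>i\<in>{1..p}. g i \<in> {1..n} \<and> u i = y (g i)"
      by metis
    have "f u = f (y \<circ> g)"
      by (rule alternating_form_cong [OF f]) (use g in auto)
    moreover have "g \<in> {1..p} \<rightarrow> {1..n}"
      using g by auto
    ultimately show ?case
      by (simp only: alternating_form_eq_zero_if_basis [OF f zero])
  next
    case (Suc m)
    have lin: "linear (\<lambda>x. f (u(Suc m := x)))"
      using alternating_form_linear [OF f, of "Suc m" u] Suc.prems(1) by auto
    have "f (u(Suc m := x)) = 0" if "x \<in> span (y ` {1..n})" for x
    proof (rule linear_eq_0_on_span [OF lin _ that])
      fix b assume b: "b \<in> y ` {1..n}"
      show "f (u(Suc m := b)) = 0"
        by (rule Suc.IH) (use Suc.prems b in auto)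
    qed
    from this [of "u (Suc m)"] Suc.prems show ?case
      by simp
  qed
  from this [of p u] u show ?thesis by simp
qed

text \<open>A matrix and its transpose have the same determinant. This makes the facts about the
  second argument available for the first.\<close>

lemma wedge_commute: "wedge p v u = wedge p u v"
proof -
  have "wedge p v u = (\<Sum>\<pi> | \<pi> permutes {1..p}. of_int (sign (inv \<pi>)) * (\<Prod>i=1..p. v i \<bullet> u (inv \<pi> i)))"
    unfolding wedge_def by (rule sum_permutations_inverse)
  also have "\<dots> = (\<Sum>\<pi> | \<pi> permutes {1..p}. of_int (sign \<pi>) * (\<Prod>i=1..p. u i \<bullet> v (\<pi> i)))"
  proof (intro sum.cong refl)
    fix \<pi> assume "\<pi> \<in> {\<pi>. \<pi> permutes {1..p}}"
    then have \<pi>: "\<pi> permutes {1..p}" by simp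
    have "(\<Prod>i=1..p. v i \<bullet> u (inv \<pi> i)) = (\<Prod>i=1..p. v (\<pi> i) \<bullet> u (inv \<pi> (\<pi> i)))"
      using prod.permute [OF \<pi>, of "\<lambda>i. v i \<bullet> u (inv \<pi> i)"] by (simp add: o_def)
    moreover have "sign (inv \<pi>) = sign \<pi>"
      using \<pi> by (intro sign_inverse) (auto simp: permutation_permutes)
    ultimately show "of_int (sign (inv \<pi>)) * (\<Prod>i=1..p. v i \<bullet> u (inv \<pi> i))
        = of_int (sign \<pi>) * (\<Prod>i=1..p. u i \<bullet> v (\<pi> i))"
      by (simp add: permutes_inverses [OF \<pi>] inner_commute)
  qed
  finally show ?thesis by (simp add: wedge_def)
qed

lemma alternating_form_wedge: "alternating_form p (wedge p v)"
  unfolding alternating_form_def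
proof (intro conjI allI impI ballI)
  fix u w :: "nat \<Rightarrow> 'a" assume "\<forall>i\<in>{1..p}. u i = w i"
  then show "wedge p v u = wedge p v w"
    unfolding wedge_def
    by (intro sum.cong prod.cong refl arg_cong2 [where f = "(*)"])
      (metis mem_Collect_eq permutes_in_image)
next
  fix u :: "nat \<Rightarrow> 'a" and i assume i: "i \<in> {1..p}"
  show "linear (\<lambda>x. wedge p v (u(i := x)))"
    unfolding wedge_def
  proof (intro linear_compose_sum ballI)
    fix \<pi> assume "\<pi> \<in> {\<pi>. \<pi> permutes {1..p}}"
    then have \<pi>: "\<pi> permutes {1..p}" by simp
    define k where "k = inv \<pi> i"
    have k: "k \<in> {1..p}" "\<pi> k = i"
      using i permutes_in_image [OF permutes_inv [OF \<pi>]] permutes_inverses [OF \<pi>] by (auto simp: k_def)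
    have "(\<Prod>j=1..p. v j \<bullet> (u(i := x)) (\<pi> j)) = (v k \<bullet> x) * (\<Prod>j\<in>{1..p} - {k}. v j \<bullet> u (\<pi> j))" for x
    proof -
      have "(\<Prod>j\<in>{1..p} - {k}. v j \<bullet> (u(i := x)) (\<pi> j)) = (\<Prod>j\<in>{1..p} - {k}. v j \<bullet> u (\<pi> j))"
        using permutes_inj [OF \<pi>] k(2) by (intro prod.cong refl) (auto dest: injD)
      then show ?thesis
        using prod.remove [of "{1..p}" k "\<lambda>j. v j \<bullet> (u(i := x)) (\<pi> j)"] k by simp
    qed
    then show "linear (\<lambda>x. of_int (sign \<pi>) * (\<Prod>j=1..p. v j \<bullet> (u(i := x)) (\<pi> j)))"
      by (auto intro!: linearI simp: inner_add_right algebra_simps)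
  qed
next
  fix u :: "nat \<Rightarrow> 'a" and \<sigma> assume \<sigma>: "\<sigma> permutes {1..p}"
  have "wedge p v u = (\<Sum>\<pi> | \<pi> permutes {1..p}. of_int (sign (\<sigma> \<circ> \<pi>)) * (\<Prod>i=1..p. v i \<bullet> u ((\<sigma> \<circ> \<pi>) i)))"
    unfolding wedge_def by (rule setum_permutations_compose_left [OF \<sigma>])
  also have "\<dots> = (\<Sum>\<pi> | \<pi> permutes {1..p}. of_int (sign \<sigma>) * (of_int (sign \<pi>) * (\<Prod>i=1..p. v i \<bullet> (u \<circ> \<sigma>) (\<pi> i))))"
  proof (intro sum.cong refl)
    fix \<pi> assume "\<pi> \<in> {\<pi>. \<pi> permutes {1..p}}"
    then have "sign (\<sigma> \<circ> \<pi>) = sign \<sigma> * sign \<pi>"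
      using \<sigma> by (intro sign_compose) (auto simp: permutation_permutes)
    then show "of_int (sign (\<sigma> \<circ> \<pi>)) * (\<Prod>i=1..p. v i \<bullet> u ((\<sigma> \<circ> \<pi>) i))
        = of_int (sign \<sigma>) * (of_int (sign \<pi>) * (\<Prod>i=1..p. v i \<bullet> (u \<circ> \<sigma>) (\<pi> i)))"
      by simp
  qed
  also have "\<dots> = of_int (sign \<sigma>) * wedge p v (u \<circ> \<sigma>)"
    by (simp add: wedge_def sum_distrib_left)
  finally show "wedge p v (u \<circ> \<sigma>) = of_int (sign \<sigma>) * wedge p v u"
    by (auto simp: sign_def)
qed

lemma alternating_form_diff:
  assumes "alternating_form p f" "alternating_form p g"
  shows "alternating_form p (\<lambda>u. f u - g u)"
  using assms unfolding alternating_form_def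
  by (auto intro!: linear_compose_sub simp: algebra_simps) metis+

lemma alternating_form_linear_combination:
  assumes "\<And>a. a \<in> A \<Longrightarrow> alternating_form p (f a)"
  shows "alternating_form p (\<lambda>u. \<Sum>a\<in>A. c a * f a u)"
  unfolding alternating_form_def
proof (intro conjI allI impI ballI)
  fix u w :: "nat \<Rightarrow> 'b" assume "\<forall>i\<in>{1..p}. u i = w i"
  then show "(\<Sum>a\<in>A. c a * f a u) = (\<Sum>a\<in>A. c a * f a w)"
    using alternating_form_cong [OF assms] by (intro sum.cong refl) (metis (no_types, lifting))
next
  fix u :: "nat \<Rightarrow> 'b" and i assume "i \<in> {1..p}"
  then show "linear (\<lambda>x. \<Sum>a\<in>A. c a * f a (u(i := x)))"
    using linear_compose_scale_right [OF alternating_form_linear [OF assms]]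
    by (intro linear_compose_sum ballI) auto
next
  fix u :: "nat \<Rightarrow> 'b" and \<sigma> assume "\<sigma> permutes {1..p}"
  then show "(\<Sum>a\<in>A. c a * f a (u \<circ> \<sigma>)) = of_int (sign \<sigma>) * (\<Sum>a\<in>A. c a * f a u)"
    by (simp add: alternating_form_permute [OF assms] sum_distrib_left mult.left_commute)
qed

text \<open>Putting the combination into slot \<open>k\<close> multiplies the determinant by
  \<open>b k\<close>, since every other term repeats an argument; but then a whole column is
  zero.\<close>

lemma wedge_eq_zero_if_dependent:
  assumes k: "k \<in> {1..p}" "b k \<noteq> 0"
    and w: "\<And>i. i \<in> {1..p} \<Longrightarrow> (\<Sum>j=1..p. b j *\<^sub>R u j) \<bullet> v i = 0"
  shows "wedge p v u = 0"
proof -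
  note wedge = alternating_form_wedge [of p v]
  define s where "s = (\<Sum>j=1..p. b j *\<^sub>R u j)"
  have lin: "linear (\<lambda>x. wedge p v (u(k := x)))"
    by (rule alternating_form_linear [OF wedge k(1)])
  have "wedge p v (u(k := s)) = (\<Sum>j=1..p. b j * wedge p v (u(k := u j)))"
    unfolding s_def by (simp add: linear_sum [OF lin] linear_scale [OF lin])
  also have "\<dots> = (\<Sum>j\<in>{k}. b j * wedge p v (u(k := u j)))"
  proof (rule sum.mono_neutral_right)
    show "\<forall>j\<in>{1..p} - {k}. b j * wedge p v (u(k := u j)) = 0"
      using alternating_form_eq_slots [OF wedge k(1)] by auto
  qed (use k in auto)
  finally have 1: "wedge p v (u(k := s)) = b k * wedge p v u"
    by simp
  have "wedge p v (u(k := s)) = 0"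
    unfolding wedge_def
  proof (intro sum.neutral ballI)
    fix \<pi> assume "\<pi> \<in> {\<pi>. \<pi> permutes {1..p}}"
    then have \<pi>: "\<pi> permutes {1..p}" by simp
    have i: "inv \<pi> k \<in> {1..p}" "\<pi> (inv \<pi> k) = k"
      using k permutes_in_image [OF permutes_inv [OF \<pi>]] permutes_inverses [OF \<pi>] by auto
    then have "v (inv \<pi> k) \<bullet> (u(k := s)) (\<pi> (inv \<pi> k)) = 0"
      using w [OF i(1)] by (simp add: s_def inner_commute)
    then have "(\<Prod>i=1..p. v i \<bullet> (u(k := s)) (\<pi> i)) = 0"
      using i(1) by (intro prod_zero) blast+
    then show "of_int (sign \<pi>) * (\<Prod>i=1..p. v i \<bullet> (u(k := s)) (\<pi> i)) = 0" by simp
  qed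
  with 1 k show ?thesis by simp
qed

section \<open>Increasing multi-indices and dual bases\<close>

text \<open>As both indices are increasing, so is \<open>\<pi>\<close>, and an increasing
  permutation of \<open>{1..p}\<close> is the identity.\<close>

lemma multi_indices_permute_eq:
  assumes "\<alpha> \<in> multi_indices n p" "\<beta> \<in> multi_indices n p" "\<pi> permutes {1..p}"
    and eq: "\<And>i. i \<in> {1..p} \<Longrightarrow> \<beta> i = \<alpha> (\<pi> i)"
  shows "\<pi> = id \<and> \<alpha> = \<beta>"
proof -
  have sm: "strict_mono_on {1..p} \<alpha>" "strict_mono_on {1..p} \<beta>"
    using assms(1,2) by (auto simp: multi_indices_def)
  have "\<pi> i < \<pi> j" if "i \<in> {1..p}" "j \<in> {1..p}" "i < j" for i j
  proof -
    have "\<alpha> (\<pi> i) < \<alpha> (\<pi> j)"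
      using strict_mono_onD [OF sm(2) that] eq that by simp
    then show ?thesis
      using strict_mono_on_leD [OF sm(1)] permutes_in_image [OF assms(3)] that
      by (meson linorder_not_le)
  qed
  then have mono: "strict_mono_on {1..p} \<pi>"
    by (auto simp: strict_mono_on_def)
  have fixed: "\<pi> i = i" for i
  proof (induction i rule: less_induct)
    case (less i)
    show ?case
    proof (cases "i \<in> {1..p}")
      case True
      then have "\<pi> i \<in> {1..p}" using permutes_in_image [OF assms(3)] by simp
      obtain j where j: "j \<in> {1..p}" "\<pi> j = i"
        using True permutes_image [OF assms(3)] by (metis imageE)
      have "\<not> \<pi> i < i"
      proof
        assume lt: "\<pi> i < i"
        then have "\<pi> (\<pi> i) = \<pi> i" using less by blast
        then show False using lt permutes_inj [OF assms(3)] by (metis injD less_irrefl)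
      qed
      moreover have "\<not> i < \<pi> i"
      proof
        assume lt: "i < \<pi> i"
        then have "j < i"
          using j mono True strict_mono_on_leD [OF mono True j(1)] by force
        then show False using less [of j] j by simp
      qed
      ultimately show ?thesis by simp
    qed (use permutes_not_in [OF assms(3)] in simp)
  qed
  then have "\<alpha> i = \<beta> i" for i
    using eq [of i] assms(1,2) by (cases "i \<in> {1..p}") (auto simp: multi_indices_def PiE_def extensional_def)
  with fixed show ?thesis by auto
qed

text \<open>Only the identity permutation can contribute to the determinant. Evaluation on a dual
  basis therefore reads off single coefficients of a \<open>p\<close>-vector.\<close>

lemma wedge_dual:
  assumes dual: "\<And>i j. i \<in> {1..n} \<Longrightarrow> j \<in> {1..n} \<Longrightarrow> y i \<bullet> u j = (if i = j then 1 else 0)"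
    and \<alpha>: "\<alpha> \<in> multi_indices n p" and \<beta>: "\<beta> \<in> multi_indices n p"
  shows "wedge p (\<lambda>i. y (\<beta> i)) (u \<circ> \<alpha>) = (if \<alpha> = \<beta> then 1 else 0)"
proof -
  have range: "\<alpha> i \<in> {1..n}" "\<beta> i \<in> {1..n}" if "i \<in> {1..p}" for i
    using \<alpha> \<beta> that by (auto simp: multi_indices_def)
  have "(\<Prod>i=1..p. y (\<beta> i) \<bullet> (u \<circ> \<alpha>) (\<pi> i)) = (if \<pi> = id \<and> \<alpha> = \<beta> then 1 else 0)"
    if \<pi>: "\<pi> permutes {1..p}" for \<pi>
  proof -
    have eq: "y (\<beta> i) \<bullet> (u \<circ> \<alpha>) (\<pi> i) = (if \<beta> i = \<alpha> (\<pi> i) then 1 else 0)" if "i \<in> {1..p}" for i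
      using dual [OF range(2) range(1), of i "\<pi> i"] that permutes_in_image [OF \<pi>] by auto
    show ?thesis
    proof (cases "\<forall>i\<in>{1..p}. \<beta> i = \<alpha> (\<pi> i)")
      case True
      then have "\<pi> = id \<and> \<alpha> = \<beta>"
        using multi_indices_permute_eq [OF \<alpha> \<beta> \<pi>] by blast
      moreover have "(\<Prod>i=1..p. y (\<beta> i) \<bullet> (u \<circ> \<alpha>) (\<pi> i)) = 1"
        using True eq by (intro prod.neutral ballI) presburger
      ultimately show ?thesis by simp
    next
      case False
      then obtain i where "i \<in> {1..p}" "\<beta> i \<noteq> \<alpha> (\<pi> i)" by auto
      then have "(\<Prod>i=1..p. y (\<beta> i) \<bullet> (u \<circ> \<alpha>) (\<pi> i)) = 0"
        using eq by (intro prod_zero) auto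
      moreover have "\<not> (\<pi> = id \<and> \<alpha> = \<beta>)"
        using False by auto
      ultimately show ?thesis by auto
    qed
  qed
  then have "wedge p (\<lambda>i. y (\<beta> i)) (u \<circ> \<alpha>)
      = (\<Sum>\<pi> | \<pi> permutes {1..p}. of_int (sign \<pi>) * (if \<pi> = id \<and> \<alpha> = \<beta> then 1 else 0))"
    unfolding wedge_def by (intro sum.cong refl) auto
  also have "\<dots> = (\<Sum>\<pi>\<in>{id :: nat \<Rightarrow> nat}. of_int (sign \<pi>) * (if \<pi> = id \<and> \<alpha> = \<beta> then 1 else 0))"
  proof (rule sum.mono_neutral_right)
    show "finite {\<pi>. \<pi> permutes {1..p}}"
      by (rule finite_permutations) simp
  qed (auto simp: permutes_id)
  finally show ?thesis by (simp add: sign_id)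
qed

lemma finite_multi_indices: "finite (multi_indices n p)"
  unfolding multi_indices_def by (rule finite_subset [of _ "{1..p} \<rightarrow>\<^sub>E {1..n}"]) (auto intro!: finite_PiE)

text \<open>The reason why alternating \<open>p\<close>-forms on a \<open>p\<close>-dimensional
  space are determined by one value.\<close>

lemma multi_indices_self: "\<alpha> \<in> multi_indices p p \<Longrightarrow> \<alpha> = restrict id {1..p}"
proof -
  assume \<alpha>: "\<alpha> \<in> multi_indices p p"
  have r: "restrict id {1..p} \<in> multi_indices p p"
    by (auto simp: multi_indices_def strict_mono_on_def)
  have "bij_betw \<alpha> {1..p} {1..p}"
  proof -
    have "inj_on \<alpha> {1..p}" "\<alpha> ` {1..p} \<subseteq> {1..p}"
      using \<alpha> by (auto simp: multi_indices_def intro: strict_mono_on_imp_inj_on)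
    then show ?thesis
      by (simp add: bij_betw_def endo_inj_surj)
  qed
  then have perm: "(\<lambda>i. if i \<in> {1..p} then \<alpha> i else i) permutes {1..p}"
    by (rule permutes_extend)
  have "\<alpha> i \<in> {1..p}" if "i \<in> {1..p}" for i
    using \<alpha> that by (auto simp: multi_indices_def)
  then have "\<alpha> i = restrict id {1..p} (if i \<in> {1..p} then \<alpha> i else i)" if "i \<in> {1..p}" for i
    using that by simp
  from multi_indices_permute_eq [OF r \<alpha> perm this] show ?thesis by blast
qed

section \<open>The degree of a point\<close>

text \<open>Replaces the definite description of the degree by a usable witness. The coefficient of
  \<open>\<alpha>\<close> is the determinant of the \<open>\<alpha>\<close> coordinates on the
  tangent space, so a nonzero coefficient means that no nonzero tangent vector has all of these
  coordinates zero.\<close>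

lemma point_deg_witness:
  fixes X :: "nat \<Rightarrow> 'a::euclidean_space"
  defines "n \<equiv> DIM('a)" and "p \<equiv> CARD('p::finite)"
  assumes dual: "\<And>i j. i \<in> {1..n} \<Longrightarrow> j \<in> {1..n} \<Longrightarrow>
      left_inv_field mul (X i) x \<bullet> u j = (if i = j then 1 else 0)"
    and subspace: "subspace (tangent_space TYPE('p) T x)"
    and dim: "dim (tangent_space TYPE('p) T x) = p"
  obtains \<alpha> where "\<alpha> \<in> multi_indices n p" "multi_deg V p \<alpha> = point_deg TYPE('p) mul V X T x"
    "\<And>v. v \<in> tangent_space TYPE('p) T x \<Longrightarrow> (\<And>i. i \<in> {1..p} \<Longrightarrow> v \<bullet> u (\<alpha> i) = 0) \<Longrightarrow> v = 0"
proof -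
  let ?TS = "tangent_space TYPE('p) T x"
  define y where "y i = left_inv_field mul (X i) x" for i
  have dual': "y i \<bullet> u j = (if i = j then 1 else 0)" if "i \<in> {1..n}" "j \<in> {1..n}" for i j
    using dual that by (simp add: y_def)
  \<comment> \<open>Being dual to \<open>y\<close>, the \<open>u j\<close> are independent, and
    there are \<open>DIM('a)\<close> of them; so an alternating form is determined by its values on
    the tuples \<open>u \<circ> \<alpha>\<close>.\<close>
  have span_u: "span (u ` {1..n}) = UNIV"
  proof -
    have inj: "inj_on u {1..n}"
      by (rule inj_onI) (metis dual' zero_neq_one)
    have "independent (u ` {1..n})"
    proof (rule independent_if_scalars_zero)
      fix f z assume s: "(\<Sum>z\<in>u ` {1..n}. f z *\<^sub>R z) = 0" and "z \<in> u ` {1..n}"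
      then obtain k where k: "k \<in> {1..n}" "z = u k" by auto
      have "0 = y k \<bullet> (\<Sum>j\<in>{1..n}. f (u j) *\<^sub>R u j)"
        using s unfolding sum.reindex [OF inj] by simp
      also have "\<dots> = (\<Sum>j\<in>{1..n}. f (u j) * (if k = j then 1 else 0))"
        unfolding inner_sum_right inner_scaleR_right using dual' [OF k(1)] by (intro sum.cong refl) auto
      also have "\<dots> = f (u k)"
        using k(1) by (simp add: if_distrib [where f = "\<lambda>c. _ * c"] cong: if_cong)
      finally show "f z = 0" using k by simp
    qed simp
    then have "dim (u ` {1..n}) = DIM('a)"
      using card_image [OF inj] by (simp add: dim_eq_card_independent n_def)
    then show ?thesis by (simp add: dim_eq_full)
  qed
  \<comment> \<open>An orthonormal basis is taken so that the Gram determinant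
    \<open>wedge p v v\<close> equals 1 below.\<close>
  obtain B where B: "B \<subseteq> ?TS" "pairwise orthogonal B" "\<And>b. b \<in> B \<Longrightarrow> norm b = 1"
      "independent B" "card B = p" "span B = ?TS"
    using orthonormal_basis_subspace [OF subspace] dim by metis
  have "finite B" using B(4) independent_bound by blast
  then obtain v where v: "bij_betw v {1..p} B"
    using ex_bij_betw_nat_finite_1 [of B] B(5) by blast
  have v_ortho: "v i \<bullet> v j = (if i = j then 1 else 0)" if "i \<in> {1..p}" "j \<in> {1..p}" for i j
  proof (cases "i = j")
    case True
    then show ?thesis using B(3) v that by (simp add: bij_betwE norm_eq_1)
  next
    case False
    then have "v i \<in> B" "v j \<in> B" "v i \<noteq> v j"
      using v that by (blast dest: bij_betwE, blast dest: bij_betwE, metis bij_betw_imp_inj_on inj_onD)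
    then have "orthogonal (v i) (v j)"
      using B(2) unfolding pairwise_def by blast
    then show ?thesis
      using False by (simp add: orthogonal_def)
  qed
  have v_image: "v ` {1..p} = B" and v_inj: "inj_on v {1..p}"
    using v by (auto simp: bij_betw_def)
  define c where "c \<alpha> = wedge p v (u \<circ> \<alpha>)" for \<alpha>
  have coeff: "c' \<alpha> = wedge p v' (u \<circ> \<alpha>)"
    if "wedge p v' = (\<lambda>u. \<Sum>\<alpha>\<in>multi_indices n p. c' \<alpha> * wedge p (\<lambda>i. y (\<alpha> i)) u)"
      "\<alpha> \<in> multi_indices n p" for v' c' \<alpha>
  proof -
    have "wedge p v' (u \<circ> \<alpha>) = (\<Sum>\<beta>\<in>multi_indices n p. c' \<beta> * (if \<alpha> = \<beta> then 1 else 0))"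
      using wedge_dual [OF dual' that(2)] by (simp add: that(1))
    also have "\<dots> = c' \<alpha>"
      using that(2) by (simp add: finite_multi_indices if_distrib [where f = "\<lambda>c. _ * c"] cong: if_cong)
    finally show ?thesis ..
  qed
  have expansion: "wedge p v = (\<lambda>u. \<Sum>\<alpha>\<in>multi_indices n p. c \<alpha> * wedge p (\<lambda>i. y (\<alpha> i)) u)"
  proof
    fix w
    have "wedge p v w - (\<Sum>\<alpha>\<in>multi_indices n p. c \<alpha> * wedge p (\<lambda>i. y (\<alpha> i)) w) = 0"
    proof (rule alternating_form_eq_zero [where u = w and y = u and n = n and
          f = "\<lambda>w. wedge p v w - (\<Sum>\<alpha>\<in>multi_indices n p. c \<alpha> * wedge p (\<lambda>i. y (\<alpha> i)) w)"])
      show "alternating_form p (\<lambda>w. wedge p v w - (\<Sum>\<alpha>\<in>multi_indices n p. c \<alpha> * wedge p (\<lambda>i. y (\<alpha> i)) w))"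
        by (intro alternating_form_diff alternating_form_linear_combination alternating_form_wedge)
      show "w i \<in> span (u ` {1..n})" for i
        unfolding span_u by simp
      show "wedge p v (u \<circ> \<alpha>) - (\<Sum>\<beta>\<in>multi_indices n p. c \<beta> * wedge p (\<lambda>i. y (\<beta> i)) (u \<circ> \<alpha>)) = 0"
        if "\<alpha> \<in> multi_indices n p" for \<alpha>
        using wedge_dual [OF dual' that] that
        by (simp add: finite_multi_indices c_def if_distrib [where f = "\<lambda>c. _ * c"] cong: if_cong)
    qed
    then show "wedge p v w = (\<Sum>\<alpha>\<in>multi_indices n p. c \<alpha> * wedge p (\<lambda>i. y (\<alpha> i)) w)" by simp
  qed
  \<comment> \<open>For fixed \<open>w\<close> the wedge is an alternating form in its first
    argument, determined on the span of \<open>p\<close> vectors by its value on them. Hence every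
    basis of the tangent space has the same set of nonzero coefficients, which makes the degree well
    defined.\<close>
  have transfer: "wedge p v' w = 0"
    if "wedge p v w = 0" "\<And>i. i \<in> {1..p} \<Longrightarrow> v' i \<in> span (v ` {1..p})" for v v' w :: "nat \<Rightarrow> 'a"
  proof -
    have "wedge p w v' = 0"
    proof (rule alternating_form_eq_zero [OF alternating_form_wedge _ that(2)])
      fix \<alpha> assume "\<alpha> \<in> multi_indices p p"
      then have "\<alpha> = restrict id {1..p}" by (rule multi_indices_self)
      then have "wedge p w (v \<circ> \<alpha>) = wedge p w v"
        by (intro alternating_form_cong [OF alternating_form_wedge]) auto
      then show "wedge p w (v \<circ> \<alpha>) = 0"
        using that(1) by (simp add: wedge_commute)
    qed
    then show ?thesis by (simp add: wedge_commute)
  qed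
  define k where "k = Max {multi_deg V p \<alpha> | \<alpha>. \<alpha> \<in> multi_indices n p \<and> c \<alpha> \<noteq> 0}"
  have "point_deg TYPE('p) mul V X T x = k"
    unfolding point_deg_def y_def [symmetric] n_def [symmetric] p_def [symmetric]
  proof (rule the_equality)
    show "\<exists>v c. inj_on v {1..p} \<and> independent (v ` {1..p}) \<and> span (v ` {1..p}) = ?TS \<and>
       wedge p v = (\<lambda>u. \<Sum>\<alpha>\<in>multi_indices n p. c \<alpha> * wedge p (\<lambda>i. y (\<alpha> i)) u) \<and>
       k = Max {multi_deg V p \<alpha> |\<alpha>. \<alpha> \<in> multi_indices n p \<and> c \<alpha> \<noteq> 0}"
      by (rule exI [of _ v], rule exI [of _ c], intro conjI v_inj expansion k_def)
        (simp_all only: v_image B not_False_eq_True)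
  next
    fix k' assume "\<exists>v c. inj_on v {1..p} \<and> independent (v ` {1..p}) \<and> span (v ` {1..p}) = ?TS \<and>
       wedge p v = (\<lambda>u. \<Sum>\<alpha>\<in>multi_indices n p. c \<alpha> * wedge p (\<lambda>i. y (\<alpha> i)) u) \<and>
       k' = Max {multi_deg V p \<alpha> |\<alpha>. \<alpha> \<in> multi_indices n p \<and> c \<alpha> \<noteq> 0}"
    then obtain v' c' where v': "span (v' ` {1..p}) = ?TS"
       "wedge p v' = (\<lambda>u. \<Sum>\<alpha>\<in>multi_indices n p. c' \<alpha> * wedge p (\<lambda>i. y (\<alpha> i)) u)"
       "k' = Max {multi_deg V p \<alpha> |\<alpha>. \<alpha> \<in> multi_indices n p \<and> c' \<alpha> \<noteq> 0}"
      by blast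
    have "c' \<alpha> = 0 \<longleftrightarrow> c \<alpha> = 0" if "\<alpha> \<in> multi_indices n p" for \<alpha>
    proof -
      have "v i \<in> span (v' ` {1..p})" "v' i \<in> span (v ` {1..p})" if "i \<in> {1..p}" for i
        using that v'(1) B(6) v_image by (metis image_eqI span_base)+
      then show ?thesis
        unfolding coeff [OF v'(2) that] c_def using transfer by blast
    qed
    then have "{multi_deg V p \<alpha> |\<alpha>. \<alpha> \<in> multi_indices n p \<and> c' \<alpha> \<noteq> 0}
        = {multi_deg V p \<alpha> |\<alpha>. \<alpha> \<in> multi_indices n p \<and> c \<alpha> \<noteq> 0}"
      by blast
    then show "k' = k" by (simp add: v'(3) k_def)
  qed
  moreover have "k \<in> {multi_deg V p \<alpha> | \<alpha>. \<alpha> \<in> multi_indices n p \<and> c \<alpha> \<noteq> 0}"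
    unfolding k_def
  proof (rule Max_in)
    show "finite {multi_deg V p \<alpha> | \<alpha>. \<alpha> \<in> multi_indices n p \<and> c \<alpha> \<noteq> 0}"
      using finite_multi_indices [of n p] by simp
    \<comment> \<open>The maximum has to be taken over a nonempty set: the expansion is nonzero at
      \<open>v\<close>, so some coefficient is nonzero.\<close>
    have "wedge p v v = 1"
    proof -
      have r: "restrict id {1..p} \<in> multi_indices p p"
        by (auto simp: multi_indices_def strict_mono_on_def)
      have "wedge p v v = wedge p v (v \<circ> restrict id {1..p})"
        by (rule alternating_form_cong [OF alternating_form_wedge]) auto
      also have "\<dots> = wedge p (v \<circ> restrict id {1..p}) v"
        by (rule wedge_commute)
      also have "\<dots> = wedge p (v \<circ> restrict id {1..p}) (v \<circ> restrict id {1..p})"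
        by (rule alternating_form_cong [OF alternating_form_wedge]) auto
      also have "\<dots> = 1"
        using wedge_dual [OF v_ortho r r] by (simp add: o_def)
      finally show ?thesis .
    qed
    then have "(\<Sum>\<alpha>\<in>multi_indices n p. c \<alpha> * wedge p (\<lambda>i. y (\<alpha> i)) v) \<noteq> 0"
      using fun_cong [OF expansion, of v] by simp
    then have "\<not> (\<forall>\<alpha>\<in>multi_indices n p. c \<alpha> = 0)"
      by (metis (no_types, lifting) mult_zero_left sum.neutral)
    then show "{multi_deg V p \<alpha> | \<alpha>. \<alpha> \<in> multi_indices n p \<and> c \<alpha> \<noteq> 0} \<noteq> {}" by blast
  qed
  ultimately obtain \<alpha> where \<alpha>: "\<alpha> \<in> multi_indices n p" "c \<alpha> \<noteq> 0"
      "multi_deg V p \<alpha> = point_deg TYPE('p) mul V X T x" by auto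
  have "z = 0" if z: "z \<in> ?TS" "\<And>i. i \<in> {1..p} \<Longrightarrow> z \<bullet> u (\<alpha> i) = 0" for z
  proof (rule ccontr)
    assume "z \<noteq> 0"
    have "z \<in> span (v ` {1..p})" using z(1) B(6) v_image by simp
    then obtain b where b: "z = (\<Sum>j=1..p. b j *\<^sub>R v j)"
    proof -
      obtain f where "z = (\<Sum>x\<in>v ` {1..p}. f x *\<^sub>R x)"
        using \<open>z \<in> span (v ` {1..p})\<close> by (auto simp: span_finite)
      then show thesis
        unfolding sum.reindex [OF v_inj] o_def by (rule that)
    qed
    with \<open>z \<noteq> 0\<close> obtain j where "j \<in> {1..p}" "b j \<noteq> 0"
      by (metis (no_types, lifting) scaleR_zero_left sum.neutral)
    then have "wedge p (u \<circ> \<alpha>) v = 0"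
      by (rule wedge_eq_zero_if_dependent) (use z(2) b in auto)
    then show False using \<alpha>(2) by (simp add: c_def wedge_commute)
  qed
  with \<alpha> show thesis by (intro that) auto
qed

section \<open>Tangent spaces\<close>

text \<open>The transition map \<open>\<zeta>\<close> between the charts is only known to be
  continuous. Difference quotients of \<open>\<phi>\<close> are compared directly with values of
  \<open>\<psi>' w\<close>, using that the injective \<open>\<psi>' w\<close> controls the
  increments of \<open>\<zeta>\<close>; the limit \<open>z\<close> is tested against the orthogonal
  complement of the range.\<close>

lemma C1_param_tangent_subset:
  fixes \<phi> \<psi> :: "real ^ 'p::finite \<Rightarrow> 'a::euclidean_space"
  assumes \<phi>: "C1_param T U \<phi> \<phi>'" and \<psi>: "C1_param T W \<psi> \<psi>'"
    and "u \<in> U" "w \<in> W" "\<phi> u = \<psi> w"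
  shows "range (\<phi>' u) \<subseteq> range (\<psi>' w)"
proof
  fix z assume "z \<in> range (\<phi>' u)"
  then obtain h where z: "z = \<phi>' u h" by auto
  have "open U" "open W"
    and oU: "openin T (\<phi> ` U)" and oW: "openin T (\<psi> ` W)"
    and hU: "homeomorphic_map (top_of_set U) (subtopology T (\<phi> ` U)) \<phi>"
    and hW: "homeomorphic_map (top_of_set W) (subtopology T (\<psi> ` W)) \<psi>"
    and dU: "(\<phi> has_derivative \<phi>' u) (at u)"
    and dW: "(\<psi> has_derivative \<psi>' w) (at w)" and injW: "inj (\<psi>' w)"
    using \<phi> \<psi> \<open>u \<in> U\<close> \<open>w \<in> W\<close> by (auto simp: C1_param_def)
  obtain g where g: "homeomorphic_maps (top_of_set W) (subtopology T (\<psi> ` W)) \<psi> g"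
    using hW homeomorphic_map_maps by blast
  have c\<phi>: "continuous_map (top_of_set U) T \<phi>"
    using hU by (auto simp: homeomorphic_imp_continuous_map continuous_map_in_subtopology dest: homeomorphic_imp_continuous_map)
  define U' where "U' = {y \<in> U. \<phi> y \<in> \<psi> ` W}"
  have "openin (top_of_set U) U'"
    using openin_continuous_map_preimage [OF c\<phi> oW] by (simp add: U'_def)
  then have "open U'" using \<open>open U\<close> openin_open_trans by blast
  have "u \<in> U'" using assms by (auto simp: U'_def)
  have "continuous_map (top_of_set U') (subtopology T (\<psi> ` W)) \<phi>"
    using c\<phi> by (auto simp: continuous_map_in_subtopology U'_def
        intro: continuous_map_from_subtopology_mono)
  then have "continuous_map (top_of_set U') (top_of_set W) (g \<circ> \<phi>)"
    using g continuous_map_compose unfolding homeomorphic_maps_def by blast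
  then have "continuous_on U' (g \<circ> \<phi>)"
    by (simp add: continuous_map_in_subtopology)
  then have "isCont (g \<circ> \<phi>) u"
    using \<open>open U'\<close> \<open>u \<in> U'\<close> continuous_on_eq_continuous_at by blast
  define \<zeta> where "\<zeta> = g \<circ> \<phi>"
  have \<zeta>u: "\<zeta> u = w"
    using g assms by (auto simp: \<zeta>_def homeomorphic_maps_def)
  have \<zeta>: "\<psi> (\<zeta> y) = \<phi> y" if "y \<in> U'" for y
  proof -
    have "\<phi> y \<in> topspace (subtopology T (\<psi> ` W))"
      using that oW openin_subset by (auto simp: U'_def)
    then show ?thesis using g by (simp add: \<zeta>_def homeomorphic_maps_def)
  qed
  define line where "line t = u + t *\<^sub>R h" for t :: real
  have line_cont: "isCont line 0"
    unfolding line_def by (intro continuous_intros)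
  have line0: "line 0 = u" by (simp add: line_def)
  have "isCont (\<lambda>t. \<zeta> (line t)) 0"
    using continuous_at_compose [OF line_cont, of \<zeta>] \<open>isCont (g \<circ> \<phi>) u\<close>
    by (simp add: o_def \<zeta>_def line0)
  then have \<zeta>_lim: "((\<lambda>t. \<zeta> (line t)) \<longlongrightarrow> w) (at 0)"
    by (simp add: isCont_def line0 \<zeta>u)
  have in_U': "\<forall>\<^sub>F t in at 0. line t \<in> U'"
  proof -
    have "(line \<longlongrightarrow> u) (at 0)" using line_cont by (simp add: isCont_def line0)
    then show ?thesis using topological_tendstoD [OF _ \<open>open U'\<close> \<open>u \<in> U'\<close>] by blast
  qed
  have q_lim: "((\<lambda>t. (1 / t) *\<^sub>R (\<phi> (line t) - \<phi> u)) \<longlongrightarrow> z) (at 0)"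
  proof -
    have 1: "(line has_derivative (\<lambda>t. t *\<^sub>R h)) (at 0)"
      unfolding line_def by (auto intro!: derivative_eq_intros)
    have "((\<lambda>t. \<phi> (line t)) has_derivative (\<lambda>t. \<phi>' u (t *\<^sub>R h))) (at 0)"
      using has_derivative_compose [OF 1, of \<phi> "\<phi>' u"] dU by (simp add: line0)
    then have "((\<lambda>t. \<phi> (line t)) has_vector_derivative z) (at 0)"
      by (simp add: has_vector_derivative_def z blinfun.scaleR_right)
    then show ?thesis
      unfolding has_vector_derivative_iff_lim by (simp add: line0)
  qed
  have lin: "linear (\<psi>' w)"
    using blinfun.bounded_linear_right linear_conv_bounded_linear by blast
  obtain c where c: "c > 0" "\<And>y. c * norm y \<le> norm (\<psi>' w y)"
    using linear_inj_bounded_below_pos [OF lin injW] by blast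
  have "z \<bullet> m = 0" if m: "\<And>y. \<psi>' w y \<bullet> m = 0" for m
  proof (rule ccontr)
    assume "z \<bullet> m \<noteq> 0"
    \<comment> \<open>The bound \<open>c / 2\<close> lets the remainder be absorbed when
      \<open>norm \<delta>\<close> is estimated by \<open>norm \<Delta>\<close>; the other one makes
      the limiting inequality read \<open>\<bar>z \<bullet> m\<bar> \<le> \<bar>z \<bullet> m\<bar>
      / 2\<close>. The summands 1 keep the denominator positive.\<close>
    define e where "e = min (c / 2) (c * \<bar>z \<bullet> m\<bar> / (4 * (norm m + 1) * (norm z + 1)))"
    have "e > 0"
      using \<open>c > 0\<close> \<open>z \<bullet> m \<noteq> 0\<close> by (auto simp: e_def intro!: divide_pos_pos mult_pos_pos add_nonneg_pos)
    obtain d where "d > 0" and d: "\<And>y. norm (y - w) < d \<Longrightarrow>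
        norm (\<psi> y - \<psi> w - \<psi>' w (y - w)) \<le> e * norm (y - w)"
      using dW \<open>e > 0\<close> unfolding has_derivative_at_alt by blast
    have near: "\<forall>\<^sub>F t in at 0. norm (\<zeta> (line t) - w) < d"
      using tendstoD [OF \<zeta>_lim \<open>d > 0\<close>] by (simp add: dist_norm)
    have "\<forall>\<^sub>F t in at 0. \<bar>((1 / t) *\<^sub>R (\<phi> (line t) - \<phi> u)) \<bullet> m\<bar>
        \<le> norm m * (2 * e / c) * norm ((1 / t) *\<^sub>R (\<phi> (line t) - \<phi> u))"
      using near in_U'
    proof eventually_elim
      fix t assume t: "norm (\<zeta> (line t) - w) < d" "line t \<in> U'"
      define \<delta> where "\<delta> = \<zeta> (line t) - w"
      define \<Delta> where "\<Delta> = \<phi> (line t) - \<phi> u"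
      have \<Delta>: "norm (\<Delta> - \<psi>' w \<delta>) \<le> e * norm \<delta>"
        using d [OF t(1)] \<zeta> [OF t(2)] assms(5) by (simp add: \<delta>_def \<Delta>_def)
      have "c * norm \<delta> \<le> norm (\<psi>' w \<delta>)" by (rule c(2))
      also have "\<dots> \<le> norm \<Delta> + e * norm \<delta>"
        using \<Delta> norm_triangle_sub [of "\<psi>' w \<delta>" \<Delta>] by (simp add: norm_minus_commute)
      also have "\<dots> \<le> norm \<Delta> + (c / 2) * norm \<delta>"
        by (intro add_left_mono mult_right_mono) (simp_all only: e_def min.cobounded1 norm_ge_zero)
      finally have "norm \<delta> \<le> (2 / c) * norm \<Delta>"
        using \<open>c > 0\<close> by (simp add: field_simps)
      have "\<bar>\<Delta> \<bullet> m\<bar> = \<bar>(\<Delta> - \<psi>' w \<delta>) \<bullet> m\<bar>"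
        by (simp add: inner_diff_left m)
      also have "\<dots> \<le> norm (\<Delta> - \<psi>' w \<delta>) * norm m"
        by (rule Cauchy_Schwarz_ineq2)
      also have "\<dots> \<le> (e * ((2 / c) * norm \<Delta>)) * norm m"
        using order_trans [OF \<Delta> mult_left_mono [OF \<open>norm \<delta> \<le> (2 / c) * norm \<Delta>\<close>]] \<open>e > 0\<close>
        by (intro mult_right_mono) simp_all
      finally have "\<bar>\<Delta> \<bullet> m\<bar> \<le> norm m * (2 * e / c) * norm \<Delta>"
        by (simp add: field_simps)
      then have "\<bar>1 / t\<bar> * \<bar>\<Delta> \<bullet> m\<bar> \<le> \<bar>1 / t\<bar> * (norm m * (2 * e / c) * norm \<Delta>)"
        by (rule mult_left_mono) auto
      then show "\<bar>((1 / t) *\<^sub>R (\<phi> (line t) - \<phi> u)) \<bullet> m\<bar>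
          \<le> norm m * (2 * e / c) * norm ((1 / t) *\<^sub>R (\<phi> (line t) - \<phi> u))"
        unfolding \<Delta>_def [symmetric] by (simp add: abs_mult mult_ac)
    qed
    then have "\<bar>z \<bullet> m\<bar> \<le> norm m * (2 * e / c) * norm z"
      by (rule tendsto_le [OF trivial_limit_at, rotated 2]) (intro tendsto_intros q_lim)+
    also have "\<dots> \<le> (norm m + 1) * (2 * (c * \<bar>z \<bullet> m\<bar> / (4 * (norm m + 1) * (norm z + 1))) / c) * (norm z + 1)"
      using \<open>c > 0\<close> \<open>e > 0\<close> by (intro mult_mono divide_right_mono) (auto simp: e_def)
    also have "\<dots> = \<bar>z \<bullet> m\<bar> / 2"
    proof -
      have "norm m + 1 \<noteq> 0" "norm z + 1 \<noteq> 0"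
        by (metis add.commute add_le_same_cancel2 norm_ge_zero not_one_le_zero)+
      moreover have "M * (2 * (c * a / (4 * M * Z)) / c) * Z = a / 2" if "M \<noteq> 0" "Z \<noteq> 0" for M Z a :: real
        using that \<open>c > 0\<close> by (simp add: field_simps)
      ultimately show ?thesis by blast
    qed
    finally show False using \<open>z \<bullet> m \<noteq> 0\<close> by simp
  qed
  then have "z \<in> ((range (\<psi>' w))\<^sup>\<bottom>)\<^sup>\<bottom>"
    by (auto simp: orthogonal_comp_def orthogonal_def inner_commute)
  then show "z \<in> range (\<psi>' w)"
    using orthogonal_comp_self [OF linear_subspace_image [OF lin subspace_UNIV]] by simp
qed

lemma tangent_space_eq:
  fixes \<phi> :: "real ^ 'p::finite \<Rightarrow> 'a::euclidean_space"
  assumes "C1_param T W \<phi> \<phi>'" "w \<in> W"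
  shows "tangent_space TYPE('p) T (\<phi> w) = range (\<phi>' w)"
  unfolding tangent_space_def using C1_param_tangent_subset [OF _ assms(1)] assms by blast

section \<open>Graded coordinates\<close>

locale graded_exp_group = exp_lie_group mul
  for mul :: "'a::euclidean_space \<Rightarrow> 'a \<Rightarrow> 'a" +
  fixes V :: "nat \<Rightarrow> 'a set" and \<iota> :: nat and X :: "nat \<Rightarrow> 'a"
  assumes stratified: "stratified_group mul V \<iota>"
    and graded: "graded_basis V \<iota> X"
begin

abbreviation dg :: "nat \<Rightarrow> nat" where "dg \<equiv> deg V"
abbreviation ls :: "nat \<Rightarrow> nat" where "ls \<equiv> layer_sum V"

lemma X_inner: "i \<in> {1..DIM('a)} \<Longrightarrow> j \<in> {1..DIM('a)} \<Longrightarrow> X i \<bullet> X j = (if i = j then 1 else 0)"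
  using graded by (simp add: graded_basis_def)

lemma V_eq_span: "j \<in> {1..\<iota>} \<Longrightarrow> V j = span (X ` {ls (j - 1) + 1..ls j})"
  using graded by (simp add: graded_basis_def)

lemma subspace_V: "i \<ge> 1 \<Longrightarrow> subspace (V i)"
  using stratified by (simp add: stratified_group_def)

lemma V_Suc: "i \<ge> 1 \<Longrightarrow> V (Suc i) = span {bracket v w | v w. v \<in> V 1 \<and> w \<in> V i}"
  using stratified by (simp add: stratified_group_def)

lemma V_eq_0: "i > \<iota> \<Longrightarrow> V i = {0}"
proof -
  have "V (Suc (\<iota> + k)) = {0}" for k
  proof (induction k)
    case 0
    then show ?case using stratified by (simp add: stratified_group_def)
  next
    case (Suc k)
    then have "V (Suc (\<iota> + Suc k)) = span {bracket v w | v w. v \<in> V 1 \<and> w \<in> {0}}"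
      using V_Suc [of "Suc (\<iota> + k)"] by simp
    also have "\<dots> \<subseteq> {0}"
      using bilinear_rzero [OF bilinear_bracket] by (intro span_minimal) auto
    finally show ?case
      using subspace_0 [OF subspace_V, of "Suc (\<iota> + Suc k)"] by auto
  qed
  then show "i > \<iota> \<Longrightarrow> V i = {0}"
    by (auto simp: less_iff_Suc_add)
qed

lemma V_orthogonal:
  "i \<in> {1..\<iota>} \<Longrightarrow> j \<in> {1..\<iota>} \<Longrightarrow> i \<noteq> j \<Longrightarrow> v \<in> V i \<Longrightarrow> w \<in> V j \<Longrightarrow> v \<bullet> w = 0"
  using stratified unfolding stratified_group_def by blast

section \<open>Layer sums and degrees of indices\<close>

lemma layer_sum_0 [simp]: "ls 0 = 0"
  by (simp add: layer_sum_def)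

lemma layer_sum_Suc: "ls (Suc j) = ls j + dim (V (Suc j))"
  by (simp add: layer_sum_def)

lemma layer_sum_mono: "i \<le> j \<Longrightarrow> ls i \<le> ls j"
  by (rule lift_Suc_mono_le) (simp_all add: layer_sum_Suc)

lemma layer_sum_total: "ls \<iota> = DIM('a)"
proof -
  have "j \<le> \<iota> \<Longrightarrow> dim (\<Union>i\<in>{1..j}. V i) = ls j" for j
  proof (induction j)
    case (Suc j)
    have "(\<Union>i\<in>{1..Suc j}. V i) = (\<Union>i\<in>{1..j}. V i) \<union> V (Suc j)"
      by (auto simp: atLeastAtMostSuc_conv)
    also have "dim \<dots> = dim (\<Union>i\<in>{1..j}. V i) + dim (V (Suc j))"
    proof (rule dim_orthogonal_sum)
      fix x y assume "x \<in> (\<Union>i\<in>{1..j}. V i)" "y \<in> V (Suc j)"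
      then obtain i where "i \<in> {1..j}" "x \<in> V i" by auto
      then show "x \<bullet> y = 0"
        using V_orthogonal [of i "Suc j" x y] Suc.prems \<open>y \<in> V (Suc j)\<close> by simp
    qed
    finally show ?case using Suc by (simp add: layer_sum_Suc)
  qed simp
  moreover have "dim (\<Union>i\<in>{1..\<iota>}. V i) = DIM('a)"
    using stratified by (simp add: stratified_group_def dim_eq_full)
  ultimately show ?thesis by simp
qed

lemma deg_eqI:
  assumes "ls (k - 1) < j" "j \<le> ls k"
  shows "dg j = k"
  unfolding deg_def
proof (rule the_equality)
  fix k' assume k': "ls (k' - 1) < j \<and> j \<le> ls k'"
  have "\<not> k' < k"
  proof
    assume "k' < k"
    then have "ls k' \<le> ls (k - 1)" by (intro layer_sum_mono) simp
    then show False using k' assms by simp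
  qed
  moreover have "\<not> k < k'"
  proof
    assume "k < k'"
    then have "ls k \<le> ls (k' - 1)" by (intro layer_sum_mono) simp
    then show False using k' assms by simp
  qed
  ultimately show "k' = k" by simp
qed (use assms in auto)

lemma deg_bounds:
  assumes "j \<in> {1..DIM('a)}"
  shows "ls (dg j - 1) < j" "j \<le> ls (dg j)" "dg j \<in> {1..\<iota>}"
proof -
  define k where "k = (LEAST k. j \<le> ls k)"
  have ex: "j \<le> ls \<iota>" using assms layer_sum_total by simp
  have k: "j \<le> ls k" "k \<le> \<iota>"
    unfolding k_def using LeastI [of "\<lambda>k. j \<le> ls k", OF ex] Least_le [of "\<lambda>k. j \<le> ls k", OF ex] by auto
  have "k \<noteq> 0" using k(1) assms by (metis atLeastAtMost_iff layer_sum_0 not_one_le_zero le_zero_eq)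
  have "\<not> j \<le> ls (k - 1)"
    using not_less_Least [of "k - 1" "\<lambda>k. j \<le> ls k"] \<open>k \<noteq> 0\<close> by (simp add: k_def)
  then have "dg j = k" using deg_eqI [of k j] k by simp
  with k \<open>\<not> j \<le> ls (k - 1)\<close> \<open>k \<noteq> 0\<close> show "ls (dg j - 1) < j" "j \<le> ls (dg j)" "dg j \<in> {1..\<iota>}"
    by auto
qed

lemma deg_gt_iff:
  assumes "j \<in> {1..DIM('a)}"
  shows "k < dg j \<longleftrightarrow> ls k < j"
proof
  assume "k < dg j"
  then have "ls k \<le> ls (dg j - 1)" by (intro layer_sum_mono) simp
  then show "ls k < j" using deg_bounds(1) [OF assms] by simp
next
  assume "ls k < j"
  show "k < dg j"
  proof (rule ccontr)
    assume "\<not> k < dg j"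
    then have "ls (dg j) \<le> ls k" by (intro layer_sum_mono) simp
    then show False using deg_bounds(2) [OF assms] \<open>ls k < j\<close> by simp
  qed
qed

lemma deg_mono: "i \<in> {1..DIM('a)} \<Longrightarrow> j \<in> {1..DIM('a)} \<Longrightarrow> i \<le> j \<Longrightarrow> dg i \<le> dg j"
  using deg_gt_iff [of i "dg j"] deg_bounds(2) [of j] by linarith

lemma X_in_V: "i \<in> {1..DIM('a)} \<Longrightarrow> X i \<in> V (dg i)"
  using deg_bounds [of i] V_eq_span [of "dg i"] by (auto intro!: span_base)

section \<open>Coordinates with respect to the graded basis\<close>

lemma inj_on_X: "inj_on X {1..DIM('a)}"
  by (rule inj_onI) (metis X_inner zero_neq_one)

lemma span_X: "span (X ` {1..DIM('a)}) = UNIV"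
proof -
  have "pairwise orthogonal (X ` {1..DIM('a)})"
    using X_inner by (auto simp: pairwise_def orthogonal_def)
  moreover have "0 \<notin> X ` {1..DIM('a)}"
    using X_inner by (metis imageE inner_zero_left zero_neq_one)
  ultimately have "independent (X ` {1..DIM('a)})"
    by (rule pairwise_orthogonal_independent)
  then have "dim (X ` {1..DIM('a)}) = DIM('a)"
    using card_image [OF inj_on_X] by (simp add: dim_eq_card_independent)
  then show ?thesis by (simp add: dim_eq_full)
qed

lemma X_expand: "y = (\<Sum>i=1..DIM('a). (y \<bullet> X i) *\<^sub>R X i)"
proof -
  define z where "z = y - (\<Sum>i=1..DIM('a). (y \<bullet> X i) *\<^sub>R X i)"
  have "z \<bullet> X j = 0" if "j \<in> {1..DIM('a)}" for j
  proof -
    have "(\<Sum>i=1..DIM('a). (y \<bullet> X i) *\<^sub>R X i) \<bullet> X j = (\<Sum>i=1..DIM('a). (y \<bullet> X i) * (if i = j then 1 else 0))"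
      unfolding inner_sum_left inner_scaleR_left using X_inner that by (intro sum.cong refl) auto
    also have "\<dots> = y \<bullet> X j"
      using that by (simp add: if_distrib [where f = "\<lambda>c. _ * c"] cong: if_cong)
    finally show ?thesis by (simp add: z_def inner_diff_left)
  qed
  then have "z \<bullet> w = 0" if "w \<in> span (X ` {1..DIM('a)})" for w
    using linear_eq_0_on_span [OF bounded_linear.linear [OF bounded_linear_inner_right], of "X ` {1..DIM('a)}" z w]
      that by blast
  then have "z \<bullet> z = 0" using span_X by blast
  then show ?thesis by (simp add: z_def)
qed

lemma X_eqI:
  assumes "\<And>i. i \<in> {1..DIM('a)} \<Longrightarrow> x \<bullet> X i = y \<bullet> X i"
  shows "x = y"
proof -
  have "x = (\<Sum>i=1..DIM('a). (x \<bullet> X i) *\<^sub>R X i)"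
    by (rule X_expand)
  also have "\<dots> = (\<Sum>i=1..DIM('a). (y \<bullet> X i) *\<^sub>R X i)"
    using assms by (intro sum.cong refl) simp
  also have "\<dots> = y"
    by (rule X_expand [symmetric])
  finally show ?thesis .
qed

lemma norm_X: "i \<in> {1..DIM('a)} \<Longrightarrow> norm (X i) = 1"
  by (simp add: X_inner norm_eq_1)

lemma coord_le_norm: "i \<in> {1..DIM('a)} \<Longrightarrow> \<bar>y \<bullet> X i\<bar> \<le> norm y"
  using Cauchy_Schwarz_ineq2 [of y "X i"] by (simp add: norm_X)

lemma norm_le_coords:
  assumes "\<And>i. i \<in> {1..DIM('a)} \<Longrightarrow> \<bar>y \<bullet> X i\<bar> \<le> c"
  shows "norm y \<le> real DIM('a) * c"
proof -
  have "norm y \<le> (\<Sum>i=1..DIM('a). norm ((y \<bullet> X i) *\<^sub>R X i))"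
    by (subst X_expand) (rule norm_sum)
  also have "\<dots> \<le> (\<Sum>i=1..DIM('a). c)"
    using assms by (intro sum_mono) (simp add: norm_X)
  finally show ?thesis by simp
qed

lemma coord_sum:
  assumes "J \<subseteq> {1..DIM('a)}" "i \<in> {1..DIM('a)}"
  shows "(\<Sum>j\<in>J. c j *\<^sub>R X j) \<bullet> X i = (if i \<in> J then c i else 0)"
proof -
  have "(\<Sum>j\<in>J. c j *\<^sub>R X j) \<bullet> X i = (\<Sum>j\<in>J. c j * (if j = i then 1 else 0))"
    unfolding inner_sum_left inner_scaleR_left using X_inner assms by (intro sum.cong refl) auto
  also have "\<dots> = (if i \<in> J then c i else 0)"
    using finite_subset [OF assms(1)] by (simp add: if_distrib [where f = "\<lambda>c. _ * c"] cong: if_cong)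
  finally show ?thesis .
qed

section \<open>The grading of the algebra and the filtration by degree\<close>

text \<open>The stratification gives the case i = 1. A larger layer is spanned by brackets [a, b]
  with a in \<open>V 1\<close>, and Jacobi's identity distributes [[a, b], w] over brackets with a
  and with b.\<close>

lemma bracket_V: "v \<in> V i \<Longrightarrow> w \<in> V j \<Longrightarrow> i \<ge> 1 \<Longrightarrow> j \<ge> 1 \<Longrightarrow> bracket v w \<in> V (i + j)"
proof (induction i arbitrary: v w j)
  case (Suc i)
  show ?case
  proof (cases "i = 0")
    case True
    then show ?thesis
      using V_Suc [of j] Suc.prems by (auto intro: span_base)
  next
    case False
    have sub: "subspace (V (Suc i + j))"
      by (rule subspace_V) simp
    have "v \<in> span {bracket v w | v w. v \<in> V 1 \<and> w \<in> V i}"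
      using V_Suc [of i] Suc.prems(1) False by simp
    then show ?thesis
    proof (induction v rule: span_induct_alt)
      case base
      then show ?case
        using bilinear_lzero [OF bilinear_bracket] subspace_0 [OF sub] by simp
    next
      case (step c v v')
      then obtain a b where ab: "v = bracket a b" "a \<in> V 1" "b \<in> V i" by auto
      have 1: "bracket a u \<in> V (Suc k)" if "u \<in> V k" "k \<ge> 1" for u k
        using V_Suc [of k] ab(2) that by (auto intro: span_base)
      have "bracket v w = bracket a (bracket b w) - bracket b (bracket a w)"
        using jacobi [of a b w] by (simp add: ab)
      moreover have "bracket a (bracket b w) \<in> V (Suc i + j)"
        using 1 [OF Suc.IH [OF ab(3) Suc.prems(2)]] False Suc.prems(4) by simp
      moreover have "bracket b (bracket a w) \<in> V (Suc i + j)"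
        using Suc.IH [OF ab(3) 1 [OF Suc.prems(2)]] False Suc.prems(4) by simp
      ultimately have "bracket v w \<in> V (Suc i + j)"
        using subspace_diff [OF sub] by simp
      then show ?case
        using step.IH subspace_add [OF sub subspace_scale [OF sub]]
        by (simp add: bilinear_ladd [OF bilinear_bracket] bilinear_lmul [OF bilinear_bracket])
    qed
  qed
qed simp

text \<open>The sum of the layers of degree at least \<open>k\<close>, described by vanishing
  coordinates so that membership is directly a statement on inner products.\<close>

definition I :: "nat \<Rightarrow> 'a set" where
  "I k = {y. \<forall>i\<in>{1..DIM('a)}. dg i < k \<longrightarrow> y \<bullet> X i = 0}"

lemma subspace_I: "subspace (I k)"
  by (auto simp: I_def subspace_def inner_add_left)

lemma I_antimono: "i \<le> k \<Longrightarrow> I k \<subseteq> I i"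
  by (auto simp: I_def)

lemma I_1: "I 1 = UNIV"
  using deg_bounds(3) by (force simp: I_def)

lemma V_subset_I: "k \<ge> 1 \<Longrightarrow> V k \<subseteq> I k"
proof (cases "k \<le> \<iota>")
  case True
  assume "k \<ge> 1"
  have "X ` {ls (k - 1) + 1..ls k} \<subseteq> I k"
  proof safe
    fix j assume j: "j \<in> {ls (k - 1) + 1..ls k}"
    have jn: "j \<in> {1..DIM('a)}"
      using j layer_sum_mono [OF True] layer_sum_total by auto
    have "dg j = k" using j by (intro deg_eqI) auto
    then show "X j \<in> I k" using X_inner [OF jn] by (auto simp: I_def)
  qed
  then show ?thesis
    using V_eq_span [of k] True \<open>k \<ge> 1\<close> subspace_I by (simp add: span_minimal)
qed (simp add: V_eq_0 subspace_0 [OF subspace_I])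

text \<open>Expand both arguments in the graded basis: only degrees at least \<open>k\<close>
  survive in \<open>y\<close>, and every degree in \<open>x\<close> is at least 1.\<close>

lemma bracket_I:
  assumes "k \<ge> 1" "y \<in> I k"
  shows "bracket x y \<in> I (Suc k)"
proof -
  have "bracket (X j) (X i) \<in> I (Suc k)" if "i \<in> {1..DIM('a)}" "j \<in> {1..DIM('a)}" "dg i \<ge> k" for i j
  proof -
    have "bracket (X j) (X i) \<in> V (dg j + dg i)"
      using deg_bounds(3) that by (intro bracket_V X_in_V) auto
    also have "\<dots> \<subseteq> I (dg j + dg i)"
      using deg_bounds(3) [OF that(1)] by (intro V_subset_I) auto
    also have "\<dots> \<subseteq> I (Suc k)"
      using deg_bounds(3) [OF that(2)] that(3) by (intro I_antimono) auto
    finally show ?thesis .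
  qed
  then have "bracket (\<Sum>j=1..DIM('a). (x \<bullet> X j) *\<^sub>R X j) (X i) \<in> I (Suc k)" if "i \<in> {1..DIM('a)}" "dg i \<ge> k" for i
    using that
    by (simp add: linear_sum [OF bilinear_bracket [unfolded bilinear_def, THEN conjunct2, rule_format]]
          bilinear_lmul [OF bilinear_bracket])
      (intro subspace_sum subspace_scale subspace_I; simp)
  then have *: "bracket x (X i) \<in> I (Suc k)" if "i \<in> {1..DIM('a)}" "dg i \<ge> k" for i
    using that X_expand [of x] by simp
  have "bracket x ((y \<bullet> X i) *\<^sub>R X i) \<in> I (Suc k)" if "i \<in> {1..DIM('a)}" for i
  proof (cases "dg i \<ge> k")
    case True
    then show ?thesis
      using * [OF that] by (simp add: bilinear_rmul [OF bilinear_bracket] subspace_scale [OF subspace_I])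
  next
    case False
    then show ?thesis
      using assms(2) that bilinear_rzero [OF bilinear_bracket]
      by (simp add: I_def)
  qed
  then have "bracket x (\<Sum>i=1..DIM('a). (y \<bullet> X i) *\<^sub>R X i) \<in> I (Suc k)"
    unfolding linear_sum [OF bilinear_bracket [unfolded bilinear_def, THEN conjunct1, rule_format]]
    by (intro subspace_sum [OF subspace_I])
  then show ?thesis using X_expand [of y] by simp
qed

text \<open>The deviation of \<open>mul y x\<close> from the sum lies in \<open>I (Suc k)\<close>,
  which has no coordinates of degree at most \<open>k\<close>.\<close>

lemma mul_coord:
  assumes "y \<in> I k" "k \<ge> 1" "i \<in> {1..DIM('a)}" "dg i \<le> k"
  shows "mul y x \<bullet> X i = y \<bullet> X i + x \<bullet> X i"
proof -
  have "mul y x - y - x \<in> I (Suc k)"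
    using mul_mod_filtration_left [of I, OF subspace_I I_1 I_antimono bracket_I assms(1,2)] by simp
  then have "(mul y x - y - x) \<bullet> X i = 0"
    using assms(3,4) by (simp add: I_def)
  then show ?thesis by (simp add: inner_diff_left)
qed

section \<open>The maximal degree\<close>

text \<open>An increasing index satisfies \<alpha>(i) + (p - i) <= n, so it lies entrywise below the
  last \<open>p\<close> indices, and degrees are monotone.\<close>

lemma sum_top_degrees: "max_deg V p = (\<Sum>j\<in>{DIM('a) - p + 1..DIM('a)}. dg j)" if "p \<le> DIM('a)"
proof -
  define \<alpha>\<^sub>0 where "\<alpha>\<^sub>0 = restrict (\<lambda>i. DIM('a) - p + i) {1..p}"
  have \<alpha>\<^sub>0: "\<alpha>\<^sub>0 \<in> multi_indices DIM('a) p"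
  proof -
    have "\<alpha>\<^sub>0 \<in> {1..p} \<rightarrow>\<^sub>E {1..DIM('a)}"
      using that by (auto simp: \<alpha>\<^sub>0_def)
    moreover have "strict_mono_on {1..p} \<alpha>\<^sub>0"
      by (rule strict_mono_onI) (simp add: \<alpha>\<^sub>0_def)
    ultimately show ?thesis by (simp add: multi_indices_def)
  qed
  have le: "multi_deg V p \<alpha> \<le> multi_deg V p \<alpha>\<^sub>0" if \<alpha>: "\<alpha> \<in> multi_indices DIM('a) p" for \<alpha>
    unfolding multi_deg_def
  proof (intro sum_mono)
    fix i assume i: "i \<in> {1..p}"
    have sm: "strict_mono_on {1..p} \<alpha>" and ran: "\<And>i. i \<in> {1..p} \<Longrightarrow> \<alpha> i \<in> {1..DIM('a)}"
      using \<alpha> by (auto simp: multi_indices_def)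
    have "\<alpha> i + (j - i) \<le> \<alpha> j" if "j \<ge> i" "j \<le> p" for j
      using that
    proof (induction j rule: nat_induct_at_least)
      case (Suc j)
      have "\<alpha> j < \<alpha> (Suc j)"
        using Suc i by (intro strict_mono_onD [OF sm]) auto
      with Suc show ?case by auto
    qed simp
    from this [of p] have "\<alpha> i \<le> \<alpha>\<^sub>0 i"
      using i ran [of p] by (auto simp: \<alpha>\<^sub>0_def)
    then show "dg (\<alpha> i) \<le> dg (\<alpha>\<^sub>0 i)"
      using ran [OF i] \<alpha>\<^sub>0 i by (intro deg_mono) (auto simp: multi_indices_def)
  qed
  have "max_deg V p = multi_deg V p \<alpha>\<^sub>0"
    unfolding max_deg_def
  proof (rule Max_eqI)
    show "finite (multi_deg V p ` multi_indices DIM('a) p)"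
      by (simp add: finite_multi_indices)
    show "multi_deg V p \<alpha>\<^sub>0 \<in> multi_deg V p ` multi_indices DIM('a) p"
      using \<alpha>\<^sub>0 by (rule imageI)
    show "k \<le> multi_deg V p \<alpha>\<^sub>0" if "k \<in> multi_deg V p ` multi_indices DIM('a) p" for k
      using that le by blast
  qed
  also have "\<dots> = (\<Sum>i\<in>{1..p}. dg (DIM('a) - p + i))"
    by (simp add: multi_deg_def \<alpha>\<^sub>0_def)
  also have "\<dots> = (\<Sum>j\<in>{DIM('a) - p + 1..DIM('a)}. dg j)"
    by (rule sum.reindex_bij_witness [of _ "\<lambda>j. j - (DIM('a) - p)" "\<lambda>i. DIM('a) - p + i"]) (use that in auto)
  finally show ?thesis .
qed

lemma sum_layers:
  assumes "l \<le> m" "m \<le> \<iota>"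
  shows "(\<Sum>j\<in>{ls l + 1..ls m}. f (dg j)) = (\<Sum>k=l+1..m. dim (V k) * f k)"
  using assms
proof (induction m rule: nat_induct_at_least)
  case (Suc m)
  have un: "{ls l + 1..ls (Suc m)} = {ls l + 1..ls m} \<union> {ls m + 1..ls (Suc m)}"
    using layer_sum_mono [of l m] layer_sum_mono [of m "Suc m"] Suc by auto
  have "(\<Sum>j\<in>{ls l + 1..ls (Suc m)}. f (dg j))
      = (\<Sum>j\<in>{ls l + 1..ls m}. f (dg j)) + (\<Sum>j\<in>{ls m + 1..ls (Suc m)}. f (dg j))"
    unfolding un by (rule sum.union_disjoint) auto
  also have "(\<Sum>j\<in>{ls m + 1..ls (Suc m)}. f (dg j)) = (\<Sum>j\<in>{ls m + 1..ls (Suc m)}. f (Suc m))"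
    by (intro sum.cong refl arg_cong [where f = f] deg_eqI) auto
  finally show ?case
    using Suc by (simp add: layer_sum_Suc)
qed simp

text \<open>This is the shape in which the covering produces the exponent: \<open>l\<close> for each
  of the \<open>p\<close> parameters, and the excess \<open>j - l\<close> for each direction of
  degree above \<open>l\<close>.\<close>

lemma max_deg_formula:
  assumes "1 \<le> p" "p \<le> DIM('a)"
  defines "l \<equiv> dg (DIM('a) + 1 - p)"
  shows "max_deg V p = (\<Sum>j=l+1..\<iota>. dim (V j) * (j - l)) + l * p"
proof -
  have jn: "DIM('a) + 1 - p \<in> {1..DIM('a)}" using assms by auto
  have l: "ls (l - 1) < DIM('a) + 1 - p" "DIM('a) + 1 - p \<le> ls l" "l \<in> {1..\<iota>}"
    using deg_bounds [OF jn] by (simp_all add: l_def)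
  have ge: "dg j \<ge> l" if "j \<in> {DIM('a) - p + 1..DIM('a)}" for j
    unfolding l_def using that jn assms(2) by (intro deg_mono) auto
  have "max_deg V p = (\<Sum>j\<in>{DIM('a) - p + 1..DIM('a)}. (dg j - l) + l)"
    unfolding sum_top_degrees [OF assms(2)] using ge by (intro sum.cong refl) fastforce
  also have "\<dots> = (\<Sum>j\<in>{DIM('a) - p + 1..DIM('a)}. dg j - l) + l * p"
    using assms(2) by (simp add: sum.distrib mult.commute)
  \<comment> \<open>The discarded indices have degree \<open>l\<close>, where the truncated
    difference is 0; what remains consists of whole layers.\<close>
  also have "(\<Sum>j\<in>{DIM('a) - p + 1..DIM('a)}. dg j - l) = (\<Sum>j\<in>{ls l + 1..DIM('a)}. dg j - l)"
  proof (rule sum.mono_neutral_right)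
    show "\<forall>j\<in>{DIM('a) - p + 1..DIM('a)} - {ls l + 1..DIM('a)}. dg j - l = 0"
    proof
      fix j assume j: "j \<in> {DIM('a) - p + 1..DIM('a)} - {ls l + 1..DIM('a)}"
      then have "\<not> l < dg j" using deg_gt_iff [of j l] by auto
      then show "dg j - l = 0" by simp
    qed
    have "DIM('a) - p + 1 \<le> ls l + 1"
      using l(2) by linarith
    then show "{ls l + 1..DIM('a)} \<subseteq> {DIM('a) - p + 1..DIM('a)}"
      by simp
  qed simp
  also have "\<dots> = (\<Sum>j=l+1..\<iota>. dim (V j) * (j - l))"
    using sum_layers [of l \<iota> "\<lambda>k. k - l"] l(3) layer_sum_total by simp
  finally show ?thesis .
qed

lemma max_deg_formula_real:
  assumes "1 \<le> p" "p \<le> DIM('a)" "l = dg (DIM('a) + 1 - p)"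
  shows "real (max_deg V p) =
           (\<Sum>j=l+1..\<iota>. real j * real (dim (V j))) +
           real l * (real p - (\<Sum>j=l+1..\<iota>. real (dim (V j))))"
proof -
  have "real (\<Sum>j=l+1..\<iota>. dim (V j) * (j - l)) = (\<Sum>j=l+1..\<iota>. real j * real (dim (V j)) - real l * real (dim (V j)))"
    unfolding of_nat_sum by (intro sum.cong refl) (auto simp: of_nat_diff algebra_simps)
  then show ?thesis
    using max_deg_formula [OF assms(1,2)] unfolding assms(3) [symmetric]
    by (simp add: sum_subtractf sum_distrib_left algebra_simps)
qed

end

section \<open>Homogeneous distances\<close>

locale homogeneous_group = graded_exp_group mul V \<iota> X
  for mul :: "'a::euclidean_space \<Rightarrow> 'a \<Rightarrow> 'a" and V \<iota> X +
  fixes d :: "'a \<Rightarrow> 'a \<Rightarrow> real"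
  assumes homogeneous: "homogeneous_distance mul V X d"
begin

sublocale Metric_space UNIV d
  using homogeneous by (simp add: homogeneous_distance_def)

lemma d_mul: "d (mul z x) (mul z y) = d x y"
  using homogeneous by (simp add: homogeneous_distance_def)

lemma d_left: "d x y = d 0 (mul (- x) y)"
  using d_mul [of "- x" x y] by simp

lemma continuous_on_d [continuous_intros]:
  assumes "continuous_on S f" "continuous_on S g"
  shows "continuous_on S (\<lambda>x. d (f x) (g x))"
proof -
  have "continuous_on UNIV (\<lambda>(x, y). d x y)"
    using homogeneous by (simp add: homogeneous_distance_def)
  from continuous_on_compose2 [OF this continuous_on_Pair [OF assms]] show ?thesis by auto
qed

lemma dilation_coord: "i \<in> {1..DIM('a)} \<Longrightarrow> dilation V X r y \<bullet> X i = r ^ dg i * (y \<bullet> X i)"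
  unfolding dilation_def by (subst coord_sum) auto

lemma dilation_zero: "dilation V X r 0 = 0"
  by (simp add: dilation_def)

lemma d_dilation: "r > 0 \<Longrightarrow> d 0 (dilation V X r y) = r * d 0 y"
  using homogeneous dilation_zero [of r] unfolding homogeneous_distance_def by metis

lemma compact_box: "compact {y. \<forall>i\<in>{1..DIM('a)}. \<bar>y \<bullet> X i\<bar> \<le> M}"
  unfolding compact_eq_bounded_closed
proof
  have "{y. \<forall>i\<in>{1..DIM('a)}. \<bar>y \<bullet> X i\<bar> \<le> M} \<subseteq> cball 0 (real DIM('a) * M)"
    using norm_le_coords by auto
  then show "bounded {y. \<forall>i\<in>{1..DIM('a)}. \<bar>y \<bullet> X i\<bar> \<le> M}"
    using bounded_cball bounded_subset by blast
  have "{y. \<forall>i\<in>{1..DIM('a)}. \<bar>y \<bullet> X i\<bar> \<le> M} = (\<Inter>i\<in>{1..DIM('a)}. {y. \<bar>y \<bullet> X i\<bar> \<le> M})"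
    by auto
  then show "closed {y. \<forall>i\<in>{1..DIM('a)}. \<bar>y \<bullet> X i\<bar> \<le> M}"
    by (auto intro!: closed_INT closed_Collect_le continuous_intros)
qed

text \<open>Dilation by 1/r reduces to a fixed compact box, on which the continuous function
  \<open>d 0\<close> is bounded.\<close>

lemma d_le_if_coords_le:
  assumes "M \<ge> 0"
  obtains C where "C > 0"
    "\<And>r y. r > 0 \<Longrightarrow> (\<And>i. i \<in> {1..DIM('a)} \<Longrightarrow> \<bar>y \<bullet> X i\<bar> \<le> M * r ^ dg i) \<Longrightarrow> d 0 y \<le> C * r"
proof -
  have "compact ((\<lambda>y. d 0 y) ` {y. \<forall>i\<in>{1..DIM('a)}. \<bar>y \<bullet> X i\<bar> \<le> M})"
    by (intro compact_continuous_image compact_box continuous_intros)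
  then have "bounded ((\<lambda>y. d 0 y) ` {y. \<forall>i\<in>{1..DIM('a)}. \<bar>y \<bullet> X i\<bar> \<le> M})"
    by (rule compact_imp_bounded)
  then obtain C where "C > 0"
      "\<forall>z\<in>(\<lambda>y. d 0 y) ` {y. \<forall>i\<in>{1..DIM('a)}. \<bar>y \<bullet> X i\<bar> \<le> M}. norm z \<le> C"
    unfolding bounded_pos by blast
  then have C: "\<And>y. (\<forall>i\<in>{1..DIM('a)}. \<bar>y \<bullet> X i\<bar> \<le> M) \<Longrightarrow> \<bar>d 0 y\<bar> \<le> C" "C > 0"
    by auto
  show thesis
  proof (rule that [OF C(2)])
    fix r :: real and y assume r: "r > 0" and y: "\<And>i. i \<in> {1..DIM('a)} \<Longrightarrow> \<bar>y \<bullet> X i\<bar> \<le> M * r ^ dg i"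
    have "\<bar>dilation V X (1 / r) y \<bullet> X i\<bar> \<le> M" if "i \<in> {1..DIM('a)}" for i
      using y [OF that] r by (simp add: dilation_coord [OF that] abs_mult power_one_over field_simps)
    then have "d 0 (dilation V X (1 / r) y) \<le> C"
      using C(1) by fastforce
    then show "d 0 y \<le> C * r"
      using d_dilation [of "1 / r" y] r by (simp add: field_simps)
  qed
qed

text \<open>Compactness again, now of the unit sphere of a homogeneous gauge: \<open>d 0\<close> has
  a positive minimum there, and dilations carry every nonzero point to it.\<close>

lemma coords_le_d:
  obtains C where "C > 0" "\<And>y i. i \<in> {1..DIM('a)} \<Longrightarrow> \<bar>y \<bullet> X i\<bar> \<le> C * d 0 y ^ dg i"
proof -
  define K where "K = {y. \<forall>i\<in>{1..DIM('a)}. \<bar>y \<bullet> X i\<bar> \<le> 1} \<inter> (\<Union>i\<in>{1..DIM('a)}. {y. \<bar>y \<bullet> X i\<bar> = 1})"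
  have "compact K"
  proof -
    have "closed {y. \<bar>y \<bullet> X i\<bar> = 1}" for i
      by (intro closed_Collect_eq continuous_intros)
    then show ?thesis
      unfolding K_def by (intro compact_Int_closed compact_box closed_UN) auto
  qed
  have "X 1 \<in> K"
    using DIM_positive [where 'a = 'a] X_inner [of 1] by (auto simp: K_def Suc_le_eq)
  then have "K \<noteq> {}" by blast
  obtain k where k: "k \<in> K" "\<And>y. y \<in> K \<Longrightarrow> d 0 k \<le> d 0 y"
    using continuous_attains_inf [OF \<open>compact K\<close> \<open>K \<noteq> {}\<close> continuous_on_d [OF continuous_on_const continuous_on_id]]
    by blast
  have "k \<noteq> 0" using k(1) by (auto simp: K_def)
  then have c: "d 0 k > 0" by (simp add: mdist_pos_eq)
  \<comment> \<open>One constant for all degrees: a base at least 1 allows the exponent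
    \<open>dg i\<close> to be raised to \<open>\<iota>\<close>.\<close>
  define C where "C = max 1 (1 / d 0 k) ^ \<iota>"
  have "C > 0" by (simp add: C_def zero_less_power)
  moreover have "\<bar>y \<bullet> X i\<bar> \<le> C * d 0 y ^ dg i" if i: "i \<in> {1..DIM('a)}" for y i
  proof (cases "y = 0")
    case True
    then show ?thesis using deg_bounds(3) [OF i] by (simp add: power_0_left)
  next
    case False
    \<comment> \<open>The homogeneous gauge max |y_i|^(1/d_i); dilating \<open>y\<close> by its
      reciprocal gives a point of \<open>K\<close>.\<close>
    define \<rho> where "\<rho> = Max ((\<lambda>i. root (dg i) \<bar>y \<bullet> X i\<bar>) ` {1..DIM('a)})"
    have fin: "finite ((\<lambda>i. root (dg i) \<bar>y \<bullet> X i\<bar>) ` {1..DIM('a)})"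
      "(\<lambda>i. root (dg i) \<bar>y \<bullet> X i\<bar>) ` {1..DIM('a)} \<noteq> {}"
      using i by auto
    have \<rho>_ge: "root (dg j) \<bar>y \<bullet> X j\<bar> \<le> \<rho>" if "j \<in> {1..DIM('a)}" for j
      unfolding \<rho>_def using fin that by (intro Max_ge) auto
    obtain m where m: "m \<in> {1..DIM('a)}" "root (dg m) \<bar>y \<bullet> X m\<bar> = \<rho>"
    proof -
      have "\<rho> \<in> (\<lambda>i. root (dg i) \<bar>y \<bullet> X i\<bar>) ` {1..DIM('a)}"
        unfolding \<rho>_def by (rule Max_in [OF fin])
      then show ?thesis using that by blast
    qed
    obtain j where j: "j \<in> {1..DIM('a)}" "y \<bullet> X j \<noteq> 0"
    proof (rule ccontr)
      assume "\<not> thesis"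
      then have "y \<bullet> X i = 0" if "i \<in> {1..DIM('a)}" for i
        using \<open>\<And>j. j \<in> {1..DIM('a)} \<Longrightarrow> y \<bullet> X j \<noteq> 0 \<Longrightarrow> thesis\<close> that by blast
      then have "y = 0" by (intro X_eqI) simp
      then show False using False by simp
    qed
    have pos: "dg j > 0" if "j \<in> {1..DIM('a)}" for j
      using deg_bounds(3) [OF that] by simp
    have "0 < root (dg j) \<bar>y \<bullet> X j\<bar>"
      using j pos by simp
    then have "\<rho> > 0" using \<rho>_ge [OF j(1)] by simp
    have le: "\<bar>y \<bullet> X j\<bar> \<le> \<rho> ^ dg j" if "j \<in> {1..DIM('a)}" for j
      using power_mono [OF \<rho>_ge [OF that], of "dg j"] pos [OF that] by simp
    have eq: "\<bar>y \<bullet> X m\<bar> = \<rho> ^ dg m"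
      using m pos by (metis abs_ge_zero real_root_pow_pos2)
    have "dilation V X (1 / \<rho>) y \<in> K"
    proof -
      have eq_div: "\<bar>dilation V X (1 / \<rho>) y \<bullet> X j\<bar> = \<bar>y \<bullet> X j\<bar> / \<rho> ^ dg j" if "j \<in> {1..DIM('a)}" for j
        using \<open>\<rho> > 0\<close> by (simp add: dilation_coord [OF that] abs_mult power_one_over)
      have "\<bar>dilation V X (1 / \<rho>) y \<bullet> X j\<bar> \<le> 1" if "j \<in> {1..DIM('a)}" for j
        using le [OF that] \<open>\<rho> > 0\<close> by (simp add: eq_div [OF that])
      moreover have "\<bar>dilation V X (1 / \<rho>) y \<bullet> X m\<bar> = 1"
        using \<open>\<rho> > 0\<close> by (simp add: eq_div [OF m(1)] eq)
      ultimately show ?thesis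
        unfolding K_def using m(1) by blast
    qed
    then have "d 0 k \<le> d 0 (dilation V X (1 / \<rho>) y)" by (rule k(2))
    also have "\<dots> = d 0 y / \<rho>"
      using d_dilation [of "1 / \<rho>" y] \<open>\<rho> > 0\<close> by simp
    finally have "\<rho> \<le> (1 / d 0 k) * d 0 y"
      using \<open>\<rho> > 0\<close> c by (simp add: field_simps)
    also have "\<dots> \<le> max 1 (1 / d 0 k) * d 0 y"
      by (intro mult_right_mono) auto
    finally have "\<rho> ^ dg i \<le> (max 1 (1 / d 0 k) * d 0 y) ^ dg i"
      using \<open>\<rho> > 0\<close> by (intro power_mono) auto
    also have "\<dots> \<le> C * d 0 y ^ dg i"
      unfolding C_def power_mult_distrib using deg_bounds(3) [OF i]
      by (intro mult_right_mono power_increasing) auto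
    finally show ?thesis using le [OF i] by simp
  qed
  ultimately show thesis by (rule that)
qed

end

section \<open>Sets of Hausdorff measure zero\<close>

text \<open>Measure zero stated with explicit covers, so that later arguments need no infima or
  suprema in \<open>ennreal\<close>.\<close>

definition hausdorff_null :: "('a \<Rightarrow> 'a \<Rightarrow> real) \<Rightarrow> real \<Rightarrow> 'a set \<Rightarrow> bool" where
  "hausdorff_null d s A \<longleftrightarrow> (\<forall>\<epsilon>>0. \<forall>\<eta>>0. \<exists>E :: nat \<Rightarrow> 'a set. A \<subseteq> (\<Union>i. E i) \<and>
     (\<forall>i. \<forall>x\<in>E i. \<forall>y\<in>E i. d x y \<le> \<epsilon>) \<and> (\<Sum>i. diam_power d s (E i)) \<le> ennreal \<eta>)"

lemma hausdorff_null_iff: "hausdorff_null d s A \<longleftrightarrow> hausdorff_measure d s A = 0"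
proof
  assume null: "hausdorff_null d s A"
  have "hausdorff_premeasure d s \<epsilon> A \<le> 0" if "\<epsilon> > 0" for \<epsilon>
  proof (rule ennreal_le_epsilon)
    fix \<eta> :: real assume "\<eta> > 0"
    then obtain E :: "nat \<Rightarrow> 'a set" where E: "A \<subseteq> (\<Union>i. E i)"
        "\<forall>i. \<forall>x\<in>E i. \<forall>y\<in>E i. d x y \<le> \<epsilon>" "(\<Sum>i. diam_power d s (E i)) \<le> ennreal \<eta>"
      using null [unfolded hausdorff_null_def, rule_format, OF \<open>\<epsilon> > 0\<close> \<open>\<eta> > 0\<close>] by blast
    have "hausdorff_premeasure d s \<epsilon> A \<le> (\<Sum>i. diam_power d s (E i))"
      unfolding hausdorff_premeasure_def using E by (intro INF_lower) auto
    with E(3) show "hausdorff_premeasure d s \<epsilon> A \<le> 0 + ennreal \<eta>" by simp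
  qed
  then have "hausdorff_measure d s A \<le> 0"
    unfolding hausdorff_measure_def by (intro SUP_least) auto
  then show "hausdorff_measure d s A = 0" by simp
next
  assume zero: "hausdorff_measure d s A = 0"
  show "hausdorff_null d s A"
    unfolding hausdorff_null_def
  proof (intro allI impI)
    fix \<epsilon> \<eta> :: real assume "\<epsilon> > 0" "\<eta> > 0"
    have "hausdorff_premeasure d s \<epsilon> A \<le> hausdorff_measure d s A"
      unfolding hausdorff_measure_def using \<open>\<epsilon> > 0\<close> by (intro SUP_upper) auto
    also have "\<dots> < ennreal \<eta>" using zero \<open>\<eta> > 0\<close> by simp
    finally obtain E :: "nat \<Rightarrow> 'a set" where "A \<subseteq> (\<Union>i. E i)"
        "\<forall>i. \<forall>x\<in>E i. \<forall>y\<in>E i. d x y \<le> \<epsilon>" "(\<Sum>i. diam_power d s (E i)) < ennreal \<eta>"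
      unfolding hausdorff_premeasure_def INF_less_iff by blast
    then show "\<exists>E :: nat \<Rightarrow> 'a set. A \<subseteq> (\<Union>i. E i) \<and>
       (\<forall>i. \<forall>x\<in>E i. \<forall>y\<in>E i. d x y \<le> \<epsilon>) \<and> (\<Sum>i. diam_power d s (E i)) \<le> ennreal \<eta>"
      by (intro exI [of _ E] conjI) (simp_all add: less_imp_le)
  qed
qed

text \<open>The k-th set receives the share \<eta> / 2^(k+1), and the double sequence of covers is
  enumerated through \<open>prod_decode\<close>.\<close>

lemma hausdorff_null_countable_Union:
  assumes "countable \<A>" and null: "\<And>A. A \<in> \<A> \<Longrightarrow> hausdorff_null d s A"
  shows "hausdorff_null d s (\<Union>\<A>)"
proof (cases "\<A> = {}")
  case True
  have "(\<Sum>i. diam_power d s ((\<lambda>_. {}) (i :: nat))) = 0"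
    by (simp add: diam_power_def)
  then show ?thesis
    unfolding hausdorff_null_def True by (intro allI impI exI [of _ "\<lambda>_. {}"]) simp
next
  case False
  define A where "A = from_nat_into \<A>"
  have range: "range A = \<A>"
    unfolding A_def using assms(1) False by (simp add: range_from_nat_into)
  show ?thesis
    unfolding hausdorff_null_def
  proof (intro allI impI)
    fix \<epsilon> \<eta> :: real assume "\<epsilon> > 0" "\<eta> > 0"
    have "\<exists>E :: nat \<Rightarrow> 'a set. A k \<subseteq> (\<Union>i. E i) \<and> (\<forall>i. \<forall>x\<in>E i. \<forall>y\<in>E i. d x y \<le> \<epsilon>) \<and>
        (\<Sum>i. diam_power d s (E i)) \<le> ennreal (\<eta> * (1 / 2) ^ Suc k)" for k
    proof -
      have "hausdorff_null d s (A k)" using null range by blast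
      moreover have "\<eta> * (1 / 2) ^ Suc k > 0" using \<open>\<eta> > 0\<close> by simp
      ultimately show ?thesis
        using \<open>\<epsilon> > 0\<close> unfolding hausdorff_null_def by blast
    qed
    then obtain E :: "nat \<Rightarrow> nat \<Rightarrow> 'a set" where E: "\<And>k. A k \<subseteq> (\<Union>i. E k i)"
        "\<And>k i x y. x \<in> E k i \<Longrightarrow> y \<in> E k i \<Longrightarrow> d x y \<le> \<epsilon>"
        "\<And>k. (\<Sum>i. diam_power d s (E k i)) \<le> ennreal (\<eta> * (1 / 2) ^ Suc k)"
      by metis
    define F where "F i = (case prod_decode i of (k, j) \<Rightarrow> E k j)" for i
    have "\<Union>\<A> \<subseteq> (\<Union>i. F i)"
    proof
      fix x assume "x \<in> \<Union>\<A>"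
      then obtain k where "x \<in> A k" using range by auto
      then obtain j where "x \<in> E k j" using E(1) by blast
      then have "x \<in> F (prod_encode (k, j))" by (simp add: F_def)
      then show "x \<in> (\<Union>i. F i)" by blast
    qed
    moreover have "\<forall>i. \<forall>x\<in>F i. \<forall>y\<in>F i. d x y \<le> \<epsilon>"
      unfolding F_def by (auto split: prod.splits intro: E(2))
    moreover have "(\<Sum>i. diam_power d s (F i)) \<le> ennreal \<eta>"
    proof -
      have "(\<Sum>i. (\<lambda>(k, j). diam_power d s (E k j)) (prod_decode i)) = (\<Sum>k. \<Sum>j. diam_power d s (E k j))"
        by (rule suminf_ennreal_2dimen) simp
      also have "\<dots> \<le> (\<Sum>k. ennreal (\<eta> * (1 / 2) ^ Suc k))"
        by (intro suminf_le E(3)) auto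
      also have "\<dots> = ennreal \<eta>"
      proof (rule suminf_ennreal_eq)
        show "(\<lambda>k. \<eta> * (1 / 2) ^ Suc k) sums \<eta>"
          using sums_mult [OF power_half_series, of \<eta>] by simp
      qed (use \<open>\<eta> > 0\<close> in auto)
      finally show ?thesis
        by (simp add: F_def case_prod_unfold)
    qed
    ultimately show "\<exists>E :: nat \<Rightarrow> 'a set. \<Union>\<A> \<subseteq> (\<Union>i. E i) \<and>
       (\<forall>i. \<forall>x\<in>E i. \<forall>y\<in>E i. d x y \<le> \<epsilon>) \<and> (\<Sum>i. diam_power d s (E i)) \<le> ennreal \<eta>"
      by blast
  qed
qed

section \<open>Covering numbers\<close>

text \<open>A bound on the covering number. The count is compared with a real \<open>N\<close>, so
  that powers of 1/r can be used without rounding.\<close>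

definition covered :: "('a \<Rightarrow> 'a \<Rightarrow> real) \<Rightarrow> real \<Rightarrow> real \<Rightarrow> 'a set \<Rightarrow> bool" where
  "covered d \<rho> N A \<longleftrightarrow> (\<exists>\<E>. finite \<E> \<and> real (card \<E>) \<le> N \<and> A \<subseteq> \<Union>\<E> \<and>
     (\<forall>E\<in>\<E>. \<forall>x\<in>E. \<forall>y\<in>E. d x y \<le> \<rho>))"

lemma covered_mono:
  assumes "covered d \<rho> N A" "\<rho> \<le> \<rho>'" "N \<le> N'" "B \<subseteq> A"
  shows "covered d \<rho>' N' B"
proof -
  obtain \<E> where \<E>: "finite \<E>" "real (card \<E>) \<le> N" "A \<subseteq> \<Union>\<E>"
      "\<And>E x y. E \<in> \<E> \<Longrightarrow> x \<in> E \<Longrightarrow> y \<in> E \<Longrightarrow> d x y \<le> \<rho>"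
    using assms(1) unfolding covered_def by blast
  have "d x y \<le> \<rho>'" if "E \<in> \<E>" "x \<in> E" "y \<in> E" for E x y
    using \<E>(4) [OF that] assms(2) by simp
  moreover have "real (card \<E>) \<le> N'" "B \<subseteq> \<Union>\<E>"
    using \<E>(2,3) assms(3,4) by auto
  ultimately show ?thesis
    using \<E>(1) unfolding covered_def by blast
qed

lemma covered_single: "(\<And>x y. x \<in> A \<Longrightarrow> y \<in> A \<Longrightarrow> d x y \<le> \<rho>) \<Longrightarrow> 1 \<le> N \<Longrightarrow> covered d \<rho> N A"
  unfolding covered_def by (intro exI [of _ "{A}"]) auto

lemma covered_UN:
  assumes "finite Q" "real (card Q) \<le> M" "0 \<le> N" "A \<subseteq> (\<Union>q\<in>Q. B q)"
    and "\<And>q. q \<in> Q \<Longrightarrow> covered d \<rho> N (B q)"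
  shows "covered d \<rho> (M * N) A"
proof -
  from assms(5) obtain \<E> where \<E>: "\<And>q. q \<in> Q \<Longrightarrow> finite (\<E> q) \<and> real (card (\<E> q)) \<le> N \<and> B q \<subseteq> \<Union>(\<E> q) \<and>
     (\<forall>E\<in>\<E> q. \<forall>x\<in>E. \<forall>y\<in>E. d x y \<le> \<rho>)"
    unfolding covered_def by metis
  have "real (card (\<Union>q\<in>Q. \<E> q)) \<le> real (\<Sum>q\<in>Q. card (\<E> q))"
    using card_UN_le [OF assms(1)] by (simp only: of_nat_le_iff)
  also have "\<dots> \<le> (\<Sum>q\<in>Q. N)"
    unfolding of_nat_sum using \<E> by (intro sum_mono) blast
  also have "\<dots> \<le> M * N"
    using assms(2,3) by (simp add: mult_right_mono)
  finally have "real (card (\<Union>q\<in>Q. \<E> q)) \<le> M * N" .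
  moreover have "finite (\<Union>q\<in>Q. \<E> q)" using \<E> assms(1) by blast
  moreover have "A \<subseteq> \<Union>(\<Union>q\<in>Q. \<E> q)"
  proof
    fix x assume "x \<in> A"
    then obtain q where q: "q \<in> Q" "x \<in> B q" using assms(4) by auto
    then have "x \<in> \<Union>(\<E> q)" using \<E> [OF q(1)] by auto
    then show "x \<in> \<Union>(\<Union>q\<in>Q. \<E> q)" using q(1) by auto
  qed
  moreover have "\<forall>E\<in>(\<Union>q\<in>Q. \<E> q). \<forall>x\<in>E. \<forall>y\<in>E. d x y \<le> \<rho>"
  proof
    fix E assume "E \<in> (\<Union>q\<in>Q. \<E> q)"
    then obtain q where q: "q \<in> Q" "E \<in> \<E> q" by auto
    then show "\<forall>x\<in>E. \<forall>y\<in>E. d x y \<le> \<rho>" using \<E> [OF q(1)] by blast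
  qed
  ultimately show ?thesis
    unfolding covered_def by (intro exI [of _ "\<Union>q\<in>Q. \<E> q"] conjI)
qed

lemma diam_power_le:
  assumes "s > 0" "\<delta> > 0" "\<And>x y. x \<in> E \<Longrightarrow> y \<in> E \<Longrightarrow> d x y \<le> \<delta>" "\<And>x y. 0 \<le> d x y"
  shows "diam_power d s E \<le> ennreal (\<delta> powr s)"
proof (cases "E = {}")
  case False
  then have "(SUP (x, y)\<in>E \<times> E. d x y) \<le> \<delta>"
    using assms(3) by (intro cSUP_least) auto
  moreover have "0 \<le> (SUP (x, y)\<in>E \<times> E. d x y)"
  proof -
    obtain x where "x \<in> E" using False by auto
    then have "d x x \<le> (SUP (x, y)\<in>E \<times> E. d x y)"
      using assms(3) by (intro cSUP_upper2 [where x = "(x, x)"]) (auto intro!: bdd_aboveI [of _ \<delta>])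
    then show ?thesis using assms(4) [of x x] by simp
  qed
  ultimately show ?thesis
    using False assms(1) by (auto simp: diam_power_def intro!: ennreal_leI powr_mono2)
qed (simp add: diam_power_def)

text \<open>The cover at scale \<open>r\<close> contributes at most a constant times
  \<open>r powr (s - D)\<close>, which tends to 0 with \<open>r\<close>.\<close>

lemma hausdorff_null_if_covered:
  assumes d: "\<And>x y. 0 \<le> d x y" and s: "s > real D" and C: "C > 0"
    and cov: "\<And>r. 0 < r \<Longrightarrow> r \<le> 1 \<Longrightarrow> covered d (C * r) (C * (1 / r) ^ D) A"
  shows "hausdorff_null d s A"
  unfolding hausdorff_null_def
proof (intro allI impI)
  fix \<epsilon> \<eta> :: real assume "\<epsilon> > 0" "\<eta> > 0"
  \<comment> \<open>The diameters \<open>C * r\<close> must stay below \<open>\<epsilon>\<close>,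
    and the last entry solves \<open>C * C powr s * r powr (s - D) = \<eta>\<close>.\<close>
  define r where "r = min 1 (min (\<epsilon> / C) ((\<eta> / (C * C powr s)) powr (1 / (s - D))))"
  have r: "0 < r" "r \<le> 1" "r \<le> \<epsilon> / C" "r \<le> (\<eta> / (C * C powr s)) powr (1 / (s - D))"
    using \<open>\<epsilon> > 0\<close> \<open>\<eta> > 0\<close> C by (auto simp: r_def)
  have "C * r \<le> \<epsilon>" using r(3) C by (simp add: field_simps)
  have small: "C * (1 / r) ^ D * (C * r) powr s \<le> \<eta>"
  proof -
    have "r powr (s - D) \<le> ((\<eta> / (C * C powr s)) powr (1 / (s - D))) powr (s - D)"
      using r s by (intro powr_mono2) auto
    also have "\<dots> = \<eta> / (C * C powr s)"
      using s \<open>\<eta> > 0\<close> C by (simp add: powr_powr)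
    finally have "C * C powr s * r powr (s - D) \<le> \<eta>"
      using C by (simp add: field_simps)
    moreover have "C * (1 / r) ^ D * (C * r) powr s = C * C powr s * r powr (s - D)"
      using C r(1) by (simp add: powr_mult powr_diff powr_realpow power_one_over field_simps)
    ultimately show ?thesis by (simp only:)
  qed
  obtain \<E> where \<E>: "finite \<E>" "real (card \<E>) \<le> C * (1 / r) ^ D" "A \<subseteq> \<Union>\<E>"
      "\<And>E x y. E \<in> \<E> \<Longrightarrow> x \<in> E \<Longrightarrow> y \<in> E \<Longrightarrow> d x y \<le> C * r"
    using cov [OF r(1,2)] unfolding covered_def by blast
  obtain f where f: "bij_betw f {..<card \<E>} \<E>"
    using ex_bij_betw_nat_finite [OF \<E>(1)] by (auto simp: atLeast0LessThan)
  \<comment> \<open>The finite cover is continued by empty sets, which contribute 0 by the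
    convention in \<open>diam_power\<close>.\<close>
  define E where "E i = (if i < card \<E> then f i else {})" for i
  have Ef: "E i \<in> \<E>" if "i < card \<E>" for i
    using f that by (auto simp: E_def bij_betw_def)
  have "A \<subseteq> (\<Union>i. E i)"
  proof
    fix x assume "x \<in> A"
    then obtain F where "F \<in> \<E>" "x \<in> F" using \<E>(3) by blast
    then obtain i where "i < card \<E>" "F = f i"
      using f by (auto simp: bij_betw_def image_iff)
    then show "x \<in> (\<Union>i. E i)" using \<open>x \<in> F\<close> by (auto simp: E_def)
  qed
  moreover have "d x y \<le> \<epsilon>" if "x \<in> E i" "y \<in> E i" for i x y
  proof -
    have "i < card \<E>" using that by (auto simp: E_def split: if_splits)
    then show ?thesis using \<E>(4) [OF Ef that] \<open>C * r \<le> \<epsilon>\<close> by simp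
  qed
  moreover have "(\<Sum>i. diam_power d s (E i)) \<le> ennreal \<eta>"
  proof -
    have "(\<Sum>i. diam_power d s (E i)) = (\<Sum>i<card \<E>. diam_power d s (E i))"
      by (rule suminf_finite) (auto simp: E_def diam_power_def)
    also have "\<dots> \<le> (\<Sum>i<card \<E>. ennreal ((C * r) powr s))"
    proof (intro sum_mono diam_power_le)
      show "s > 0" using s by (meson of_nat_0_le_iff le_less_trans)
      show "C * r > 0" using C r(1) by simp
      show "d x y \<le> C * r" if "i \<in> {..<card \<E>}" "x \<in> E i" "y \<in> E i" for i x y
        using \<E>(4) [OF Ef that(2,3)] that(1) by simp
    qed (rule d)
    also have "\<dots> = ennreal (real (card \<E>) * (C * r) powr s)"
      by (simp add: ennreal_mult ennreal_of_nat_eq_real_of_nat)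
    also have "\<dots> \<le> ennreal \<eta>"
    proof (rule ennreal_leI)
      have "real (card \<E>) * (C * r) powr s \<le> C * (1 / r) ^ D * (C * r) powr s"
        using \<E>(2) by (rule mult_right_mono) simp
      then show "real (card \<E>) * (C * r) powr s \<le> \<eta>" using small by simp
    qed
    finally show ?thesis .
  qed
  ultimately show "\<exists>E :: nat \<Rightarrow> 'a set. A \<subseteq> (\<Union>i. E i) \<and>
       (\<forall>i. \<forall>x\<in>E i. \<forall>y\<in>E i. d x y \<le> \<epsilon>) \<and> (\<Sum>i. diam_power d s (E i)) \<le> ennreal \<eta>"
    by blast
qed

section \<open>The upper bound\<close>

text \<open>Use the multiples k \<rho> with |k| <= m = floor(R/\<rho>) in each coordinate. Their
  number 2m + 1 is at most 3 R/\<rho> because R/\<rho> >= 1.\<close>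

lemma exists_grid:
  fixes R \<rho> :: real
  assumes J: "finite J" and "0 < \<rho>" "\<rho> \<le> R"
  obtains G :: "('j \<Rightarrow> real) set" where "finite G" "real (card G) \<le> (3 * (R / \<rho>)) ^ card J"
    "\<And>g j. g \<in> G \<Longrightarrow> j \<in> J \<Longrightarrow> \<bar>g j\<bar> \<le> R"
    "\<And>a. (\<And>j. j \<in> J \<Longrightarrow> \<bar>a j\<bar> \<le> R) \<Longrightarrow> \<exists>g\<in>G. \<forall>j\<in>J. \<bar>a j - g j\<bar> \<le> \<rho>"
proof -
  define m where "m = \<lfloor>R / \<rho>\<rfloor>"
  define Z where "Z = (\<lambda>k. \<rho> * of_int k) ` {- m..m}"
  have m: "1 \<le> m" "of_int m \<le> R / \<rho>"
    using assms by (auto simp: m_def le_floor_iff)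
  have "real (card Z) \<le> real (card {- m..m})"
    unfolding Z_def using card_image_le [of "{- m..m}" "\<lambda>k. \<rho> * of_int k"] by (simp only: of_nat_le_iff finite_atLeastAtMost_int)
  also have "\<dots> = 2 * of_int m + 1" using m(1) by simp
  also have "\<dots> \<le> 3 * (R / \<rho>)" using m by linarith
  finally have Z_card: "real (card Z) \<le> 3 * (R / \<rho>)" .
  have Z_le: "\<bar>z\<bar> \<le> R" if z: "z \<in> Z" for z
  proof -
    obtain k where k: "z = \<rho> * of_int k" "k \<in> {- m..m}"
      using z unfolding Z_def by blast
    have "\<rho> * of_int \<bar>k\<bar> \<le> \<rho> * of_int m"
      using k(2) \<open>0 < \<rho>\<close> by (intro mult_left_mono) auto
    also have "\<dots> \<le> \<rho> * (R / \<rho>)" using m(2) \<open>0 < \<rho>\<close> by (intro mult_left_mono) auto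
    finally show ?thesis using k(1) \<open>0 < \<rho>\<close> by (simp add: abs_mult)
  qed
  have Z_near: "\<exists>z\<in>Z. \<bar>t - z\<bar> \<le> \<rho>" if t: "\<bar>t\<bar> \<le> R" for t
  proof -
    \<comment> \<open>Rounding towards 0, by floor or ceiling according to the sign, keeps the grid
      point within the range.\<close>
    have k: "\<exists>k. k \<in> {- m..m} \<and> \<bar>t / \<rho> - of_int k\<bar> \<le> 1"
    proof (cases "t \<ge> 0")
      case True
      then have "t / \<rho> \<le> R / \<rho>" "0 \<le> t / \<rho>"
        using t \<open>0 < \<rho>\<close> by (auto intro: divide_right_mono)
      then have "\<lfloor>t / \<rho>\<rfloor> \<le> m" "0 \<le> \<lfloor>t / \<rho>\<rfloor>"
        unfolding m_def by (auto intro: floor_mono)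
      moreover have "\<bar>t / \<rho> - of_int \<lfloor>t / \<rho>\<rfloor>\<bar> \<le> 1"
        by linarith
      ultimately show ?thesis
        using m(1) by (intro exI [of _ "\<lfloor>t / \<rho>\<rfloor>"]) auto
    next
      case False
      then have "t / \<rho> \<le> 0"
        using \<open>0 < \<rho>\<close> by (simp add: divide_nonpos_pos)
      have "- R \<le> t" using t by simp
      then have "- R / \<rho> \<le> t / \<rho>"
        using \<open>0 < \<rho>\<close> by (intro divide_right_mono) auto
      then have "- (R / \<rho>) \<le> t / \<rho>" by simp
      then have "\<lceil>- (R / \<rho>)\<rceil> \<le> \<lceil>t / \<rho>\<rceil>" "\<lceil>t / \<rho>\<rceil> \<le> 0"
        using \<open>t / \<rho> \<le> 0\<close> by (auto intro: ceiling_mono simp: ceiling_le_zero)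
      moreover have "\<bar>t / \<rho> - of_int \<lceil>t / \<rho>\<rceil>\<bar> \<le> 1"
        by linarith
      moreover have "- m \<le> \<lceil>t / \<rho>\<rceil>"
        using \<open>\<lceil>- (R / \<rho>)\<rceil> \<le> \<lceil>t / \<rho>\<rceil>\<close> by (simp only: m_def ceiling_minus)
      moreover have "\<lceil>t / \<rho>\<rceil> \<le> m"
        using \<open>\<lceil>t / \<rho>\<rceil> \<le> 0\<close> m(1) by linarith
      ultimately show ?thesis
        by (intro exI [of _ "\<lceil>t / \<rho>\<rceil>"] conjI) (simp_all only: atLeastAtMost_iff)
    qed
    then obtain k where k: "k \<in> {- m..m}" "\<bar>t / \<rho> - of_int k\<bar> \<le> 1" by metis
    have "t - \<rho> * of_int k = \<rho> * (t / \<rho> - of_int k)"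
      using \<open>0 < \<rho>\<close> by (simp add: right_diff_distrib)
    then have "\<bar>t - \<rho> * of_int k\<bar> = \<rho> * \<bar>t / \<rho> - of_int k\<bar>"
      using \<open>0 < \<rho>\<close> by (simp add: abs_mult)
    also have "\<dots> \<le> \<rho> * 1"
      using k(2) \<open>0 < \<rho>\<close> by (intro mult_left_mono) auto
    finally have "\<bar>t - \<rho> * of_int k\<bar> \<le> \<rho>" by simp
    moreover have "\<rho> * of_int k \<in> Z"
      unfolding Z_def using k(1) by (rule imageI)
    ultimately show ?thesis by blast
  qed
  show thesis
  proof
    show "finite (J \<rightarrow>\<^sub>E Z)" using J by (auto intro!: finite_PiE simp: Z_def)
    have "real (card (J \<rightarrow>\<^sub>E Z)) = real (card Z) ^ card J"
      using card_PiE [OF J, of "\<lambda>_. Z"] by simp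
    also have "\<dots> \<le> (3 * (R / \<rho>)) ^ card J" using Z_card by (intro power_mono) auto
    finally show "real (card (J \<rightarrow>\<^sub>E Z)) \<le> (3 * (R / \<rho>)) ^ card J" .
    show "\<bar>g j\<bar> \<le> R" if "g \<in> J \<rightarrow>\<^sub>E Z" "j \<in> J" for g j
      using that by (auto intro: Z_le)
    fix a :: "'j \<Rightarrow> real" assume a: "\<And>j. j \<in> J \<Longrightarrow> \<bar>a j\<bar> \<le> R"
    then have "\<forall>j\<in>J. \<exists>z. z \<in> Z \<and> \<bar>a j - z\<bar> \<le> \<rho>"
      using Z_near by blast
    from bchoice [OF this] obtain z where z: "\<And>j. j \<in> J \<Longrightarrow> z j \<in> Z \<and> \<bar>a j - z j\<bar> \<le> \<rho>"
      by blast
    then show "\<exists>g\<in>J \<rightarrow>\<^sub>E Z. \<forall>j\<in>J. \<bar>a j - g j\<bar> \<le> \<rho>"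
      by (intro bexI [of _ "restrict z J"]) auto
  qed
qed

context exp_lie_group
begin

text \<open>Mean value inequality on the compact convex product of two balls, where the derivative
  of \<open>mul\<close> is bounded.\<close>

lemma mul_Lipschitz:
  assumes "B > 0"
  obtains L where "L > 0" "\<And>x y z w. norm x \<le> B \<Longrightarrow> norm y \<le> B \<Longrightarrow> norm z \<le> B \<Longrightarrow> norm w \<le> B \<Longrightarrow>
     norm (mul x y - mul z w) \<le> L * (norm (x - z) + norm (y - w))"
proof -
  define K where "K = cball (0 :: 'a) B \<times> cball (0 :: 'a) B"
  have "compact K" unfolding K_def by (intro compact_Times compact_cball)
  have "\<exists>c. \<forall>q\<in>K. norm (D q b) \<le> c" for b
  proof -
    have "compact ((\<lambda>q. D q b) ` K)"
      using \<open>compact K\<close> by (intro compact_continuous_image continuous_intros)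
    then have "bounded ((\<lambda>q. D q b) ` K)" by (rule compact_imp_bounded)
    then show ?thesis
      unfolding bounded_iff by blast
  qed
  then obtain c where c: "\<And>b q. q \<in> K \<Longrightarrow> norm (D q b) \<le> c b" by metis
  define L where "L = (\<Sum>b\<in>Basis. \<bar>c b\<bar>) + 1"
  have "L > 0" unfolding L_def by (intro add_nonneg_pos sum_nonneg) auto
  have on: "onorm (D q) \<le> L" if "q \<in> K" for q
  proof (rule onorm_le)
    fix v
    have "norm (D q v) \<le> (\<Sum>b\<in>Basis. norm ((v \<bullet> b) *\<^sub>R D q b))"
      by (subst D_expand) (rule norm_sum)
    also have "\<dots> \<le> (\<Sum>b\<in>Basis. norm v * \<bar>c b\<bar>)"
      unfolding norm_scaleR using c [OF that] Basis_le_norm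
      by (intro sum_mono mult_mono) (auto intro: order_trans [OF _ abs_ge_self])
    also have "\<dots> = (\<Sum>b\<in>Basis. \<bar>c b\<bar>) * norm v"
      by (simp add: sum_distrib_left [symmetric] mult.commute)
    also have "\<dots> \<le> L * norm v"
      unfolding L_def by (intro mult_right_mono) auto
    finally show "norm (D q v) \<le> L * norm v" .
  qed
  have "convex K" unfolding K_def by (intro convex_Times convex_cball)
  show thesis
  proof (rule that [OF \<open>L > 0\<close>])
    fix x y z w :: 'a assume "norm x \<le> B" "norm y \<le> B" "norm z \<le> B" "norm w \<le> B"
    then have "(x, y) \<in> K" "(z, w) \<in> K" by (auto simp: K_def)
    then have "norm ((\<lambda>(x, y). mul x y) (x, y) - (\<lambda>(x, y). mul x y) (z, w)) \<le> L * norm ((x, y) - (z, w))"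
      using differentiable_bound [OF \<open>convex K\<close> has_derivative_at_withinI [OF has_derivative_mul] on] by blast
    also have "\<dots> \<le> L * (norm (x - z) + norm (y - w))"
      using \<open>L > 0\<close> by (intro mult_left_mono) (auto simp: norm_Pair_le)
    finally show "norm (mul x y - mul z w) \<le> L * (norm (x - z) + norm (y - w))" by simp
  qed
qed

end

context homogeneous_group
begin

lemma covered_mul:
  assumes "covered d \<rho> N A"
  shows "covered d \<rho> N (mul q ` A)"
proof -
  obtain \<E> where \<E>: "finite \<E>" "real (card \<E>) \<le> N" "A \<subseteq> \<Union>\<E>"
      "\<And>E x y. E \<in> \<E> \<Longrightarrow> x \<in> E \<Longrightarrow> y \<in> E \<Longrightarrow> d x y \<le> \<rho>"
    using assms unfolding covered_def by blast
  have "real (card ((`) (mul q) ` \<E>)) \<le> N"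
    using card_image_le [OF \<E>(1), of "(`) (mul q)"] \<E>(2) by linarith
  moreover have "\<forall>E\<in>(`) (mul q) ` \<E>. \<forall>x\<in>E. \<forall>y\<in>E. d x y \<le> \<rho>"
    using \<E>(4) by (auto simp: d_mul)
  moreover have "finite ((`) (mul q) ` \<E>)" using \<E>(1) by simp
  moreover have "mul q ` A \<subseteq> \<Union>((`) (mul q) ` \<E>)" using \<E>(3) by blast
  ultimately show ?thesis
    unfolding covered_def by (intro exI [of _ "(`) (mul q) ` \<E>"] conjI)
qed

lemma layer_indices:
  assumes "k \<in> {1..\<iota>}"
  shows "{i \<in> {1..DIM('a)}. dg i = k} = {ls (k - 1) + 1..ls k}"
proof -
  have le: "ls k \<le> DIM('a)"
    using layer_sum_mono [of k \<iota>] assms layer_sum_total by simp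
  have "i \<in> {1..DIM('a)} \<and> dg i = k \<longleftrightarrow> i \<in> {ls (k - 1) + 1..ls k}" for i
  proof
    assume "i \<in> {1..DIM('a)} \<and> dg i = k"
    then show "i \<in> {ls (k - 1) + 1..ls k}"
      using deg_bounds(1,2) [of i] by auto
  next
    assume i: "i \<in> {ls (k - 1) + 1..ls k}"
    then have "dg i = k" by (intro deg_eqI) simp_all
    then show "i \<in> {1..DIM('a)} \<and> dg i = k" using i le by simp
  qed
  then show ?thesis by blast
qed

text \<open>Going from \<open>k\<close> to \<open>k + 1\<close>, the coordinates of degree \<open>k\<close> are brought from size \<open>r\<^sup>l\<close> down to
  size \<open>r\<^sup>k\<close> by left translation with the points of a grid in \<open>V k\<close>; such a translation acts
  additively on the coordinates of degree at most \<open>k\<close>.\<close>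

lemma covered_partial_box:
  assumes "1 \<le> l" "l < k" "k \<le> Suc \<iota>" "M > 0"
  shows "\<exists>C>0. \<forall>r. 0 < r \<and> r \<le> 1 \<longrightarrow> covered d (C * r) (C * (1 / r) ^ (\<Sum>j=k..\<iota>. dim (V j) * (j - l)))
      {z. norm z \<le> M * r ^ l \<and> (\<forall>i\<in>{1..DIM('a)}. dg i < k \<longrightarrow> \<bar>z \<bullet> X i\<bar> \<le> M * r ^ dg i)}"
  using assms(3,2,4)
\<comment> \<open>Downward induction from \<open>Suc \<iota>\<close>, where all coordinates already
  have homogeneous size. \<open>M\<close> is arbitrary because it grows at each translation.\<close>
proof (induction k arbitrary: M rule: inc_induct)
  case base
  obtain C where C: "C > 0"
    "\<And>r y. r > 0 \<Longrightarrow> (\<And>i. i \<in> {1..DIM('a)} \<Longrightarrow> \<bar>y \<bullet> X i\<bar> \<le> M * r ^ dg i) \<Longrightarrow> d 0 y \<le> C * r"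
    using d_le_if_coords_le [of M] base by auto
  have "covered d ((2 * C + 1) * r) ((2 * C + 1) * (1 / r) ^ (\<Sum>j=Suc \<iota>..\<iota>. dim (V j) * (j - l)))
      {z. norm z \<le> M * r ^ l \<and> (\<forall>i\<in>{1..DIM('a)}. dg i < Suc \<iota> \<longrightarrow> \<bar>z \<bullet> X i\<bar> \<le> M * r ^ dg i)}"
    if "0 < r" "r \<le> 1" for r
  proof (rule covered_single)
    have near: "d 0 z \<le> C * r"
      if "z \<in> {z. norm z \<le> M * r ^ l \<and> (\<forall>i\<in>{1..DIM('a)}. dg i < Suc \<iota> \<longrightarrow> \<bar>z \<bullet> X i\<bar> \<le> M * r ^ dg i)}" for z
      using that deg_bounds(3) by (intro C(2) \<open>0 < r\<close>) (auto simp: less_Suc_eq_le)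
    fix x y
    assume "x \<in> {z. norm z \<le> M * r ^ l \<and> (\<forall>i\<in>{1..DIM('a)}. dg i < Suc \<iota> \<longrightarrow> \<bar>z \<bullet> X i\<bar> \<le> M * r ^ dg i)}"
       "y \<in> {z. norm z \<le> M * r ^ l \<and> (\<forall>i\<in>{1..DIM('a)}. dg i < Suc \<iota> \<longrightarrow> \<bar>z \<bullet> X i\<bar> \<le> M * r ^ dg i)}"
    then have "d 0 x \<le> C * r" "d 0 y \<le> C * r" by (intro near; simp)+
    then show "d x y \<le> (2 * C + 1) * r"
      using triangle [of x 0 y] commute [of x 0] \<open>0 < r\<close> by (simp add: algebra_simps)
  qed (use C(1) in simp)
  then show ?case using C(1) by (intro exI [of _ "2 * C + 1"]) auto
next
  case (step k)
  define J where "J = {i \<in> {1..DIM('a)}. dg i = k}"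
  have J: "finite J" "J \<subseteq> {1..DIM('a)}" by (auto simp: J_def)
  have kk: "k \<in> {1..\<iota>}" using step assms(1) by auto
  have cardJ: "card J = dim (V k)"
    using layer_indices [OF kk] layer_sum_Suc [of "k - 1"] kk by (simp add: J_def)
  define B where "B = real DIM('a) * M + M"
  have "B > 0" using step.prems by (simp add: B_def add_nonneg_pos)
  obtain L where L: "L > 0" "\<And>x y z w. norm x \<le> B \<Longrightarrow> norm y \<le> B \<Longrightarrow> norm z \<le> B \<Longrightarrow> norm w \<le> B \<Longrightarrow>
     norm (mul x y - mul z w) \<le> L * (norm (x - z) + norm (y - w))"
    using mul_Lipschitz [OF \<open>B > 0\<close>] by blast
  \<comment> \<open>Translation by the inverse of a grid vector of norm at most
    \<open>DIM('a) * M * r ^ l\<close> moves a point by at most \<open>L\<close> times that norm.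
    The bound of order \<open>r ^ l\<close> for the higher coordinates thus survives.\<close>
  define M' where "M' = M + L * (real DIM('a) * M)"
  have "M' \<ge> M" "M' > 0" using L(1) step.prems by (auto simp: M'_def add_pos_nonneg)
  define P where "P k M r = {z. norm z \<le> M * r ^ l \<and> (\<forall>i\<in>{1..DIM('a)}. dg i < k \<longrightarrow> \<bar>z \<bullet> X i\<bar> \<le> M * r ^ dg i)}" for k M r
  obtain C where C: "C > 0" "\<And>r. 0 < r \<Longrightarrow> r \<le> 1 \<Longrightarrow>
      covered d (C * r) (C * (1 / r) ^ (\<Sum>j=Suc k..\<iota>. dim (V j) * (j - l))) (P (Suc k) M' r)"
    using step.IH [of M'] step.prems \<open>M' > 0\<close> unfolding P_def by auto
  have "covered d (3 ^ dim (V k) * C * r) (3 ^ dim (V k) * C * (1 / r) ^ (\<Sum>j=k..\<iota>. dim (V j) * (j - l))) (P k M r)"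
    if r: "0 < r" "r \<le> 1" for r
  proof -
    have "M * r ^ k \<le> M * r ^ l"
      using step.prems r by (intro mult_left_mono power_decreasing) auto
    then obtain G where G: "finite G" "real (card G) \<le> (3 * ((M * r ^ l) / (M * r ^ k))) ^ card J"
      "\<And>g j. g \<in> G \<Longrightarrow> j \<in> J \<Longrightarrow> \<bar>g j\<bar> \<le> M * r ^ l"
      "\<And>a. (\<And>j. j \<in> J \<Longrightarrow> \<bar>a j\<bar> \<le> M * r ^ l) \<Longrightarrow> \<exists>g\<in>G. \<forall>j\<in>J. \<bar>a j - g j\<bar> \<le> M * r ^ k"
      using exists_grid [OF J(1), of "M * r ^ k" "M * r ^ l"] step.prems r(1) by auto
    define q where "q g = (\<Sum>j\<in>J. g j *\<^sub>R X j)" for g :: "nat \<Rightarrow> real"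
    have q_coord: "q g \<bullet> X i = (if i \<in> J then g i else 0)" if "i \<in> {1..DIM('a)}" for g i
      unfolding q_def by (rule coord_sum [OF J(2) that])
    have "P k M r \<subseteq> (\<Union>g\<in>G. mul (q g) ` P (Suc k) M' r)"
    proof
      fix z assume z: "z \<in> P k M r"
      have "\<bar>z \<bullet> X j\<bar> \<le> M * r ^ l" if "j \<in> J" for j
        using z coord_le_norm [of j z] J(2) that by (fastforce simp: P_def)
      from G(4) [of "\<lambda>j. z \<bullet> X j", OF this] obtain g where g: "g \<in> G" "\<And>j. j \<in> J \<Longrightarrow> \<bar>z \<bullet> X j - g j\<bar> \<le> M * r ^ k"
        by blast
      define z' where "z' = mul (- q g) z"
      have rl: "r ^ l \<le> 1" using r by (intro power_le_one) auto
      have norm_q: "norm (q g) \<le> real DIM('a) * (M * r ^ l)"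
        using q_coord G(3) [OF g(1)] step.prems r by (intro norm_le_coords) auto
      have norm_z: "norm z \<le> M * r ^ l" using z by (simp add: P_def)
      have "norm z' \<le> M' * r ^ l"
      proof -
        have "M * r ^ l \<le> M * 1" using rl step.prems by (intro mult_left_mono) auto
        then have "norm z \<le> M" using norm_z by simp
        moreover have "0 \<le> real DIM('a) * M" using step.prems by simp
        ultimately have "norm z \<le> B" unfolding B_def by linarith
        have "real DIM('a) * (M * r ^ l) \<le> real DIM('a) * M"
          using \<open>M * r ^ l \<le> M * 1\<close> by (intro mult_left_mono) auto
        then have "norm (- q g) \<le> B"
          using norm_q step.prems unfolding B_def norm_minus_cancel by linarith
        then have "norm (mul (- q g) z - mul 0 z) \<le> L * (norm (- q g - 0) + norm (z - z))"
          using \<open>norm z \<le> B\<close> \<open>B > 0\<close> by (intro L(2)) auto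
        also have "\<dots> \<le> L * (real DIM('a) * (M * r ^ l))"
          using norm_q L(1) by (intro mult_left_mono) auto
        finally have "norm (z' - z) \<le> L * (real DIM('a) * (M * r ^ l))" by (simp add: z'_def)
        then show ?thesis
          using norm_z norm_triangle_sub [of z' z] by (simp add: M'_def algebra_simps)
      qed
      moreover have "\<bar>z' \<bullet> X i\<bar> \<le> M' * r ^ dg i" if i: "i \<in> {1..DIM('a)}" "dg i < Suc k" for i
      proof -
        \<comment> \<open>A grid vector has only coordinates of degree \<open>k\<close>: degrees
          below \<open>k\<close> are unchanged, degree \<open>k\<close> becomes the rounding error,
          at most \<open>M * r ^ k\<close>.\<close>
        have "- q g \<in> I k" using q_coord by (auto simp: I_def J_def)
        then have eq: "z' \<bullet> X i = - q g \<bullet> X i + z \<bullet> X i"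
          unfolding z'_def using kk i by (intro mul_coord) auto
        have "\<bar>z' \<bullet> X i\<bar> \<le> M * r ^ dg i"
        proof (cases "dg i = k")
          case True
          then have "i \<in> J" using i by (simp add: J_def)
          then show ?thesis using g(2) [of i] eq q_coord [OF i(1)] True by simp
        next
          case False
          then have "i \<notin> J" "dg i < k" using i by (auto simp: J_def)
          then show ?thesis using z eq q_coord [OF i(1)] i by (auto simp: P_def)
        qed
        also have "\<dots> \<le> M' * r ^ dg i"
          using \<open>M' \<ge> M\<close> r by (intro mult_right_mono) auto
        finally show ?thesis .
      qed
      ultimately have "z' \<in> P (Suc k) M' r" by (simp add: P_def)
      moreover have "z = mul (q g) z'" by (simp add: z'_def)
      ultimately show "z \<in> (\<Union>g\<in>G. mul (q g) ` P (Suc k) M' r)" using g(1) by blast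
    qed
    moreover have "0 \<le> C * (1 / r) ^ (\<Sum>j=Suc k..\<iota>. dim (V j) * (j - l))"
      using C(1) r(1) by simp
    ultimately have cov: "covered d (C * r) ((3 * ((M * r ^ l) / (M * r ^ k))) ^ card J *
        (C * (1 / r) ^ (\<Sum>j=Suc k..\<iota>. dim (V j) * (j - l)))) (P k M r)"
      by (intro covered_UN [OF G(1,2) _ _ covered_mul [OF C(2) [OF r]]])
    \<comment> \<open>Each direction of degree \<open>k\<close> needs 3 r^(l-k) grid values, which
      adds \<open>(k - l) * dim (V k)\<close> to the exponent.\<close>
    have cov_eq: "(3 * ((M * r ^ l) / (M * r ^ k))) ^ card J * (C * (1 / r) ^ (\<Sum>j=Suc k..\<iota>. dim (V j) * (j - l)))
        = 3 ^ dim (V k) * C * (1 / r) ^ (\<Sum>j=k..\<iota>. dim (V j) * (j - l))"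
    proof -
      have "r ^ k = r ^ l * r ^ (k - l)"
        using step.prems by (simp flip: power_add)
      then have "(M * r ^ l) / (M * r ^ k) = (1 / r) ^ (k - l)"
        using step.prems r by (simp add: power_one_over)
      moreover have "(\<Sum>j=k..\<iota>. dim (V j) * (j - l)) = (k - l) * dim (V k) + (\<Sum>j=Suc k..\<iota>. dim (V j) * (j - l))"
        using kk by (subst sum.atLeast_Suc_atMost) auto
      ultimately show ?thesis
        by (simp add: cardJ power_mult_distrib power_add power_mult)
    qed
    have cov_le: "C * r \<le> 3 ^ dim (V k) * C * r"
      using C(1) r(1) by (intro mult_right_mono) auto
    show ?thesis
      by (rule covered_mono [OF cov cov_le eq_refl [OF cov_eq] order_refl])
  qed
  then show ?case
    unfolding P_def using C(1) by (intro exI [of _ "3 ^ dim (V k) * C"]) auto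
qed

text \<open>The parameter box is cut into cells of size r^l. Translating the image of a cell by the
  inverse of one of its points puts it into a Euclidean ball of radius \<open>M * r ^ l\<close>,
  covered by the preceding lemma; the number of cells adds \<open>l * CARD('p)\<close> to the
  exponent.\<close>

lemma covered_chart:
  fixes \<phi> :: "real ^ 'p::finite \<Rightarrow> 'a"
  assumes \<phi>: "C1_param T W \<phi> \<phi>'" and K: "cbox a b \<subseteq> W" and p: "CARD('p) \<le> DIM('a)"
  shows "\<exists>C>0. \<forall>r. 0 < r \<and> r \<le> 1 \<longrightarrow> covered d (C * r) (C * (1 / r) ^ max_deg V CARD('p)) (\<phi> ` cbox a b)"
proof -
  define l where "l = dg (DIM('a) + 1 - CARD('p))"
  have p1: "1 \<le> CARD('p)" by (simp add: Suc_le_eq)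
  have l: "l \<in> {1..\<iota>}"
  proof -
    have "1 \<le> DIM('a) + 1 - CARD('p)" "DIM('a) + 1 - CARD('p) \<le> DIM('a)"
      using p p1 by linarith+
    then show ?thesis
      unfolding l_def by (intro deg_bounds(3)) simp
  qed
  have der: "(\<phi> has_derivative \<phi>' w) (at w within cbox a b)" if "w \<in> cbox a b" for w
    using \<phi> K that has_derivative_at_withinI unfolding C1_param_def by blast
  have cont: "continuous_on (cbox a b) \<phi>"
    by (rule has_derivative_continuous_on [OF der])
  have "compact (\<phi>' ` cbox a b)"
    using \<phi> K by (intro compact_continuous_image compact_cbox) (auto simp: C1_param_def intro: continuous_on_subset)
  then have "bounded (\<phi>' ` cbox a b)" by (rule compact_imp_bounded)
  then obtain \<Lambda> where \<Lambda>: "\<Lambda> > 0" "\<And>w. w \<in> cbox a b \<Longrightarrow> norm (\<phi>' w) \<le> \<Lambda>"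
    unfolding bounded_pos by blast
  have lip: "norm (\<phi> w - \<phi> w') \<le> \<Lambda> * norm (w - w')" if "w \<in> cbox a b" "w' \<in> cbox a b" for w w'
    using differentiable_bound [OF convex_box(1) der, where B = \<Lambda>] \<Lambda>(2) that by (simp add: norm_blinfun.rep_eq)
  have "bounded (\<phi> ` cbox a b)"
    by (intro compact_imp_bounded compact_continuous_image cont compact_cbox)
  then obtain B where B: "B > 0" "\<And>w. w \<in> cbox a b \<Longrightarrow> norm (\<phi> w) \<le> B"
    unfolding bounded_pos by blast
  obtain L where L: "L > 0" "\<And>x y z w. norm x \<le> B \<Longrightarrow> norm y \<le> B \<Longrightarrow> norm z \<le> B \<Longrightarrow> norm w \<le> B \<Longrightarrow>
     norm (mul x y - mul z w) \<le> L * (norm (x - z) + norm (y - w))"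
    using mul_Lipschitz [OF B(1)] by blast
  obtain R0 where R0: "R0 > 0" "\<And>w. w \<in> cbox a b \<Longrightarrow> norm w \<le> R0"
    using bounded_cbox [of a b] unfolding bounded_pos by blast
  define R where "R = max 1 R0"
  \<comment> \<open>Two points of a cell differ by at most 2 r^l in each of the
    \<open>CARD('p)\<close> parameters; \<open>\<Lambda>\<close> and \<open>L\<close> are the
    Lipschitz constants of the chart and of multiplication.\<close>
  define M where "M = L * (\<Lambda> * (real CARD('p) * 2))"
  have "M > 0" using L \<Lambda> by (simp add: M_def)
  define P where "P r = {z :: 'a. norm z \<le> M * r ^ l}" for r
  obtain C where C: "C > 0" "\<And>r. 0 < r \<Longrightarrow> r \<le> 1 \<Longrightarrow>
      covered d (C * r) (C * (1 / r) ^ (\<Sum>j=Suc l..\<iota>. dim (V j) * (j - l))) (P r)"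
  proof -
    \<comment> \<open>For degrees at most \<open>l\<close> the homogeneous bound follows from the
      Euclidean one, since r^l <= r^(dg i) when r <= 1.\<close>
    have eq: "{z. norm z \<le> M * r ^ l \<and> (\<forall>i\<in>{1..DIM('a)}. dg i < Suc l \<longrightarrow> \<bar>z \<bullet> X i\<bar> \<le> M * r ^ dg i)} = P r"
      if "0 < r" "r \<le> 1" for r
    proof -
      have "\<bar>z \<bullet> X i\<bar> \<le> M * r ^ dg i" if z: "norm z \<le> M * r ^ l" and i: "i \<in> {1..DIM('a)}" "dg i < Suc l" for z i
      proof -
        have "\<bar>z \<bullet> X i\<bar> \<le> M * r ^ l" using coord_le_norm [OF i(1), of z] z by simp
        also have "\<dots> \<le> M * r ^ dg i"
          using \<open>M > 0\<close> \<open>0 < r\<close> \<open>r \<le> 1\<close> i(2) by (intro mult_left_mono power_decreasing) auto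
        finally show ?thesis .
      qed
      then show ?thesis by (auto simp: P_def)
    qed
    obtain C where C: "C > 0" "\<And>r. 0 < r \<and> r \<le> 1 \<longrightarrow> covered d (C * r) (C * (1 / r) ^ (\<Sum>j=Suc l..\<iota>. dim (V j) * (j - l)))
      {z. norm z \<le> M * r ^ l \<and> (\<forall>i\<in>{1..DIM('a)}. dg i < Suc l \<longrightarrow> \<bar>z \<bullet> X i\<bar> \<le> M * r ^ dg i)}"
      using covered_partial_box [of l "Suc l" M] l \<open>M > 0\<close> by auto
    show thesis
    proof (rule that [OF C(1)])
      fix r :: real assume r: "0 < r" "r \<le> 1"
      show "covered d (C * r) (C * (1 / r) ^ (\<Sum>j=Suc l..\<iota>. dim (V j) * (j - l))) (P r)"
        using C(2) [of r] r unfolding eq [OF r] by blast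
    qed
  qed
  define c where "c = max 1 ((3 * R) ^ CARD('p)) * C"
  have "c > 0" using C(1) by (simp add: c_def)
  have "covered d (c * r) (c * (1 / r) ^ max_deg V CARD('p)) (\<phi> ` cbox a b)" if r: "0 < r" "r \<le> 1" for r
  proof -
    have "r ^ l \<le> 1" using r by (intro power_le_one) auto
    then have rR: "0 < r ^ l" "r ^ l \<le> R" using r by (auto simp: R_def)
    obtain G where G: "finite G" "real (card G) \<le> (3 * (R / r ^ l)) ^ card (UNIV :: 'p set)"
      "\<And>a. (\<And>j. j \<in> (UNIV :: 'p set) \<Longrightarrow> \<bar>a j\<bar> \<le> R) \<Longrightarrow> \<exists>g\<in>G. \<forall>j\<in>UNIV. \<bar>a j - g j\<bar> \<le> r ^ l"
      using exists_grid [OF finite rR] by metis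
    define Kg where "Kg g = {w \<in> cbox a b. \<forall>j. \<bar>w $ j - g j\<bar> \<le> r ^ l}" for g
    have "\<phi> ` cbox a b \<subseteq> (\<Union>g\<in>G. \<phi> ` Kg g)"
    proof
      fix x assume "x \<in> \<phi> ` cbox a b"
      then obtain w where w: "w \<in> cbox a b" "x = \<phi> w" by blast
      have "\<bar>w $ j\<bar> \<le> R" for j
        using component_le_norm_cart [of w j] R0(2) [OF w(1)] by (simp add: R_def)
      then obtain g where "g \<in> G" "\<forall>j. \<bar>w $ j - g j\<bar> \<le> r ^ l"
        using G(3) [of "\<lambda>j. w $ j"] by auto
      then show "x \<in> (\<Union>g\<in>G. \<phi> ` Kg g)" using w by (auto simp: Kg_def)
    qed
    moreover have "covered d (C * r) (C * (1 / r) ^ (\<Sum>j=Suc l..\<iota>. dim (V j) * (j - l))) (\<phi> ` Kg g)" for g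
    proof (cases "Kg g = {}")
      case True
      then show ?thesis by (intro covered_mono [OF C(2) [OF r] order_refl order_refl]) simp
    next
      case False
      then obtain w0 where w0: "w0 \<in> Kg g" by blast
      have "\<phi> ` Kg g \<subseteq> mul (\<phi> w0) ` P r"
      proof
        fix x assume "x \<in> \<phi> ` Kg g"
        then obtain w where w: "w \<in> Kg g" "x = \<phi> w" by blast
        have "norm (w - w0) \<le> (\<Sum>j\<in>UNIV. \<bar>(w - w0) $ j\<bar>)" by (rule norm_le_l1_cart)
        also have "\<dots> \<le> (\<Sum>j\<in>(UNIV :: 'p set). 2 * r ^ l)"
        proof (intro sum_mono)
          fix j
          have "\<bar>w $ j - g j\<bar> \<le> r ^ l" "\<bar>w0 $ j - g j\<bar> \<le> r ^ l" using w w0 by (auto simp: Kg_def)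
          then show "\<bar>(w - w0) $ j\<bar> \<le> 2 * r ^ l" unfolding vector_minus_component by linarith
        qed
        finally have ww: "norm (w - w0) \<le> real CARD('p) * 2 * r ^ l" by simp
        have in_K: "w \<in> cbox a b" "w0 \<in> cbox a b" using w w0 by (auto simp: Kg_def)
        have "norm (mul (- \<phi> w0) (\<phi> w) - mul (- \<phi> w0) (\<phi> w0))
            \<le> L * (norm (- \<phi> w0 - (- \<phi> w0)) + norm (\<phi> w - \<phi> w0))"
          using B(2) in_K by (intro L(2)) auto
        also have "\<dots> \<le> L * (\<Lambda> * (real CARD('p) * 2 * r ^ l))"
          using L(1) \<Lambda>(1) lip [OF in_K] ww order_trans [OF lip [OF in_K] mult_left_mono [OF ww]]
          by (intro mult_left_mono) auto
        finally have "mul (- \<phi> w0) (\<phi> w) \<in> P r"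
          by (simp add: P_def M_def mult.assoc)
        then show "x \<in> mul (\<phi> w0) ` P r"
          using w(2) by (metis image_eqI mul_neg(1))
      qed
      then show ?thesis
        by (rule covered_mono [OF covered_mul [OF C(2) [OF r]] order_refl order_refl])
    qed
    moreover have "0 \<le> C * (1 / r) ^ (\<Sum>j=Suc l..\<iota>. dim (V j) * (j - l))"
      using C(1) r(1) by simp
    ultimately have "covered d (C * r) ((3 * (R / r ^ l)) ^ card (UNIV :: 'p set) *
        (C * (1 / r) ^ (\<Sum>j=Suc l..\<iota>. dim (V j) * (j - l)))) (\<phi> ` cbox a b)"
      by (intro covered_UN [OF G(1,2)])
    moreover have "C * r \<le> c * r"
      using C(1) r unfolding c_def by (intro mult_right_mono) auto
    moreover have "(3 * (R / r ^ l)) ^ card (UNIV :: 'p set) * (C * (1 / r) ^ (\<Sum>j=Suc l..\<iota>. dim (V j) * (j - l)))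
        \<le> c * (1 / r) ^ max_deg V CARD('p)"
    proof -
      have "(3 * (R / r ^ l)) ^ card (UNIV :: 'p set) = (3 * R) ^ CARD('p) * (1 / r) ^ (l * CARD('p))"
        by (simp add: power_mult_distrib power_divide power_mult)
      moreover have "max_deg V CARD('p) = (\<Sum>j=Suc l..\<iota>. dim (V j) * (j - l)) + l * CARD('p)"
        using max_deg_formula [OF p1 p] by (simp add: l_def)
      ultimately have "(3 * (R / r ^ l)) ^ card (UNIV :: 'p set) * (C * (1 / r) ^ (\<Sum>j=Suc l..\<iota>. dim (V j) * (j - l)))
          = (3 * R) ^ CARD('p) * C * (1 / r) ^ max_deg V CARD('p)"
        by (simp add: power_add mult_ac)
      also have "\<dots> \<le> c * (1 / r) ^ max_deg V CARD('p)"
        unfolding c_def using C(1) r by (intro mult_right_mono) auto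
      finally show ?thesis .
    qed
    ultimately show ?thesis by (rule covered_mono [OF _ _ _ order_refl])
  qed
  then show ?thesis using \<open>c > 0\<close> by blast
qed

text \<open>Second countability of the manifold topology makes it Lindelof, so countably many chart
  images cover \<open>S\<close>; each chart domain is a countable union of boxes.\<close>

lemma hausdorff_null_submanifold:
  assumes S: "C1_submanifold TYPE('p::finite) S T" and p: "CARD('p) \<le> DIM('a)"
    and s: "s > real (max_deg V CARD('p))"
  shows "hausdorff_null d s S"
proof -
  define \<U> where "\<U> = {\<phi> ` W | W (\<phi> :: real ^ 'p \<Rightarrow> 'a) \<phi>'. C1_param T W \<phi> \<phi>'}"
  have "second_countable T" "topspace T = S" using S by (auto simp: C1_submanifold_def)
  moreover have open_\<U>: "\<forall>U\<in>\<U>. openin T U" by (auto simp: \<U>_def C1_param_def)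
  moreover have "\<Union>\<U> = topspace T"
  proof
    show "\<Union>\<U> \<subseteq> topspace T" using \<open>\<forall>U\<in>\<U>. openin T U\<close> openin_subset by blast
    show "topspace T \<subseteq> \<Union>\<U>"
      using S unfolding C1_submanifold_def \<U>_def by blast
  qed
  ultimately obtain \<V> where \<V>: "countable \<V>" "\<V> \<subseteq> \<U>" "\<Union>\<V> = S"
    using second_countable_imp_Lindelof_space unfolding Lindelof_space_def by metis
  have "hausdorff_null d s U" if U: "U \<in> \<V>" for U
  proof -
    obtain W and \<phi> :: "real ^ 'p \<Rightarrow> 'a" and \<phi>' where \<phi>: "C1_param T W \<phi> \<phi>'" "U = \<phi> ` W"
      using U \<V>(2) unfolding \<U>_def by blast
    then have "open W" by (simp add: C1_param_def)
    then obtain \<D> where \<D>: "countable \<D>" "\<D> \<subseteq> Pow W" "\<And>K. K \<in> \<D> \<Longrightarrow> \<exists>a b. K = cbox a b" "\<Union>\<D> = W"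
      using open_countable_Union_open_cbox by metis
    have "hausdorff_null d s (\<Union>((`) \<phi> ` \<D>))"
    proof (rule hausdorff_null_countable_Union)
      show "countable ((`) \<phi> ` \<D>)" using \<D>(1) by simp
      fix A assume "A \<in> (`) \<phi> ` \<D>"
      then obtain a b where "A = \<phi> ` cbox a b" "cbox a b \<subseteq> W" using \<D> by blast
      then obtain C where "C > 0" "\<And>r. 0 < r \<and> r \<le> 1 \<longrightarrow> covered d (C * r) (C * (1 / r) ^ max_deg V CARD('p)) A"
        using covered_chart [OF \<phi>(1) _ p] by blast
      then show "hausdorff_null d s A"
        by (intro hausdorff_null_if_covered [OF nonneg s]) auto
    qed
    moreover have "\<Union>((`) \<phi> ` \<D>) = U" using \<D>(4) \<phi>(2) by blast
    ultimately show ?thesis by simp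
  qed
  then show ?thesis
    using hausdorff_null_countable_Union [OF \<V>(1)] \<V>(3) by metis
qed

end

section \<open>The lower bound\<close>

text \<open>Divide the target box into cells of side s. The points of \<open>F\<close> sent to one
  cell are within distance ps/c of each other and lie in a cube of side 2ps/c. Count the cells and
  let s tend to 0.\<close>

lemma measure_le_prod_if_expanding:
  fixes f :: "real ^ 'p::finite \<Rightarrow> real ^ 'p" and R :: "'p \<Rightarrow> real"
  assumes F: "F \<in> sets lborel" "bounded F" and c: "c > 0"
    and expanding: "\<And>x y. x \<in> F \<Longrightarrow> y \<in> F \<Longrightarrow> c * norm (x - y) \<le> norm (f x - f y)"
    and box: "\<And>x j. x \<in> F \<Longrightarrow> \<bar>f x $ j\<bar> \<le> R j" and R: "\<And>j. 0 \<le> R j"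
  shows "measure lborel F \<le> (\<Prod>j\<in>UNIV. 4 * real CARD('p) / c * R j)"
proof -
  let ?p = "real CARD('p)"
  have p: "?p > 0" by simp
  have le: "measure lborel F \<le> (\<Prod>j\<in>UNIV. (2 * R j / s + 2) * (2 * (?p * s / c)))" if s: "s > 0" for s
  proof -
    define G where "G = PiE (UNIV :: 'p set) (\<lambda>j. {\<lfloor>- R j / s\<rfloor>..\<lfloor>R j / s\<rfloor>})"
    have "finite G" unfolding G_def by (auto intro!: finite_PiE)
    define cell where "cell x = (\<lambda>j. \<lfloor>f x $ j / s\<rfloor>)" for x
    have cell_in: "cell x \<in> G" if "x \<in> F" for x
    proof -
      have "- R j \<le> f x $ j" "f x $ j \<le> R j" for j
        using box [OF that, of j] by linarith+
      then have "- R j / s \<le> f x $ j / s" "f x $ j / s \<le> R j / s" for j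
        using s by (meson divide_right_mono less_imp_le)+
      then show ?thesis by (auto simp: G_def cell_def intro!: floor_mono)
    qed
    define t where "t = ?p * s / c"
    have "t > 0" using p s c by (simp add: t_def)
    have close: "norm (x - y) \<le> t" if xy: "x \<in> F" "y \<in> F" "cell x = cell y" for x y
    proof -
      have "norm (f x - f y) \<le> (\<Sum>j\<in>UNIV. \<bar>(f x - f y) $ j\<bar>)" by (rule norm_le_l1_cart)
      also have "\<dots> \<le> (\<Sum>j\<in>(UNIV :: 'p set). s)"
      proof (intro sum_mono)
        fix j :: 'p
        have "\<lfloor>f x $ j / s\<rfloor> = \<lfloor>f y $ j / s\<rfloor>" using fun_cong [OF xy(3), of j] by (simp add: cell_def)
        then have "\<bar>f x $ j / s - f y $ j / s\<bar> \<le> 1" by linarith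
        then have "\<bar>(f x $ j - f y $ j) / s\<bar> \<le> 1" by (simp add: diff_divide_distrib)
        then show "\<bar>(f x - f y) $ j\<bar> \<le> s" using s by (simp add: abs_divide field_simps)
      qed
      finally have "c * norm (x - y) \<le> ?p * s" using expanding [OF xy(1,2)] by simp
      then show ?thesis using c by (simp add: t_def field_simps)
    qed
    define pt where "pt k = (SOME x. x \<in> F \<and> cell x = k)" for k
    define Q where "Q k = cbox (pt k - (\<chi> j. t)) (pt k + (\<chi> j. t))" for k
    have "F \<subseteq> (\<Union>k\<in>G. Q k)"
    proof
      fix x assume x: "x \<in> F"
      have "pt (cell x) \<in> F \<and> cell (pt (cell x)) = cell x"
        unfolding pt_def by (rule someI [of _ x]) (simp add: x)
      then have "norm (x - pt (cell x)) \<le> t" using x by (intro close) auto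
      then have "\<bar>x $ j - pt (cell x) $ j\<bar> \<le> t" for j
        using component_le_norm_cart [of "x - pt (cell x)" j] by simp
      then have "x \<in> Q (cell x)"
        unfolding Q_def mem_box_cart by (auto simp: abs_le_iff algebra_simps)
      then show "x \<in> (\<Union>k\<in>G. Q k)" using cell_in [OF x] by blast
    qed
    then have "measure lborel F \<le> measure lborel (\<Union>k\<in>G. Q k)"
      using F(1) \<open>finite G\<close> by (intro measure_mono_fmeasurable) (auto simp: Q_def intro!: fmeasurable.finite_UN)
    also have "\<dots> \<le> (\<Sum>k\<in>G. measure lborel (Q k))"
      using \<open>finite G\<close> by (intro measure_UNION_le) (auto simp: Q_def)
    also have "\<dots> = (\<Sum>k\<in>G. (2 * t) ^ CARD('p))"
    proof (intro sum.cong refl)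
      fix k
      have "cbox (pt k - (\<chi> j. t)) (pt k + (\<chi> j. t)) \<noteq> {}"
        using \<open>t > 0\<close> by (auto simp: interval_ne_empty_cart)
      then show "measure lborel (Q k) = (2 * t) ^ CARD('p)"
        unfolding Q_def by (simp add: content_cbox_cart)
    qed
    also have "\<dots> = real (card G) * (2 * t) ^ CARD('p)" by simp
    also have "\<dots> \<le> (\<Prod>j\<in>(UNIV :: 'p set). 2 * R j / s + 2) * (2 * t) ^ CARD('p)"
    proof (rule mult_right_mono)
      have "real (card G) = (\<Prod>j\<in>(UNIV :: 'p set). real (card {\<lfloor>- R j / s\<rfloor>..\<lfloor>R j / s\<rfloor>}))"
        unfolding G_def by (simp add: card_PiE)
      also have "\<dots> \<le> (\<Prod>j\<in>(UNIV :: 'p set). 2 * R j / s + 2)"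
      proof (intro prod_mono conjI)
        fix j
        have "0 \<le> R j / s" using R s by simp
        have "- R j / s = - (R j / s)" by simp
        then have "real (card {\<lfloor>- R j / s\<rfloor>..\<lfloor>R j / s\<rfloor>}) = real (nat (\<lfloor>R j / s\<rfloor> - \<lfloor>- (R j / s)\<rfloor> + 1))"
          by (simp add: add.commute algebra_simps)
        also have "\<dots> \<le> 2 * (R j / s) + 2" using \<open>0 \<le> R j / s\<close> by linarith
        finally show "real (card {\<lfloor>- R j / s\<rfloor>..\<lfloor>R j / s\<rfloor>}) \<le> 2 * R j / s + 2" by simp
      qed simp
      finally show "real (card G) \<le> (\<Prod>j\<in>(UNIV :: 'p set). 2 * R j / s + 2)" .
    qed (use \<open>t > 0\<close> in simp)
    also have "\<dots> = (\<Prod>j\<in>(UNIV :: 'p set). (2 * R j / s + 2) * (2 * t))"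
      by (simp add: prod.distrib)
    finally show ?thesis by (simp add: t_def)
  qed
  \<comment> \<open>The powers of \<open>s\<close> in the cell count and in the cube size cancel up
    to a term linear in \<open>s\<close>, which disappears in the limit; degenerate sides with
    \<open>R j = 0\<close> are included.\<close>
  have eq: "(2 * R j / s + 2) * (2 * (?p * s / c)) = 4 * ?p / c * R j + 4 * ?p / c * s" if "s > 0" for j s
    using that c by (simp add: field_simps)
  have "((\<lambda>s. \<Prod>j\<in>UNIV. 4 * ?p / c * R j + 4 * ?p / c * s) \<longlongrightarrow> (\<Prod>j\<in>UNIV. 4 * ?p / c * R j + 4 * ?p / c * 0)) (at_right 0)"
    by (intro tendsto_intros)
  moreover have "\<forall>\<^sub>F s in at_right 0. measure lborel F \<le> (\<Prod>j\<in>UNIV. 4 * ?p / c * R j + 4 * ?p / c * s)"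
    using le eq by (simp add: eventually_at_right_less eventually_at_filter)
  ultimately have "measure lborel F \<le> (\<Prod>j\<in>UNIV. 4 * ?p / c * R j + 4 * ?p / c * 0)"
    by (rule tendsto_lowerbound) simp
  then show ?thesis by simp
qed

text \<open>If s < D, then each piece of a cover captures Lebesgue measure at most C diam^D <= C
  diam^s, so a cover with small sum forces \<open>K\<close> to have measure 0.\<close>

lemma mass_distribution_principle:
  fixes \<phi> :: "real ^ 'p::finite \<Rightarrow> 'a" and d :: "'a \<Rightarrow> 'a \<Rightarrow> real"
  assumes d: "\<And>x y. 0 \<le> d x y" and K: "K \<in> sets lborel" "emeasure lborel K > 0" "\<phi> ` K \<subseteq> S"
    and balls: "\<And>w r. w \<in> K \<Longrightarrow> {w' \<in> K. d (\<phi> w) (\<phi> w') \<le> r} \<in> sets lborel"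
    and mass: "\<And>w r. w \<in> K \<Longrightarrow> 0 \<le> r \<Longrightarrow> r \<le> 1 \<Longrightarrow>
       emeasure lborel {w' \<in> K. d (\<phi> w) (\<phi> w') \<le> r} \<le> ennreal (C * r ^ D)"
    and "D > 0" "C > 0" and s: "0 \<le> s" and null: "hausdorff_null d s S"
  shows "real D \<le> s"
proof (rule ccontr)
  assume "\<not> real D \<le> s"
  then have "s < real D" by simp
  have small: "emeasure lborel K \<le> 0 + ennreal \<eta>" if "\<eta> > 0" for \<eta> :: real
  proof -
    have "\<eta> / C > 0" using that \<open>C > 0\<close> by simp
    \<comment> \<open>Scale 1 keeps all diameters at most 1, as both the mass bound and the
      comparison of the powers \<open>D\<close> and \<open>s\<close> require.\<close>
    obtain E :: "nat \<Rightarrow> 'a set" where E: "S \<subseteq> (\<Union>i. E i)"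
        "\<And>i x y. x \<in> E i \<Longrightarrow> y \<in> E i \<Longrightarrow> d x y \<le> 1" "(\<Sum>i. diam_power d s (E i)) \<le> ennreal (\<eta> / C)"
      using null [unfolded hausdorff_null_def, rule_format, OF zero_less_one \<open>\<eta> / C > 0\<close>] by blast
    define diam where "diam i = (SUP (x, y)\<in>E i \<times> E i. d x y)" for i
    \<comment> \<open>Balls of radius \<open>diam i\<close> about one point of each piece replace
      the pieces, whose preimages may fail to be measurable.\<close>
    define F where "F i = (if \<exists>w\<in>K. \<phi> w \<in> E i
        then {w' \<in> K. d (\<phi> (SOME w. w \<in> K \<and> \<phi> w \<in> E i)) (\<phi> w') \<le> diam i} else {})" for i
    have F: "F i \<in> sets lborel \<and> {w \<in> K. \<phi> w \<in> E i} \<subseteq> F i \<and>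
        emeasure lborel (F i) \<le> ennreal C * diam_power d s (E i)" for i
    proof (cases "\<exists>w\<in>K. \<phi> w \<in> E i")
      case True
      define w where "w = (SOME w. w \<in> K \<and> \<phi> w \<in> E i)"
      have w: "w \<in> K" "\<phi> w \<in> E i"
        using someI_ex [of "\<lambda>w. w \<in> K \<and> \<phi> w \<in> E i"] True unfolding w_def by blast+
      have Fi: "F i = {w' \<in> K. d (\<phi> w) (\<phi> w') \<le> diam i}"
        using True by (simp add: F_def w_def)
      have bdd: "bdd_above ((\<lambda>(x, y). d x y) ` (E i \<times> E i))"
        using E(2) by (intro bdd_aboveI [of _ 1]) auto
      have diam_ge: "d x y \<le> diam i" if "x \<in> E i" "y \<in> E i" for x y
        unfolding diam_def using that by (intro cSUP_upper2 [OF bdd, of "(x, y)"]) auto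
      have "0 \<le> diam i" using diam_ge [OF w(2) w(2)] d order_trans by blast
      have "diam i \<le> 1"
        unfolding diam_def using w(2) E(2) by (intro cSUP_least) auto
      have "emeasure lborel (F i) \<le> ennreal (C * diam i ^ D)"
        unfolding Fi by (rule mass [OF w(1) \<open>0 \<le> diam i\<close> \<open>diam i \<le> 1\<close>])
      also have "\<dots> = ennreal C * ennreal (diam i ^ D)"
        using \<open>C > 0\<close> \<open>0 \<le> diam i\<close> by (simp add: ennreal_mult)
      also have "\<dots> \<le> ennreal C * diam_power d s (E i)"
      proof (rule mult_left_mono)
        show "ennreal (diam i ^ D) \<le> diam_power d s (E i)"
        proof (cases "s = 0")
          \<comment> \<open>For exponent 0 a nonempty set contributes 1 by convention, even if its
            diameter is 0.\<close>
          case True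
          have "ennreal (diam i ^ D) \<le> ennreal 1"
            using \<open>0 \<le> diam i\<close> \<open>diam i \<le> 1\<close> by (intro ennreal_leI power_le_one)
          then show ?thesis using w(2) True by (auto simp: diam_power_def)
        next
          case False
          have "diam i ^ D \<le> diam i powr s"
          proof (cases "diam i = 0")
            \<comment> \<open>Here \<open>0 powr s = 0\<close>, so the left side must vanish as
              well, which is where \<open>D > 0\<close> enters.\<close>
            case True
            then show ?thesis using \<open>D > 0\<close> by (simp add: power_0_left)
          next
            case False
            then have "diam i ^ D = diam i powr real D"
              using \<open>0 \<le> diam i\<close> by (simp add: powr_realpow)
            also have "\<dots> \<le> diam i powr s"
              using \<open>s < real D\<close> \<open>0 \<le> diam i\<close> \<open>diam i \<le> 1\<close> by (intro powr_mono') auto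
            finally show ?thesis .
          qed
          then show ?thesis
            using w(2) False by (auto simp: diam_power_def diam_def [symmetric] intro!: ennreal_leI)
        qed
      qed simp
      finally have "emeasure lborel (F i) \<le> ennreal C * diam_power d s (E i)" .
      moreover have "F i \<in> sets lborel" unfolding Fi by (rule balls [OF w(1)])
      moreover have "{w \<in> K. \<phi> w \<in> E i} \<subseteq> F i"
        unfolding Fi using diam_ge [OF w(2)] by auto
      ultimately show ?thesis by simp
    qed (auto simp: F_def)
    have "K \<subseteq> (\<Union>i. F i)"
    proof
      fix w assume w: "w \<in> K"
      then have "\<phi> w \<in> S" using K(3) by auto
      then obtain i where "\<phi> w \<in> E i" using E(1) by auto
      then have "w \<in> F i" using F [of i] w by auto
      then show "w \<in> (\<Union>i. F i)" by auto
    qed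
    then have "emeasure lborel K \<le> emeasure lborel (\<Union>i. F i)"
      using F by (intro emeasure_mono) auto
    also have "\<dots> \<le> (\<Sum>i. emeasure lborel (F i))"
      using F by (intro emeasure_subadditive_countably) auto
    also have "\<dots> \<le> (\<Sum>i. ennreal C * diam_power d s (E i))"
      using F by (intro suminf_le) auto
    also have "\<dots> = ennreal C * (\<Sum>i. diam_power d s (E i))"
      by simp
    also have "\<dots> \<le> ennreal C * ennreal (\<eta> / C)"
      by (intro mult_left_mono E(3)) simp
    also have "\<dots> = ennreal \<eta>"
      using \<open>C > 0\<close> \<open>\<eta> > 0\<close> by (simp add: ennreal_mult [symmetric])
    finally show ?thesis by simp
  qed
  have "emeasure lborel K \<le> 0"
    by (rule ennreal_le_epsilon) (rule small)
  with K(2) show False by simp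
qed

context homogeneous_group
begin

text \<open>The coordinates \<open>X (\<alpha> 1), \<dots>, X (\<alpha> p)\<close> of \<open>\<phi>(w)\<^sup>-\<^sup>1 \<phi>(w')\<close> depend on \<open>w'\<close> in an
  expanding way, uniformly in \<open>w\<close>, because they do so to first order at \<open>(w\<^sub>0, w\<^sub>0)\<close>.\<close>

lemma hausdorff_dim_ge_multi_deg:
  fixes \<phi> :: "real ^ 'p::finite \<Rightarrow> 'a"
  assumes \<phi>: "C1_param T W \<phi> \<phi>'" and "w\<^sub>0 \<in> W" and S: "\<phi> ` W \<subseteq> S"
    and \<alpha>: "\<alpha> \<in> multi_indices DIM('a) CARD('p)"
    and nondeg: "\<And>h. (\<And>i. i \<in> {1..CARD('p)} \<Longrightarrow> \<omega> (\<phi> w\<^sub>0) (\<phi>' w\<^sub>0 h) \<bullet> X (\<alpha> i) = 0) \<Longrightarrow> h = 0"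
    and s: "0 \<le> s" and null: "hausdorff_null d s S"
  shows "real (multi_deg V CARD('p) \<alpha>) \<le> s"
proof -
  \<comment> \<open>Vector components are indexed by the type \<open>'p\<close>, multi-indices by
    \<open>{1..CARD('p)}\<close>; \<open>e\<close> translates between them.\<close>
  obtain e :: "'p \<Rightarrow> nat" where e: "bij_betw e UNIV {1..CARD('p)}"
    using ex_bij_betw_finite_nat [of "UNIV :: 'p set"] finite_same_card_bij [of "UNIV :: 'p set" "{1..CARD('p)}"] by auto
  define a where "a j = \<alpha> (e j)" for j
  have e_in: "e j \<in> {1..CARD('p)}" for j using e by (auto simp: bij_betw_def)
  have a: "a j \<in> {1..DIM('a)}" for j
    using \<alpha> e_in [of j] unfolding a_def multi_indices_def by auto
  have sum_a: "(\<Sum>j\<in>UNIV. dg (a j)) = multi_deg V CARD('p) \<alpha>"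
    unfolding multi_deg_def a_def by (rule sum.reindex_bij_betw [OF e])
  have "open W" using \<phi> by (simp add: C1_param_def)
  have der: "(\<phi> has_derivative \<phi>' w) (at w)" if "w \<in> W" for w
    using \<phi> that by (simp add: C1_param_def)
  have cont_\<phi>: "continuous_on W \<phi>"
    using der by (meson has_derivative_at_withinI has_derivative_continuous_on)
  have cont_\<phi>': "continuous_on W \<phi>'" using \<phi> by (simp add: C1_param_def)
  define g where "g w w' = (\<chi> j. mul (- \<phi> w) (\<phi> w') \<bullet> X (a j))" for w w'
  define g' where "g' w w' h = (\<chi> j. D (- \<phi> w, \<phi> w') (0, \<phi>' w' h) \<bullet> X (a j))" for w w' h
  have der_g: "(g w has_derivative g' w w') (at w')" if "w' \<in> W" for w w'
  proof -
    have "((\<lambda>w'. mul (- \<phi> w) (\<phi> w')) has_derivative (\<lambda>h. D (- \<phi> w, \<phi> w') (0, \<phi>' w' h))) (at w')"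
      by (intro has_derivative_mul_compose has_derivative_const der that)
    then have "((\<lambda>w'. mul (- \<phi> w) (\<phi> w') \<bullet> X (a j)) has_derivative
        (\<lambda>h. D (- \<phi> w, \<phi> w') (0, \<phi>' w' h) \<bullet> X (a j))) (at w')" for j
      by (rule has_derivative_inner_left)
    then show ?thesis
      unfolding has_derivative_componentwise_within [of "g w"]
      by (auto simp: Basis_vec_def g_def g'_def inner_axis)
  qed
  have lin_g': "linear (g' w w')" if "w' \<in> W" for w w'
    using der_g [OF that] has_derivative_linear by blast
  \<comment> \<open>At \<open>w = w' = w\<^sub>0\<close> the derivative consists of the
    \<open>\<alpha>\<close> components of tangent vectors in the left invariant frame;
    \<open>nondeg\<close> says that it is injective.\<close>
  define A where "A = g' w\<^sub>0 w\<^sub>0"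
  have linA: "linear A" unfolding A_def by (rule lin_g' [OF \<open>w\<^sub>0 \<in> W\<close>])
  have injA: "inj A"
    unfolding linear_injective_0 [OF linA]
  proof (intro allI impI)
    fix h assume "A h = 0"
    then have 0: "\<omega> (\<phi> w\<^sub>0) (\<phi>' w\<^sub>0 h) \<bullet> X (a j) = 0" for j
      by (simp add: A_def g'_def \<omega>_def vec_eq_iff)
    show "h = 0"
    proof (rule nondeg)
      fix i assume "i \<in> {1..CARD('p)}"
      then have "i \<in> range e" using e by (simp add: bij_betw_def)
      then obtain j where "i = e j" by blast
      then show "\<omega> (\<phi> w\<^sub>0) (\<phi>' w\<^sub>0 h) \<bullet> X (\<alpha> i) = 0" using 0 [of j] by (simp add: a_def)
    qed
  qed
  obtain c where c: "c > 0" "\<And>h. c * norm h \<le> norm (A h)"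
    using linear_inj_bounded_below_pos [OF linA injA] by blast
  \<comment> \<open>A sum over coordinate vectors that bounds the operator norm of the difference
    and is visibly continuous in both points jointly.\<close>
  define \<kappa> where "\<kappa> q = (\<Sum>k\<in>UNIV. norm (g' (fst q) (snd q) (axis k 1) - A (axis k 1)))" for q
  have "continuous_on (W \<times> W) \<kappa>"
  proof -
    have 1: "continuous_on (W \<times> W) (\<lambda>q. \<phi> (fst q))" "continuous_on (W \<times> W) (\<lambda>q. \<phi> (snd q))"
        "continuous_on (W \<times> W) (\<lambda>q. \<phi>' (snd q))"
      by (auto intro!: continuous_on_compose2 [OF cont_\<phi>] continuous_on_compose2 [OF cont_\<phi>'] continuous_intros)
    show ?thesis
      unfolding \<kappa>_def g'_def
      by (intro continuous_intros continuous_on_vec_lambda 1)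
  qed
  then have "open (\<kappa> -` {..<c / 2} \<inter> W \<times> W)"
    using continuous_on_open_vimage [OF open_Times [OF \<open>open W\<close> \<open>open W\<close>]] open_lessThan by blast
  moreover have "\<kappa> -` {..<c / 2} \<inter> W \<times> W = {q \<in> W \<times> W. \<kappa> q < c / 2}"
    by auto
  ultimately have "open {q \<in> W \<times> W. \<kappa> q < c / 2}" by simp
  moreover have "(w\<^sub>0, w\<^sub>0) \<in> {q \<in> W \<times> W. \<kappa> q < c / 2}"
    using \<open>w\<^sub>0 \<in> W\<close> \<open>c > 0\<close> by (simp add: \<kappa>_def A_def)
  ultimately obtain U1 U2 where U: "open U1" "open U2" "w\<^sub>0 \<in> U1" "w\<^sub>0 \<in> U2" "U1 \<times> U2 \<subseteq> {q \<in> W \<times> W. \<kappa> q < c / 2}"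
    by (rule open_prod_elim) auto
  then obtain \<rho> where \<rho>: "\<rho> > 0" "cball w\<^sub>0 \<rho> \<subseteq> U1 \<inter> U2"
    using open_contains_cball [of "U1 \<inter> U2"] open_Int by blast
  define K where "K = cball w\<^sub>0 \<rho>"
  have KK: "(w, w') \<in> {q \<in> W \<times> W. \<kappa> q < c / 2}" if "w \<in> K" "w' \<in> K" for w w'
  proof -
    have "(w, w') \<in> U1 \<times> U2" using that \<rho>(2) unfolding K_def by blast
    then show ?thesis using U(5) by (rule rev_subsetD)
  qed
  have KW: "w \<in> W" if "w \<in> K" for w
    using KK [OF that that] by simp
  have \<kappa>: "\<kappa> (w, w') < c / 2" if "w \<in> K" "w' \<in> K" for w w'
    using KK [OF that] by simp
  have expanding: "c / 2 * norm (x - y) \<le> norm (g w x - g w y)" if w: "w \<in> K" and xy: "x \<in> K" "y \<in> K" for w x y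
  proof -
    \<comment> \<open>On the convex ball \<open>K\<close> the map \<open>g w - A\<close> has
      Lipschitz constant \<open>c / 2\<close>, half of the expansion of \<open>A\<close>; so half of
      the expansion survives for every \<open>w\<close>.\<close>
    have "norm ((g w x - A x) - (g w y - A y)) \<le> c / 2 * norm (x - y)"
    proof (rule differentiable_bound [of K "\<lambda>z. g w z - A z" "\<lambda>z h. g' w z h - A h"])
      show "convex K" by (simp add: K_def)
      show "((\<lambda>z. g w z - A z) has_derivative (\<lambda>h. g' w z h - A h)) (at z within K)" if "z \<in> K" for z
        by (intro has_derivative_diff has_derivative_at_withinI [OF der_g [OF KW [OF that]]]
            linear_imp_has_derivative linA)
      show "onorm (\<lambda>h. g' w z h - A h) \<le> c / 2" if z: "z \<in> K" for z
      proof (rule onorm_le)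
        fix h :: "real ^ 'p"
        have lin: "linear (\<lambda>h. g' w z h - A h)"
          using lin_g' [OF KW [OF z]] linA by (intro linear_compose_sub)
        have "g' w z h - A h = (\<Sum>k\<in>UNIV. (h $ k) *\<^sub>R (g' w z (axis k 1) - A (axis k 1)))"
        proof -
          have "h = (\<Sum>k\<in>UNIV. (h $ k) *\<^sub>R axis k 1)"
            using basis_expansion [of h] by (simp add: scalar_mult_eq_scaleR)
          then have "g' w z h - A h = g' w z (\<Sum>k\<in>UNIV. (h $ k) *\<^sub>R axis k 1) - A (\<Sum>k\<in>UNIV. (h $ k) *\<^sub>R axis k 1)"
            by simp
          also have "\<dots> = (\<Sum>k\<in>UNIV. (h $ k) *\<^sub>R (g' w z (axis k 1) - A (axis k 1)))"
            using linear_sum [OF lin, of "\<lambda>k. (h $ k) *\<^sub>R axis k 1" UNIV] linear_scale [OF lin] by simp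
          finally show ?thesis .
        qed
        then have "norm (g' w z h - A h) \<le> (\<Sum>k\<in>UNIV. \<bar>h $ k\<bar> * norm (g' w z (axis k 1) - A (axis k 1)))"
          using norm_sum [of "\<lambda>k. (h $ k) *\<^sub>R (g' w z (axis k 1) - A (axis k 1))" UNIV] by simp
        also have "\<dots> \<le> (\<Sum>k\<in>UNIV. norm h * norm (g' w z (axis k 1) - A (axis k 1)))"
          by (intro sum_mono mult_right_mono component_le_norm_cart) simp
        also have "\<dots> = \<kappa> (w, z) * norm h" by (simp add: \<kappa>_def sum_distrib_left mult.commute)
        also have "\<dots> \<le> c / 2 * norm h" using \<kappa> [OF w z] by (intro mult_right_mono) auto
        finally show "norm (g' w z h - A h) \<le> c / 2 * norm h" .
      qed
    qed (use xy in auto)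
    moreover have "c * norm (x - y) \<le> norm (A x - A y)"
      using c(2) [of "x - y"] linear_diff [OF linA, of x y] by simp
    moreover have "norm (A x - A y) \<le> norm (g w x - g w y) + norm ((g w x - A x) - (g w y - A y))"
      using norm_triangle_ineq4 [of "g w x - g w y" "(g w x - A x) - (g w y - A y)"] by (simp add: algebra_simps)
    ultimately show ?thesis by (simp add: field_simps)
  qed
  obtain C where C: "C > 0" "\<And>y i. i \<in> {1..DIM('a)} \<Longrightarrow> \<bar>y \<bullet> X i\<bar> \<le> C * d 0 y ^ dg i"
    using coords_le_d by blast
  have cont_K: "continuous_on K \<phi>" using cont_\<phi> KW continuous_on_subset by blast
  have compact_ball: "compact {w' \<in> K. d (\<phi> w) (\<phi> w') \<le> r}" for w r
  proof -
    have "compact K" by (simp add: K_def)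
    moreover have "closed (K \<inter> (\<lambda>w'. d (\<phi> w) (\<phi> w')) -` {..r})"
      by (intro continuous_closed_preimage continuous_intros cont_K) (auto simp: K_def)
    ultimately have "compact (K \<inter> (K \<inter> (\<lambda>w'. d (\<phi> w) (\<phi> w')) -` {..r}))"
      by (rule compact_Int_closed)
    moreover have "K \<inter> (K \<inter> (\<lambda>w'. d (\<phi> w) (\<phi> w')) -` {..r}) = {w' \<in> K. d (\<phi> w) (\<phi> w') \<le> r}"
      by auto
    ultimately show ?thesis by simp
  qed
  have mass: "emeasure lborel {w' \<in> K. d (\<phi> w) (\<phi> w') \<le> r} \<le>
      ennreal ((4 * real CARD('p) / (c / 2) * C) ^ CARD('p) * r ^ multi_deg V CARD('p) \<alpha>)"
    if w: "w \<in> K" and r: "0 \<le> r" for w r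
  proof -
    let ?F = "{w' \<in> K. d (\<phi> w) (\<phi> w') \<le> r}"
    \<comment> \<open>The target box has sides proportional to \<open>r ^ dg (a j)\<close>, so the
      exponents add up to the degree of \<open>\<alpha>\<close>.\<close>
    have "measure lborel ?F \<le> (\<Prod>j\<in>UNIV. 4 * real CARD('p) / (c / 2) * (C * r ^ dg (a j)))"
    proof (rule measure_le_prod_if_expanding [where f = "g w"])
      show "?F \<in> sets lborel" "bounded ?F"
        using borel_compact [OF compact_ball [of w r]] compact_imp_bounded [OF compact_ball [of w r]]
        by simp_all
      show "c / 2 * norm (x - y) \<le> norm (g w x - g w y)" if "x \<in> ?F" "y \<in> ?F" for x y
        using that by (intro expanding w) auto
      show "\<bar>g w x $ j\<bar> \<le> C * r ^ dg (a j)" if "x \<in> ?F" for x j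
      proof -
        have "\<bar>g w x $ j\<bar> \<le> C * d 0 (mul (- \<phi> w) (\<phi> x)) ^ dg (a j)"
          unfolding g_def using C(2) [OF a] by simp
        also have "\<dots> \<le> C * r ^ dg (a j)"
          using that C(1) d_left [of "\<phi> w" "\<phi> x"] by (intro mult_left_mono power_mono) auto
        finally show ?thesis .
      qed
    qed (use c C r in auto)
    also have "\<dots> = (4 * real CARD('p) / (c / 2) * C) ^ CARD('p) * r ^ multi_deg V CARD('p) \<alpha>"
      unfolding mult.assoc [symmetric] sum_a [symmetric] power_sum prod.distrib
      by (simp only: prod_constant power_mult_distrib)
    finally have "ennreal (measure lborel ?F) \<le>
        ennreal ((4 * real CARD('p) / (c / 2) * C) ^ CARD('p) * r ^ multi_deg V CARD('p) \<alpha>)"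
      by (rule ennreal_leI)
    moreover have "emeasure lborel ?F = ennreal (measure lborel ?F)"
      using emeasure_compact_finite [OF compact_ball [of w r]] by (simp add: emeasure_eq_ennreal_measure)
    ultimately show ?thesis by simp
  qed
  show ?thesis
  proof (rule mass_distribution_principle [where K = K and \<phi> = \<phi>, OF nonneg _ _ _ _ mass _ _ s null])
    show "K \<in> sets lborel" by (simp add: K_def)
    show "0 < emeasure lborel K"
    proof -
      have "emeasure lborel (ball w\<^sub>0 \<rho>) \<noteq> 0"
        using \<rho>(1) open_not_negligible [OF open_ball, of w\<^sub>0 \<rho>] by (auto simp: negligible_iff_emeasure0)
      moreover have "emeasure lborel (ball w\<^sub>0 \<rho>) \<le> emeasure lborel K"
        unfolding K_def by (intro emeasure_mono) auto
      ultimately show ?thesis by (metis gr_zeroI le_zero_eq)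
    qed
    show "\<phi> ` K \<subseteq> S" using KW S by blast
    show "{w' \<in> K. d (\<phi> w) (\<phi> w') \<le> r} \<in> sets lborel" for w r
      using borel_compact [OF compact_ball [of w r]] by simp
    show "0 < (4 * real CARD('p) / (c / 2) * C) ^ CARD('p)" using c C by simp
    show "0 < multi_deg V CARD('p) \<alpha>"
    proof -
      have "\<alpha> 1 \<in> {1..DIM('a)}" using \<alpha> by (auto simp: multi_indices_def Suc_le_eq)
      then have "0 < dg (\<alpha> 1)" using deg_bounds(3) by force
      also have "\<dots> \<le> multi_deg V CARD('p) \<alpha>"
        unfolding multi_deg_def by (intro member_le_sum) (auto simp: Suc_le_eq)
      finally show ?thesis .
    qed
  qed
qed

text \<open>Joins the two bounds. The inequality \<open>CARD('p) \<le> DIM('a)\<close> is recorded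
  because the closed formula subtracts \<open>p\<close> from \<open>DIM('a) + 1\<close> in the
  naturals.\<close>

theorem hausdorff_dim_transversal:
  assumes S: "C1_submanifold TYPE('p::finite) S T" and trans: "transversal TYPE('p) mul V X S T"
  shows "hausdorff_dim d S = ereal (real (max_deg V CARD('p)))" and "CARD('p) \<le> DIM('a)"
proof -
  obtain x where x: "x \<in> S" "point_deg TYPE('p) mul V X T x = max_deg V CARD('p)"
    using trans by (auto simp: transversal_def)
  obtain W and \<phi> :: "real ^ 'p \<Rightarrow> 'a" and \<phi>' and w where \<phi>: "C1_param T W \<phi> \<phi>'" "w \<in> W" "\<phi> w = x"
  proof -
    have "\<exists>W (\<phi> :: real ^ 'p \<Rightarrow> 'a) \<phi>'. C1_param T W \<phi> \<phi>' \<and> x \<in> \<phi> ` W"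
      using S x(1) by (simp add: C1_submanifold_def)
    then show ?thesis using that by (elim exE conjE imageE) metis
  qed
  have inj: "inj (\<phi>' w)" using \<phi> by (simp add: C1_param_def)
  have lin: "linear (\<phi>' w)"
    using blinfun.bounded_linear_right linear_conv_bounded_linear by blast
  have tangent: "tangent_space TYPE('p) T x = range (\<phi>' w)"
    using tangent_space_eq [OF \<phi>(1,2)] \<phi>(3) by simp
  have dim: "dim (range (\<phi>' w)) = CARD('p)"
    using dim_image_eq [OF lin, of UNIV] inj by simp
  then show p: "CARD('p) \<le> DIM('a)"
    using dim_subset_UNIV [of "range (\<phi>' w)"] by simp
  \<comment> \<open>The vectors \<open>adjoint (\<omega> x) (X j)\<close> represent the coframe dual
    to the left invariant frame at \<open>x\<close>: pairing with them gives the coordinates of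
    \<open>\<omega> x v\<close>.\<close>
  have dual: "left_inv_field mul (X i) x \<bullet> adjoint (\<omega> x) (X j) = (if i = j then 1 else 0)"
    if "i \<in> {1..DIM('a)}" "j \<in> {1..DIM('a)}" for i j
    using X_inner [OF that] by (simp add: adjoint_works [OF linear_\<omega>] \<omega>_left_inv_field)
  obtain \<alpha> where \<alpha>: "\<alpha> \<in> multi_indices DIM('a) CARD('p)" "multi_deg V CARD('p) \<alpha> = max_deg V CARD('p)"
      "\<And>v. v \<in> range (\<phi>' w) \<Longrightarrow> (\<And>i. i \<in> {1..CARD('p)} \<Longrightarrow> v \<bullet> adjoint (\<omega> x) (X (\<alpha> i)) = 0) \<Longrightarrow> v = 0"
  proof (rule point_deg_witness [where 'p = 'p, of mul X x "\<lambda>j. adjoint (\<omega> x) (X j)" T V])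
    show "subspace (tangent_space TYPE('p) T x)"
      unfolding tangent by (rule linear_subspace_image [OF lin subspace_UNIV])
    show "dim (tangent_space TYPE('p) T x) = CARD('p)"
      by (simp add: tangent dim)
  qed (use dual x(2) tangent in auto)
  have nondeg: "h = 0" if "\<And>i. i \<in> {1..CARD('p)} \<Longrightarrow> \<omega> (\<phi> w) (\<phi>' w h) \<bullet> X (\<alpha> i) = 0" for h
  proof -
    have "\<phi>' w h = 0"
      using that \<phi>(3) by (intro \<alpha>(3)) (auto simp: adjoint_works [OF linear_\<omega>])
    then show ?thesis using inj linear_injective_0 [OF lin] by blast
  qed
  have "\<phi> ` W \<subseteq> S"
    using \<phi>(1) S openin_subset unfolding C1_param_def C1_submanifold_def by blast
  then have lower: "real (max_deg V CARD('p)) \<le> s" if "0 \<le> s" "hausdorff_null d s S" for s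
    using hausdorff_dim_ge_multi_deg [OF \<phi>(1,2) _ \<alpha>(1) nondeg that] \<alpha>(2) by simp
  show "hausdorff_dim d S = ereal (real (max_deg V CARD('p)))"
  proof (rule antisym)
    show "ereal (real (max_deg V CARD('p))) \<le> hausdorff_dim d S"
      unfolding hausdorff_dim_def hausdorff_null_iff [symmetric]
      using lower by (intro INF_greatest) auto
    show "hausdorff_dim d S \<le> ereal (real (max_deg V CARD('p)))"
    \<comment> \<open>The covering yields measure zero only for exponents strictly above the maximal
      degree.\<close>
    proof (rule ereal_le_epsilon2)
      fix \<epsilon> :: real assume "0 < \<epsilon>"
      then have "hausdorff_null d (real (max_deg V CARD('p)) + \<epsilon>) S"
        by (intro hausdorff_null_submanifold [OF S p]) simp
      then have "hausdorff_dim d S \<le> ereal (real (max_deg V CARD('p)) + \<epsilon>)"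
        unfolding hausdorff_dim_def hausdorff_null_iff [symmetric] using \<open>0 < \<epsilon>\<close>
        by (intro INF_lower) auto
      then show "hausdorff_dim d S \<le> ereal (real (max_deg V CARD('p))) + ereal \<epsilon>" by simp
    qed
  qed
qed

end

theorem mainTheorem4:
  fixes mul :: "'a::euclidean_space \<Rightarrow> 'a \<Rightarrow> 'a"
    and V :: "nat \<Rightarrow> 'a set"
    and \<iota> :: nat
    and X :: "nat \<Rightarrow> 'a"
    and d :: "'a \<Rightarrow> 'a \<Rightarrow> real"
    and S :: "'a set"
    and T :: "'a topology"
    and p l :: nat
  assumes "stratified_group mul V \<iota>"
    and "graded_basis V \<iota> X"
    and "homogeneous_distance mul V X d"
    and "p = CARD('p::finite)"
    and "C1_submanifold TYPE('p) S T"
    and "transversal TYPE('p) mul V X S T"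
    and "l = deg V (DIM('a) + 1 - p)"
  shows "hausdorff_dim d S = ereal (real (max_deg V p)) \<and>
         real (max_deg V p) =
           (\<Sum>j=l+1..\<iota>. real j * real (dim (V j))) +
           real l * (real p - (\<Sum>j=l+1..\<iota>. real (dim (V j))))"
proof -
  interpret homogeneous_group mul V \<iota> X d
  proof
    show "exponential_lie_group mul"
      using assms(1) by (simp add: stratified_group_def)
  qed (use assms in auto)
  have "1 \<le> p" by (simp add: assms(4) Suc_le_eq)
  then show ?thesis
    using hausdorff_dim_transversal [OF assms(5,6)] max_deg_formula_real [of p l] assms(4,7) by simp
qed

end
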